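(* Let $n\ge6$ and $3\le\Delta\le n-3$, and consider the class $\mathfrak U(n,\Delta)$ of unicyclic graphs with $n$ vertices and maximum degree $\Delta$. Among graphs in $\mathfrak U(n,\Delta)$: (i) if $\Delta=3$, then $U_{n,4,n-2}$ is the unique graph with maximum reverse degree distance; (ii) if $\Delta=4$ and $n=7$, then $U_{7,3,4}$ is the unique graph with maximum reverse degree distance; (iii) if $\Delta=4$ and $n>7$ is odd, then $U^k_{n,4,n-3}\big(\frac{n-5}{2},\frac{n-5}{2}\big)$ for $k=0,1$ are the unique graphs with maximum reverse degree distance; (iv) if $\Delta=4$ and $n\ge6$ is even, or $5\le\Delta\le n-3$, then: $U_{n,4,n-\Delta+1}$ is the unique graph with maximum reverse degree distance if $\lfloor\frac{n-\Delta}{2}\rfloor>\frac{n+4}{6}$; $U_{n,3,n-\Delta+1}$ and $U_{n,4,n-\Delta+1}$ are the unique graphs with maximum reverse degree distance if $\lfloor\frac{n-\Delta}{2}\rfloor=\frac{n+4}{6}$; $U_{n,3,n-\Delta+1}$ is the unique graph with maximum reverse degree distance if $\lfloor\frac{n-\Delta}{2}\rfloor<\frac{n+4}{6}$.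
   Context: All graphs are finite, simple and connected; uniqueness is up to isomorphism. For a graph $G$, $d_G(x,y)$ is the distance, $D_G(x)=\sum_{y}d_G(x,y)$, $d_G(x)$ the degree, and $D'(G)=\sum_{x}d_G(x)D_G(x)$ the degree distance. The reverse degree distance of a graph $G$ with $n$ vertices, $e$ edges and diameter $d$ is ${}^rD'(G)=2(n-1)ed-D'(G)$. A unicyclic graph is a connected graph with exactly one cycle. Attaching a path $P_s$ ($s\ge1$) to $w$ means adding new vertices $w_1,\dots,w_s$ with edges $ww_1,w_1w_2,\dots,w_{s-1}w_s$ (nothing for $s=0$); attaching $h$ pendant vertices to $w$ means adding $h$ new vertices each joined only to $w$. For integers $n,m,d$ let $h=n-d-\lfloor\frac{m+1}{2}\rfloor$. For integers $a\ge b\ge0$ with $a\ge1$, $a+b=d-\lfloor\frac m2\rfloor$, and $0\le k\le\lfloor\frac m4\rfloor$, $U^k_{n,m,d}(a,b)$ is the graph obtained from the cycle $C_m=v_0v_1\cdots v_{m-1}v_0$ by attaching a path $P_a$ to $v_0$, a path $P_b$ to $v_{\lfloor m/2\rfloor}$, and $h$ pendant vertices to $v_k$; $U_{n,m,d}(a,b)=U^0_{n,m,d}(a,b)$. Let $\alpha=\frac{h\lfloor m/2\rfloor}{n-d-\frac12}$, let $\gamma,\theta$ be nonnegative integers with $\gamma+\theta=d-\lfloor\frac m2\rfloor$ such that $\gamma-\theta$ is as large as possible subject to $\gamma-\theta\le\alpha+1$, and $U_{n,m,d}=U_{n,m,d}(\gamma,\theta)$.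
   Formalization: In (iii), the graph with k=1 has maximum degree 3, so it is not in the class for Δ=4; the formal statement claims only that k=0 is a maximiser, that k=1 has the same reverse degree distance, and that every maximiser is isomorphic to one of the two. *)

theory Defs
  imports
    Complex_Main
    "Graph_Theory.Pair_Digraph"
    "Graph_Theory.Digraph_Component"
    "Graph_Theory.Digraph_Isomorphism"
begin

text \<open>
  Finite simple graphs are represented by \<^locale>\<open>pair_graph\<close>: a finite vertex set together with a
  symmetric irreflexive relation on it. An undirected edge thus corresponds to a pair of
  opposite arcs.
\<close>

type_synonym 'a ugraph = "'a pair_pre_digraph"

definition uedges :: "'a ugraph \<Rightarrow> 'a set set" where
  "uedges G = (\<lambda>(u, v). {u, v}) ` parcs G"

abbreviation degree :: "'a ugraph \<Rightarrow> 'a \<Rightarrow> nat" where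
  "degree G x \<equiv> out_degree (with_proj G) x"

definition max_degree :: "'a ugraph \<Rightarrow> nat" where
  "max_degree G = Max (degree G ` pverts G)"

definition gdist :: "'a ugraph \<Rightarrow> 'a \<Rightarrow> 'a \<Rightarrow> nat" where
  "gdist G x y = (LEAST l. \<exists>p. pre_digraph.awalk (with_proj G) x p y \<and> length p = l)"

definition diameter :: "'a ugraph \<Rightarrow> nat" where
  "diameter G = Max {gdist G x y | x y. x \<in> pverts G \<and> y \<in> pverts G}"

definition transmission :: "'a ugraph \<Rightarrow> 'a \<Rightarrow> nat" where
  "transmission G x = (\<Sum>y\<in>pverts G. gdist G x y)"

definition degree_distance :: "'a ugraph \<Rightarrow> nat" where
  "degree_distance G = (\<Sum>x\<in>pverts G. degree G x * transmission G x)"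

definition reverse_degree_distance :: "'a ugraph \<Rightarrow> int" where
  "reverse_degree_distance G =
     2 * (int (card (pverts G)) - 1) * int (card (uedges G)) * int (diameter G)
       - int (degree_distance G)"

text \<open>
  The library's \<^const>\<open>pre_digraph.cycle\<close> is a closed directed walk without repeated vertices. In a
  symmetric digraph it also admits walks \<open>u, v, u\<close> along a single edge, hence the bound on the
  length. An undirected cycle is identified with its edge set, so that the choice of starting
  vertex and of direction does not matter when cycles are counted.
\<close>

definition cycle_edge_sets :: "'a ugraph \<Rightarrow> 'a set set set" where
  "cycle_edge_sets G =
     {(\<lambda>(u, v). {u, v}) ` set p | p. pre_digraph.cycle (with_proj G) p \<and> 3 \<le> length p}"

definition unicyclic :: "'a ugraph \<Rightarrow> bool" where
  "unicyclic G \<longleftrightarrow>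
     pair_graph G \<and> Digraph_Component.connected (with_proj G) \<and> (\<exists>!C. C \<in> cycle_edge_sets G)"

definition unicyclic_class :: "nat \<Rightarrow> nat \<Rightarrow> 'a ugraph set" where
  "unicyclic_class n \<Delta> = {G. unicyclic G \<and> card (pverts G) = n \<and> max_degree G = \<Delta>}"

abbreviation graph_iso :: "'a ugraph \<Rightarrow> 'b ugraph \<Rightarrow> bool" where
  "graph_iso G H \<equiv> digraph_iso (with_proj G) (with_proj H)"

definition is_maximal :: "nat \<Rightarrow> nat \<Rightarrow> 'a ugraph \<Rightarrow> bool" where
  "is_maximal n \<Delta> G \<longleftrightarrow>
     G \<in> unicyclic_class n \<Delta> \<and>
     (\<forall>H :: 'a ugraph. H \<in> unicyclic_class n \<Delta> \<longrightarrow>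
        reverse_degree_distance H \<le> reverse_degree_distance G)"

text \<open>
  Maximality compares graphs on one vertex type. It is used with \<^typ>\<open>nat\<close>, where every finite
  graph has an isomorphic copy.
\<close>

definition unique_maximal_graphs :: "nat \<Rightarrow> nat \<Rightarrow> 'a ugraph set \<Rightarrow> bool" where
  "unique_maximal_graphs n \<Delta> S \<longleftrightarrow>
     (\<forall>H \<in> S. is_maximal n \<Delta> H) \<and>
     (\<forall>G :: 'a ugraph. is_maximal n \<Delta> G \<longrightarrow> (\<exists>H \<in> S. graph_iso G H))"

text \<open>
  In the edge sets below each edge occurs in one orientation only; the new vertices are
  \<open>s, s + 1, \<dots>\<close>.
\<close>

definition cycle_edges :: "nat \<Rightarrow> nat rel" where
  "cycle_edges m = {(i, (i + 1) mod m) | i. i < m}"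

definition path_edges :: "nat \<Rightarrow> nat \<Rightarrow> nat \<Rightarrow> nat rel" where
  "path_edges w s l = {(if j = 0 then w else s + (j - 1), s + j) | j. j < l}"

definition pendant_edges :: "nat \<Rightarrow> nat \<Rightarrow> nat \<Rightarrow> nat rel" where
  "pendant_edges w s l = {(w, s + j) | j. j < l}"

definition pendant_count :: "nat \<Rightarrow> nat \<Rightarrow> nat \<Rightarrow> nat" where
  "pendant_count n m d = n - d - (m + 1) div 2"

text \<open>
  The vertex \<open>v\<^sub>i\<close> of the cycle is \<open>i\<close>; the numbers from \<open>m\<close> on are, in this order, the vertices of
  the path at \<open>v\<^sub>0\<close>, those of the path at the vertex of index \<open>m div 2\<close>, and the pendant vertices.
  For \<open>a + b = d - m div 2\<close> and \<open>d + (m + 1) div 2 \<le> n\<close> there are \<open>n\<close> vertices in total.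
\<close>

definition U_graph :: "nat \<Rightarrow> nat \<Rightarrow> nat \<Rightarrow> nat \<Rightarrow> nat \<Rightarrow> nat \<Rightarrow> nat ugraph" where
  "U_graph k n m d a b =
     (let h = pendant_count n m d;
          E = cycle_edges m \<union> path_edges 0 m a \<union> path_edges (m div 2) (m + a) b
                \<union> pendant_edges k (m + a + b) h
      in \<lparr>pverts = {..<m + a + b + h}, parcs = E \<union> E\<inverse>\<rparr>)"

text \<open>
  For \<open>m = 4\<close>, \<open>d = n - 3\<close> and \<open>k = 1\<close> there is one pendant vertex, and the vertex \<open>v\<^sub>1\<close> carrying
  it has degree \<open>3\<close>; so \<open>U_graph 1 n 4 (n - 3) a a\<close> has maximum degree \<open>3\<close>, in contrast to
  \<open>U_graph 0 n 4 (n - 3) a a\<close>, whose maximum degree is \<open>4\<close> for \<open>a \<ge> 1\<close>.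
\<close>

definition alpha :: "nat \<Rightarrow> nat \<Rightarrow> nat \<Rightarrow> real" where
  "alpha n m d = real (pendant_count n m d * (m div 2)) / (real n - real d - 1 / 2)"

definition admissible_lengths :: "nat \<Rightarrow> nat \<Rightarrow> nat \<Rightarrow> (nat \<times> nat) set" where
  "admissible_lengths n m d =
     {(g, t). g + t = d - m div 2 \<and> real g - real t \<le> alpha n m d + 1}"

definition opt_lengths :: "nat \<Rightarrow> nat \<Rightarrow> nat \<Rightarrow> nat \<times> nat" where
  "opt_lengths n m d =
     (THE p. p \<in> admissible_lengths n m d \<and>
        (\<forall>q \<in> admissible_lengths n m d. int (fst q) - int (snd q) \<le> int (fst p) - int (snd p)))"

definition U_opt :: "nat \<Rightarrow> nat \<Rightarrow> nat \<Rightarrow> nat ugraph" where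
  "U_opt n m d = U_graph 0 n m d (fst (opt_lengths n m d)) (snd (opt_lengths n m d))"

end

theory Submission
  imports Defs
begin

text \<open>
  Summing over the vertices \<open>y\<close>, the degree distance is the sum of \<open>d(y, u)\<close> over all arcs \<open>(u, v)\<close>.
  A breadth-first tree from \<open>y\<close> accounts for all edges but one, so \<open>D'(G)\<close> is at least
  \<open>2 * (\<Sum>y. D(y)) - n * (n - 2)\<close>. Comparing each vertex \<open>x\<close> off a diametral path \<open>p 0, \<dots>, p d\<close> with
  the pairs \<open>p i\<close>, \<open>p (d - i)\<close> by the triangle inequality then bounds the reverse degree distance by
  a function of \<open>n\<close> and the diameter \<open>d\<close> that increases with \<open>d\<close>.

  At most three vertices of the closed neighbourhood of a vertex of degree \<open>\<Delta>\<close> lie on a diametral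
  path, hence \<open>d \<le> n - \<Delta> + 1\<close>. If equality holds, the graph consists of the path, of \<open>\<Delta> - 2\<close>
  further neighbours of an inner vertex \<open>p c\<close>, and of one more edge, which closes a triangle or a
  4-cycle. For smaller diameters the bound above is below the value of \<open>U_opt n 3 (n - \<Delta> + 1)\<close>;
  for \<open>d = n - \<Delta> + 1\<close> the value is a quadratic function of \<open>c\<close> for each kind of extra edge.
\<close>

section \<open>Distances in connected graphs\<close>

text \<open>The special cases come from integer rounding. Put \<open>d = n - \<Delta> + 1\<close>
  and \<open>R = 2 * (n - d - 1) + 1\<close>, which is \<open>2 * \<Delta> - 3\<close>. Moving the
  vertex of large degree by \<open>k\<close> positions along the path changes three times the value
  by \<open>6 * k * (R * (k + t) + B)\<close>, where \<open>t\<close> measures how far the old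
  position is from the middle, and \<open>B\<close> is 3 for a triangle on a path edge and 6 for a
  4-cycle. If \<open>B < R\<close>, the middle position rounded down is the only optimum. For the
  4-cycle this condition fails exactly when \<open>R\<close> is 3 or 5, that is for \<Delta> = 3 and
  \<Delta> = 4, where the optimum can slip down by one position; this separates the cases (i) to
  (iii) from (iv). The threshold \<open>(n + 4) / 6\<close> is where the two kinds of graph tie in
  the same position \<open>c\<close>: their tripled values differ by
  \<open>18 * (d - c) - 3 * n - 30\<close>, and \<open>d - c\<close> is
  \<open>(n - \<Delta>) div 2 + 1\<close> there. Values are tripled throughout because the distances
  inside a path sum to \<open>d * (d + 1) * (d + 2) / 3\<close>.\<close>

locale conn_graph = pair_graph +
  assumes conn: "Digraph_Component.connected (with_proj G)"
begin

lemma sym_arc: "(u, v) \<in> parcs G \<Longrightarrow> (v, u) \<in> parcs G"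
  by (rule arcs_symmetric)

lemma fin_V [simp]: "finite (pverts G)" and fin_A [simp]: "finite (parcs G)"
  by (simp_all add: pair_finite_verts pair_finite_arcs)

lemma ex_walk:
  assumes "u \<in> pverts G" "v \<in> pverts G"
  shows "\<exists>p. awalk u p v"
proof -
  \<comment> \<open>\<open>connected\<close> speaks of the symmetric closure, which changes nothing
    for a symmetric arc set.\<close>
  have "mk_symmetric (with_proj G) = G"
    by (rule pair_pre_digraph.equality) (auto simp: mk_symmetric_def intro: sym_arc)
  then have "reachable (with_proj G) u v"
    using conn assms unfolding Digraph_Component.connected_def strongly_connected_def by simp
  then show ?thesis by (simp add: reachable_awalk)
qed

lemma gdist_le: "awalk u p v \<Longrightarrow> gdist G u v \<le> length p"
  unfolding gdist_def by (rule Least_le) auto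

lemma gdist_walk:
  assumes "u \<in> pverts G" "v \<in> pverts G"
  obtains p where "awalk u p v" "length p = gdist G u v"
proof -
  have "\<exists>l. \<exists>p. awalk u p v \<and> length p = l" using ex_walk[OF assms] by auto
  from LeastI_ex[OF this] have "\<exists>p. awalk u p v \<and> length p = gdist G u v" by (simp only: gdist_def)
  then show ?thesis using that by blast
qed

lemma gdist_self [simp]: "u \<in> pverts G \<Longrightarrow> gdist G u u = 0"
proof -
  assume "u \<in> pverts G"
  then have "awalk u [] u" by (simp add: awalk_Nil_iff)
  from gdist_le[OF this] show ?thesis by simp
qed

lemma gdist_eq_0: "u \<in> pverts G \<Longrightarrow> v \<in> pverts G \<Longrightarrow> gdist G u v = 0 \<longleftrightarrow> u = v"
  by (metis gdist_walk gdist_self awalk_Nil_iff length_0_conv)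

lemma gdist_sym:
  assumes "u \<in> pverts G" "v \<in> pverts G"
  shows "gdist G u v = gdist G v u"
proof -
  have len: "length (rev_path p) = length p" for p :: "('a \<times> 'a) list"
    by (induction p) auto
  have "gdist G v u \<le> gdist G u v" if uv: "u \<in> pverts G" "v \<in> pverts G" for u v
  proof -
    obtain p where "awalk u p v" "length p = gdist G u v" using uv gdist_walk by blast
    moreover have "awalk v (rev_path p) u" using calculation(1) by (simp only: awalk_rev_path)
    ultimately show ?thesis using gdist_le[of v "rev_path p" u] by (simp only: len)
  qed
  from this[OF assms] this[OF assms(2,1)] show ?thesis by simp
qed

lemma gdist_triangle:
  assumes "u \<in> pverts G" "v \<in> pverts G" "w \<in> pverts G"
  shows "gdist G u w \<le> gdist G u v + gdist G v w"
proof -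
  obtain p where p: "awalk u p v" "length p = gdist G u v" using assms gdist_walk by blast
  obtain q where q: "awalk v q w" "length q = gdist G v w" using assms gdist_walk by blast
  have "awalk u (p @ q) w" using p q by auto
  from gdist_le[OF this] show ?thesis using p q by simp
qed

lemma gdist_arc:
  assumes "(u, v) \<in> parcs G" shows "gdist G u v = 1"
proof -
  have "awalk u [(u, v)] v" using assms by (auto simp: awalk_simps in_arcsD1 in_arcsD2)
  from gdist_le[OF this] have "gdist G u v \<le> 1" by simp
  moreover have "gdist G u v \<noteq> 0"
    using gdist_eq_0[of u v] no_loops'[OF assms] in_arcsD1[OF assms] in_arcsD2[OF assms] by blast
  ultimately show ?thesis by simp
qed

lemma gdist_1_arc:
  assumes "u \<in> pverts G" "v \<in> pverts G" "gdist G u v = 1"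
  shows "(u, v) \<in> parcs G"
proof -
  obtain p where p: "awalk u p v" "length p = 1" using assms gdist_walk by metis
  then obtain e where "p = [e]" by (auto simp: length_Suc_conv)
  then show ?thesis using p by (auto simp: awalk_simps)
qed

lemma gdist_step:
  assumes "u \<in> pverts G" "(v, w) \<in> parcs G"
  shows "gdist G u w \<le> gdist G u v + 1"
  using gdist_triangle[OF assms(1) in_arcsD1[OF assms(2)] in_arcsD2[OF assms(2)]]
  by (simp add: gdist_arc[OF assms(2)])

lemma gdist_pred:
  assumes "u \<in> pverts G" "v \<in> pverts G" "gdist G u v = Suc k"
  obtains w where "(w, v) \<in> parcs G" "gdist G u w = k"
proof -
  obtain p where p: "awalk u p v" "length p = Suc k" using assms gdist_walk by metis
  then obtain q e where pq: "p = q @ [e]" by (metis length_Suc_conv_rev)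
  then have e: "awalk u q (fst e)" "e \<in> parcs G" "snd e = v" "length q = k"
    using p by (auto simp: awalk_simps)
  then have "(fst e, v) \<in> parcs G" by auto
  moreover have "gdist G u (fst e) \<le> k" using gdist_le[OF e(1)] e(4) by simp
  moreover have "Suc k \<le> gdist G u (fst e) + 1"
    using gdist_step[OF assms(1) \<open>(fst e, v) \<in> parcs G\<close>] assms by simp
  ultimately show ?thesis using that by (metis Suc_eq_plus1 Suc_le_mono le_antisym)
qed

text \<open>A function that vanishes at \<open>u\<close> and grows by at most one along every arc
  cannot outrun a shortest walk; the induction on the distance peels off the last arc.\<close>

lemma gdist_ge_potential:
  assumes "u \<in> pverts G" "v \<in> pverts G" "\<delta> u = 0"
    and "\<And>x y. (x, y) \<in> parcs G \<Longrightarrow> \<delta> y \<le> \<delta> x + (1::nat)"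
  shows "\<delta> v \<le> gdist G u v"
proof -
  have "v \<in> pverts G \<Longrightarrow> gdist G u v = k \<Longrightarrow> \<delta> v \<le> k" for k v
  proof (induction k arbitrary: v)
    case 0 then show ?case using gdist_eq_0 assms by auto
  next
    case (Suc k)
    then obtain w where w: "(w, v) \<in> parcs G" "gdist G u w = k" using gdist_pred assms(1) by metis
    then have "\<delta> w \<le> k" using Suc in_arcsD1 by blast
    then show ?case using assms(4)[OF w(1)] by simp
  qed
  then show ?thesis using assms by blast
qed

text \<open>The last premise gives every vertex other than \<open>u\<close> a neighbour of smaller
  potential. Descending along these neighbours reaches \<open>u\<close> after
  \<open>\<delta> v\<close> steps, which matches the lower bound.\<close>

lemma gdist_eq_potential:
  assumes "u \<in> pverts G" "v \<in> pverts G" "\<delta> u = 0"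
    and "\<And>x y. (x, y) \<in> parcs G \<Longrightarrow> \<delta> y \<le> \<delta> x + (1::nat)"
    and "\<And>x. x \<in> pverts G \<Longrightarrow> x \<noteq> u \<Longrightarrow> \<exists>y. (y, x) \<in> parcs G \<and> \<delta> x = Suc (\<delta> y)"
  shows "gdist G u v = \<delta> v"
proof (rule antisym)
  have "x \<in> pverts G \<Longrightarrow> \<delta> x = k \<Longrightarrow> gdist G u x \<le> k" for k x
  proof (induction k arbitrary: x)
    case 0 then show ?case using assms(1) assms(5)[of x] by (cases "x = u") auto
  next
    case (Suc k)
    then have "x \<noteq> u" using assms(3) by auto
    then obtain y where y: "(y, x) \<in> parcs G" "\<delta> x = Suc (\<delta> y)" using assms(5) Suc by blast
    then have "gdist G u y \<le> k" using Suc in_arcsD1 by auto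
    then show ?case using gdist_step[OF assms(1) y(1)] by simp
  qed
  then show "gdist G u v \<le> \<delta> v" using assms by blast
qed (use gdist_ge_potential[of u v \<delta>] assms(1-4) in blast)

lemma finite_gdists: "finite {gdist G x y | x y. x \<in> pverts G \<and> y \<in> pverts G}"
proof -
  have "{gdist G x y | x y. x \<in> pverts G \<and> y \<in> pverts G} = (\<lambda>(x, y). gdist G x y) ` (pverts G \<times> pverts G)"
    by auto
  then show ?thesis by simp
qed

lemma gdist_le_diameter:
  assumes "u \<in> pverts G" "v \<in> pverts G"
  shows "gdist G u v \<le> diameter G"
  unfolding diameter_def using finite_gdists assms by (intro Max_ge) auto

lemma verts_ne: "pverts G \<noteq> {}"
  using conn by (auto simp: Digraph_Component.connected_def strongly_connected_def mk_symmetric_def)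

lemma diameter_attained:
  obtains u v where "u \<in> pverts G" "v \<in> pverts G" "gdist G u v = diameter G"
proof -
  have "diameter G \<in> {gdist G x y | x y. x \<in> pverts G \<and> y \<in> pverts G}"
    unfolding diameter_def using finite_gdists verts_ne by (intro Max_in) auto
  then show ?thesis using that by auto
qed

lemma diameter_eqI:
  assumes "\<And>u v. u \<in> pverts G \<Longrightarrow> v \<in> pverts G \<Longrightarrow> gdist G u v \<le> d"
    and "x \<in> pverts G" "y \<in> pverts G" "gdist G x y = d"
  shows "diameter G = d"
proof (rule antisym)
  show "diameter G \<le> d" using diameter_attained assms(1) by metis
  show "d \<le> diameter G" using gdist_le_diameter[OF assms(2,3)] assms(4) by simp
qed

definition geodesic :: "(nat \<Rightarrow> 'a) \<Rightarrow> nat \<Rightarrow> bool" where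
  "geodesic p d \<longleftrightarrow> (\<forall>i\<le>d. p i \<in> pverts G) \<and> (\<forall>i j. i \<le> j \<longrightarrow> j \<le> d \<longrightarrow> gdist G (p i) (p j) = j - i)"

lemma geodesic_exists:
  assumes "u \<in> pverts G" "v \<in> pverts G" "gdist G u v = d"
  shows "\<exists>p. geodesic p d \<and> p 0 = u \<and> p d = v"
  using assms(2,3)
proof (induction d arbitrary: v)
  case 0
  then have "u = v" using gdist_eq_0 assms by auto
  then show ?case using assms by (intro exI[of _ "\<lambda>_. u"]) (auto simp: geodesic_def)
next
  case (Suc d)
  then obtain w where w: "(w, v) \<in> parcs G" "gdist G u w = d" using gdist_pred assms(1) by metis
  then have wV: "w \<in> pverts G" using in_arcsD1 by blast
  then obtain p where p: "geodesic p d" "p 0 = u" "p d = w" using Suc w by blast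
  define q where "q = (\<lambda>i. if i \<le> d then p i else v)"
  have V: "\<forall>i\<le>Suc d. q i \<in> pverts G" using p Suc by (auto simp: q_def geodesic_def)
  have "gdist G (q i) (q j) = j - i" if "i \<le> j" "j \<le> Suc d" for i j
  proof (cases "j \<le> d")
    case True then show ?thesis using p that by (auto simp: q_def geodesic_def)
  next
    case False
    then have j: "j = Suc d" using that by simp
    show ?thesis
    proof (cases "i = j")
      case True then show ?thesis using V that by auto
    next
      case False
      then have i: "i \<le> d" using that j by simp
      have pi: "p i \<in> pverts G" "gdist G u (p i) = i" "gdist G (p i) w = d - i"
        using p i by (auto simp: geodesic_def)
      \<comment> \<open>The upper bound appends the last arc. The lower one is forced:
        \<open>v\<close> is at distance \<open>Suc d\<close> from \<open>u\<close>, while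
        \<open>p i\<close> is only at distance \<open>i\<close>.\<close>
      have "gdist G (p i) v \<le> d - i + 1" using gdist_step[OF pi(1) w(1)] pi by simp
      moreover have "Suc d \<le> i + gdist G (p i) v"
        using gdist_triangle[of u "p i" v] assms(1) Suc pi by simp
      ultimately show ?thesis using i j by (auto simp: q_def)
    qed
  qed
  then show ?case using V p by (intro exI[of _ q]) (auto simp: geodesic_def q_def)
qed

lemma geodesicD:
  assumes "geodesic p d" "i \<le> d" "j \<le> d"
  shows "int (gdist G (p i) (p j)) = \<bar>int i - int j\<bar>"
  using assms gdist_sym[of "p i" "p j"] unfolding geodesic_def
  by (cases "i \<le> j") (auto simp: le_nat_iff)

lemma geodesic_V: "geodesic p d \<Longrightarrow> i \<le> d \<Longrightarrow> p i \<in> pverts G"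
  by (auto simp: geodesic_def)

lemma geodesic_inj: "geodesic p d \<Longrightarrow> inj_on p {..d}"
proof (rule inj_onI)
  fix i j assume "geodesic p d" "i \<in> {..d}" "j \<in> {..d}" "p i = p j"
  then show "i = j" using geodesicD[of p d i j] geodesic_V by auto
qed

lemma geodesic_rev: "geodesic p d \<Longrightarrow> geodesic (\<lambda>i. p (d - i)) d"
proof -
  assume g: "geodesic p d"
  have "gdist G (p (d - i)) (p (d - j)) = j - i" if "i \<le> j" "j \<le> d" for i j
    using geodesicD[OF g, of "d - i" "d - j"] that by auto
  then show ?thesis using geodesic_V[OF g] by (auto simp: geodesic_def)
qed

text \<open>A geodesic is an induced path, since a chord would join two positions at distance
  greater than one.\<close>

lemma geodesic_arc_iff:
  assumes "geodesic p d" "i \<le> d" "j \<le> d"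
  shows "(p i, p j) \<in> parcs G \<longleftrightarrow> i = Suc j \<or> j = Suc i"
proof
  assume "(p i, p j) \<in> parcs G"
  from gdist_arc[OF this] show "i = Suc j \<or> j = Suc i" using geodesicD[OF assms] by auto
next
  assume "i = Suc j \<or> j = Suc i"
  then have "gdist G (p i) (p j) = 1" using geodesicD[OF assms] by auto
  then show "(p i, p j) \<in> parcs G" using gdist_1_arc geodesic_V assms by blast
qed

lemma diametral_geodesic: obtains p where "geodesic p (diameter G)"
proof -
  obtain u v where "u \<in> pverts G" "v \<in> pverts G" "gdist G u v = diameter G" by (rule diameter_attained)
  from geodesic_exists[OF this] show ?thesis using that by blast
qed

end

section \<open>Cycles and breadth-first trees\<close>

definition und :: "'a \<times> 'a \<Rightarrow> 'a set" where
  "und e = {fst e, snd e}"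

lemma und_pair [simp]: "und (u, v) = {u, v}"
  by (simp add: und_def)

lemma und_eq: "(\<lambda>(u, v). {u, v}) = und"
  by auto

lemma und_image: "s \<in> und ` R \<longleftrightarrow> (\<exists>u v. (u, v) \<in> R \<and> s = {u, v})"
  by (force simp: und_def)

text \<open>Each fibre of \<open>und\<close> is a pair of opposite arcs, distinct because there are
  no loops.\<close>

lemma card_sym_rel:
  assumes "finite R" "sym R" "irrefl R"
  shows "card R = 2 * card (und ` R)"
proof -
  have "card R = (\<Sum>e\<in>R. 1)" by simp
  also have "\<dots> = (\<Sum>s\<in>und ` R. \<Sum>e\<in>{e \<in> R. und e = s}. 1)"
    by (rule sum.image_gen[OF assms(1)])
  also have "\<dots> = (\<Sum>s\<in>und ` R. 2)"
  proof (rule sum.cong[OF refl])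
    fix s assume "s \<in> und ` R"
    then obtain u v where uv: "(u, v) \<in> R" "s = {u, v}" by (auto simp: und_image)
    have "(v, u) \<in> R" using uv assms(2) by (auto dest: symD)
    moreover have "u \<noteq> v" using uv assms(3) by (auto simp: irrefl_def)
    ultimately have "{e \<in> R. und e = s} = {(u, v), (v, u)}"
      using uv by (auto simp: und_def doubleton_eq_iff prod_eq_iff)
    then show "(\<Sum>e\<in>{e \<in> R. und e = s}. 1) = (2::nat)" using \<open>u \<noteq> v\<close> by simp
  qed
  finally show ?thesis by simp
qed

lemma pawalk_verts_eq: "pcas u p v \<Longrightarrow> pawalk_verts u p = map fst p @ [v]"
  by (induction p arbitrary: u) auto

lemma pcas_nth: "pcas u p v \<Longrightarrow> Suc i < length p \<Longrightarrow> snd (p ! i) = fst (p ! Suc i)"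
proof (induction p arbitrary: u i)
  case (Cons e p)
  then show ?case
  proof (cases i)
    case 0 then show ?thesis using Cons by (cases p) auto
  next
    case (Suc k) then show ?thesis using Cons by auto
  qed
qed simp

lemma pcas_last: "pcas u p v \<Longrightarrow> p \<noteq> [] \<Longrightarrow> snd (last p) = v \<and> fst (hd p) = u"
  by (induction p arbitrary: u) auto

text \<open>Applied at every vertex, this is the closure of the cycle space under addition modulo
  2.\<close>

lemma even_card_sym_diff:
  assumes "finite A" "finite B" "even (card A)" "even (card B)"
  shows "even (card ((A - B) \<union> (B - A)))"
proof -
  have "card ((A - B) \<union> (B - A)) = card (A - B) + card (B - A)"
    using assms by (intro card_Un_disjoint) auto
  moreover have "card A = card (A - B) + card (A \<inter> B)" "card B = card (B - A) + card (A \<inter> B)"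
    using assms by (auto simp: card_Diff_subset_Int Int_commute card_mono)
  ultimately show ?thesis using assms by presburger
qed

lemma sym_diff_subset:
  "C \<subseteq> insert e T \<Longrightarrow> D \<subseteq> insert e T \<Longrightarrow> e \<in> C \<Longrightarrow> e \<in> D \<Longrightarrow> (C - D) \<union> (D - C) \<subseteq> T"
  by blast

lemma sym_diff_empty: "(C - D) \<union> (D - C) = {} \<Longrightarrow> C = D"
  by blast

lemma Collect_sym_diff:
  "{e \<in> (C - D) \<union> (D - C). P e} = ({e \<in> C. P e} - {e \<in> D. P e}) \<union> ({e \<in> D. P e} - {e \<in> C. P e})"
  by blast

context conn_graph
begin

lemma irrefl_A: "irrefl (parcs G)" using no_loops' by (auto simp: irrefl_def)
lemma sym_A: "sym (parcs G)" using sym_arc by (auto intro: symI)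

lemma card_arcs_uedges: "card (parcs G) = 2 * card (uedges G)"
  unfolding uedges_def und_eq by (rule card_sym_rel[OF fin_A sym_A irrefl_A])

text \<open>In a cycle every vertex is incident with zero or two edges.\<close>

lemma cycle_even:
  assumes "cycle p" "3 \<le> length p"
  shows "even (card {e \<in> und ` set p. x \<in> e})"
proof -
  obtain u where u: "awalk u p u" "distinct (tl (pawalk_verts u p))"
    using assms(1) unfolding cycle_def by auto
  have cas: "pcas u p u" using u(1) unfolding awalk_def by auto
  define L where "L = length p"
  have L: "3 \<le> L" "p \<noteq> []" using assms by (auto simp: L_def)
  define f where "f i = fst (p ! i)" for i
  \<comment> \<open>\<open>cycle\<close> only gives distinctness after dropping the first vertex. As
    the walk is closed, its last vertex \<open>u\<close> may be moved to the front.\<close>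
  have "distinct (tl (map fst p) @ [u])" using u(2) L by (simp add: pawalk_verts_eq[OF cas])
  moreover have "map fst p = u # tl (map fst p)"
    using pcas_last[OF cas L(2)] L(2) by (cases p) auto
  moreover have "distinct (u # t)" if "distinct (t @ [u])" for t using that by simp
  ultimately have "distinct (map fst p)" by metis
  then have inj: "i < L \<Longrightarrow> j < L \<Longrightarrow> f i = f j \<longleftrightarrow> i = j" for i j
    unfolding f_def L_def by (metis length_map nth_eq_iff_index_eq nth_map)
  \<comment> \<open>The cyclic successor of an index, so that the \<open>i\<close>-th edge joins
    \<open>f i\<close> and \<open>f (s i)\<close>.\<close>
  define s where "s i = (if Suc i = L then 0 else Suc i)" for i
  have s: "i < L \<Longrightarrow> s i < L" for i using L by (auto simp: s_def)
  have nth: "p ! i = (f i, f (s i))" if "i < L" for i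
  proof (cases "Suc i = L")
    case True
    then have "snd (p ! i) = u" using pcas_last[OF cas L(2)] by (metis L(2) L_def diff_Suc_1 last_conv_nth)
    moreover have "f 0 = u" using pcas_last[OF cas L(2)] L(2) by (simp add: f_def hd_conv_nth)
    ultimately show ?thesis using True by (simp add: f_def s_def prod_eq_iff)
  next
    case False
    then have "snd (p ! i) = f (Suc i)" using pcas_nth[OF cas, of i] that unfolding f_def L_def by simp
    then show ?thesis using False by (simp add: f_def s_def prod_eq_iff)
  qed
  define E where "E i = {f i, f (s i)}" for i
  have sp: "set p = (!) p ` {..<L}" unfolding L_def by (auto simp: set_conv_nth)
  have img: "und ` set p = E ` {..<L}"
    unfolding sp image_image by (intro image_cong) (auto simp: nth E_def)
  have injE: "inj_on E {..<L}"
  proof (rule inj_onI)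
    fix i j assume ij: "i \<in> {..<L}" "j \<in> {..<L}" "E i = E j"
    then have "f i = f j \<or> (f i = f (s j) \<and> f (s i) = f j)" by (auto simp: E_def doubleton_eq_iff)
    then have "i = j \<or> (i = s j \<and> s i = j)" using inj s ij by auto
    \<comment> \<open>Two indices that are successors of each other would mean length 2, which the
      bound 3 excludes.\<close>
    then show "i = j" using L ij by (auto simp: s_def split: if_splits)
  qed
  have "{e \<in> und ` set p. x \<in> e} = E ` {i \<in> {..<L}. f i = x \<or> f (s i) = x}"
    unfolding img by (auto simp: E_def)
  then have card: "card {e \<in> und ` set p. x \<in> e} = card {i \<in> {..<L}. f i = x \<or> f (s i) = x}"
    using injE by (simp add: card_image inj_on_def)
  show ?thesis
  proof (cases "x \<in> f ` {..<L}")
    case False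
    then have "{i \<in> {..<L}. f i = x \<or> f (s i) = x} = {}" using s by blast
    then show ?thesis unfolding card by (simp only: card.empty even_zero)
  next
    case True
    then obtain k where k: "k < L" "x = f k" by auto
    \<comment> \<open>The cyclic predecessor of \<open>k\<close>: the two cycle edges at
      \<open>x\<close> are those with index \<open>k\<close> and \<open>q\<close>, and
      \<open>k \<noteq> q\<close> since the length is at least 3.\<close>
    define q where "q = (if k = 0 then L - 1 else k - 1)"
    have "{i \<in> {..<L}. f i = x \<or> f (s i) = x} = {i \<in> {..<L}. i = k \<or> s i = k}"
      using inj s k by auto
    also have "\<dots> = {k, q}" using k L by (auto simp: s_def q_def split: if_splits)
    finally show ?thesis unfolding card using L k by (auto simp: q_def)
  qed
qed

section \<open>Breadth-first spanning trees and fundamental cycles\<close>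

definition par :: "'a \<Rightarrow> 'a \<Rightarrow> 'a" where
  "par y x = (SOME w. (w, x) \<in> parcs G \<and> gdist G y x = Suc (gdist G y w))"

lemma par:
  assumes "y \<in> pverts G" "x \<in> pverts G" "x \<noteq> y"
  shows "(par y x, x) \<in> parcs G" "gdist G y x = Suc (gdist G y (par y x))"
proof -
  have "gdist G y x \<noteq> 0" using gdist_eq_0[OF assms(1,2)] assms(3) by auto
  then obtain k where "gdist G y x = Suc k" using not0_implies_Suc by blast
  then have "\<exists>w. (w, x) \<in> parcs G \<and> gdist G y x = Suc (gdist G y w)"
    using gdist_pred[OF assms(1,2)] by metis
  from someI_ex[OF this] show "(par y x, x) \<in> parcs G" "gdist G y x = Suc (gdist G y (par y x))"
    unfolding par_def by auto
qed

text \<open>Because \<open>par\<close> fixes one predecessor per vertex, these are the parent arcs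
  of a spanning tree rooted at \<open>y\<close> that preserves distances from \<open>y\<close>.
  Distances strictly drop along them, so no arc occurs together with its reverse.\<close>

definition up_arcs :: "'a \<Rightarrow> 'a rel" where
  "up_arcs y = (\<lambda>x. (x, par y x)) ` (pverts G - {y})"

definition tree_arcs :: "'a \<Rightarrow> 'a rel" where
  "tree_arcs y = up_arcs y \<union> (up_arcs y)\<inverse>"

context
  fixes y assumes y: "y \<in> pverts G"
begin

lemma up_arcsD: "(a, b) \<in> up_arcs y \<Longrightarrow>
    (a, b) \<in> parcs G \<and> a \<noteq> y \<and> b = par y a \<and> gdist G y a = Suc (gdist G y b)"
  unfolding up_arcs_def using par[OF y] sym_arc by auto

lemma up_disjoint: "up_arcs y \<inter> (up_arcs y)\<inverse> = {}"
proof -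
  have False if "(a, b) \<in> up_arcs y" "(b, a) \<in> up_arcs y" for a b
    using up_arcsD[OF that(1)] up_arcsD[OF that(2)] by simp
  then show ?thesis by auto
qed

lemma fin_up: "finite (up_arcs y)" unfolding up_arcs_def by simp

lemma card_up: "card (up_arcs y) = card (pverts G) - 1"
proof -
  have "card (up_arcs y) = card (pverts G - {y})"
    unfolding up_arcs_def by (intro card_image) (auto simp: inj_on_def)
  then show ?thesis using y by simp
qed

lemma fin_tree: "finite (tree_arcs y)" unfolding tree_arcs_def using fin_up by simp

lemma card_tree: "card (tree_arcs y) = 2 * (card (pverts G) - 1)"
  unfolding tree_arcs_def using fin_up up_disjoint card_up
  by (subst card_Un_disjoint) auto

lemma tree_sub: "tree_arcs y \<subseteq> parcs G"
  unfolding tree_arcs_def using up_arcsD sym_arc by auto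

lemma tree_sym: "(a, b) \<in> tree_arcs y \<Longrightarrow> (b, a) \<in> tree_arcs y"
  unfolding tree_arcs_def by auto

lemma tree_und: "{a, b} \<in> und ` tree_arcs y \<Longrightarrow> (a, b) \<in> tree_arcs y"
  using tree_sym by (auto simp: und_image doubleton_eq_iff)

text \<open>A nonempty set of tree edges has a vertex of degree one, namely one farthest from the root.\<close>

lemma tree_even_empty:
  assumes "D \<subseteq> und ` tree_arcs y" "\<And>x. even (card {e \<in> D. x \<in> e})"
  shows "D = {}"
proof (rule ccontr)
  assume "D \<noteq> {}"
  have E: "\<exists>a b. e = {a, b} \<and> (a, b) \<in> up_arcs y" if eD: "e \<in> D" for e
  proof -
    obtain a b where ab: "e = {a, b}" "(a, b) \<in> tree_arcs y" using assms(1) eD und_image by (metis subsetD)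
    then consider "(a, b) \<in> up_arcs y" | "(b, a) \<in> up_arcs y" by (auto simp: tree_arcs_def)
    then show ?thesis by cases (use ab in \<open>auto simp: insert_commute\<close>)
  qed
  have DV: "\<Union>D \<subseteq> pverts G" using E up_arcsD in_arcsD1 in_arcsD2 by blast
  have "\<Union>D \<noteq> {}" using E \<open>D \<noteq> {}\<close> by blast
  moreover have "finite (\<Union>D)" using DV by (rule finite_subset) simp
  ultimately have "Max (gdist G y ` \<Union>D) \<in> gdist G y ` \<Union>D" by (intro Max_in) auto
  then obtain x where x: "x \<in> \<Union>D" "Max (gdist G y ` \<Union>D) = gdist G y x" by blast
  have max: "gdist G y z \<le> gdist G y x" if "z \<in> \<Union>D" for z
    unfolding x(2)[symmetric] using \<open>finite (\<Union>D)\<close> that by (intro Max_ge) auto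
  have only: "e = {x, par y x}" if eD: "e \<in> D" "x \<in> e" for e
  proof -
    obtain a b where ab: "e = {a, b}" "(a, b) \<in> up_arcs y" using E[OF eD(1)] by blast
    have "gdist G y a \<le> gdist G y x" using max[of a] ab eD by blast
    then have "x = a" using ab eD up_arcsD[OF ab(2)] by auto
    then show ?thesis using ab up_arcsD[OF ab(2)] by auto
  qed
  have "{e \<in> D. x \<in> e} = {{x, par y x}}" using only x(1) by blast
  then show False using assms(2)[of x] by simp
qed

lemma tree_reach:
  defines "H \<equiv> \<lparr>pverts = pverts G, parcs = tree_arcs y\<rparr>"
  assumes "x \<in> pverts G"
  shows "reachable (with_proj H) x y"
proof -
  interpret H: pair_wf_digraph H
    using tree_sub in_arcsD1 in_arcsD2 by unfold_locales (auto simp: H_def)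
  have "x \<in> pverts G \<Longrightarrow> gdist G y x = k \<Longrightarrow> reachable (with_proj H) x y" for k
  proof (induction k arbitrary: x)
    case 0
    then have "x = y" using gdist_eq_0[OF y] by auto
    then show ?case using H.reachable_refl[of y] y by (simp add: H_def)
  next
    case (Suc k)
    then have ne: "x \<noteq> y" using y by auto
    have "(x, par y x) \<in> tree_arcs y" using Suc ne by (auto simp: tree_arcs_def up_arcs_def)
    moreover have "reachable (with_proj H) (par y x) y"
      using Suc ne par[OF y, of x] in_arcsD1 by auto
    ultimately show ?case by (intro H.adj_reachable_trans[of x "par y x" y]) (auto simp: H_def)
  qed
  then show ?thesis using assms by blast
qed

text \<open>The fundamental cycle of a non-tree edge: a tree path from \<open>b\<close> back to
  \<open>a\<close>, preceded by the arc \<open>(a, b)\<close>.\<close>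

lemma nontree_cycle:
  assumes "(a, b) \<in> parcs G" "(a, b) \<notin> tree_arcs y"
  obtains p where "cycle p" "3 \<le> length p" "{a, b} \<in> und ` set p"
    "und ` set p \<subseteq> insert {a, b} (und ` tree_arcs y)"
proof -
  define H where "H = \<lparr>pverts = pverts G, parcs = tree_arcs y\<rparr>"
  interpret H: pair_sym_digraph H
  proof unfold_locales
    show "symmetric (with_proj H)"
      using tree_sym by (auto simp: symmetric_def H_def intro: symI)
  qed (use tree_sub in_arcsD1 in_arcsD2 in \<open>auto simp: H_def\<close>)
  have V: "a \<in> pverts G" "b \<in> pverts G" using assms in_arcsD1 in_arcsD2 by blast+
  have "reachable (with_proj H) a y" "reachable (with_proj H) b y"
    using tree_reach V unfolding H_def by blast+
  moreover have "symmetric (with_proj H)" by (rule H.pair_sym_arcs)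
  ultimately have "reachable (with_proj H) b a"
    using H.reachable_trans H.symmetric_reachable' by blast
  then obtain p where p: "H.apath b p a" using H.reachable_apath by blast
  then have pw: "H.awalk b p a" "distinct (pawalk_verts b p)" by (auto simp: H.apath_def)
  have pT: "set p \<subseteq> tree_arcs y" "pcas b p a" using pw(1) unfolding H.awalk_def by (auto simp: H_def)
  have "awalk b p a" using pT V(2) tree_sub unfolding awalk_def by auto
  then have w: "awalk a ((a, b) # p) a" using assms V by (simp add: awalk_Cons_iff)
  moreover have "tl (pawalk_verts a ((a, b) # p)) = pawalk_verts b p" by simp
  ultimately have "distinct (tl (pawalk_verts a ((a, b) # p)))" using pw(2) by (simp only:)
  with w have "cycle ((a, b) # p)" unfolding cycle_def by (intro exI[of _ a] conjI) auto
  moreover have "3 \<le> length ((a, b) # p)"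
  proof -
    have "p \<noteq> []" using pT(2) no_loops'[OF assms(1)] by auto
    \<comment> \<open>A tree path of length one would be the arc \<open>(b, a)\<close>, whose
      reverse would then belong to the tree as well.\<close>
    moreover have "p \<noteq> [e]" for e
      using pT assms(2) tree_sym[of b a] by (cases e) auto
    moreover from this have "length p \<noteq> Suc 0" unfolding length_Suc_conv by blast
    ultimately have "length p \<noteq> 0" "length p \<noteq> Suc 0" by blast+
    then show ?thesis unfolding list.size by linarith
  qed
  moreover have "und ` set ((a, b) # p) \<subseteq> insert {a, b} (und ` tree_arcs y)" using pT by auto
  moreover have "{a, b} \<in> und ` set ((a, b) # p)" by simp
  ultimately show ?thesis by (intro that)
qed

lemma cycle_not_in_tree:
  assumes "cycle p" "3 \<le> length p"
  shows "\<not> und ` set p \<subseteq> und ` tree_arcs y"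
proof
  assume "und ` set p \<subseteq> und ` tree_arcs y"
  then have "und ` set p = {}" using tree_even_empty cycle_even[OF assms] by blast
  then show False using assms(2) by auto
qed

end

lemma cycle_set_sub: "cycle p \<Longrightarrow> set p \<subseteq> parcs G"
  unfolding cycle_def awalk_def by auto

lemma nontree_sym_diff:
  assumes "y \<in> pverts G" "(a, b) \<in> parcs G - tree_arcs y"
  shows "(b, a) \<in> parcs G - tree_arcs y"
  using assms sym_arc tree_sym by blast

text \<open>A spanning tree has \<open>2 * (n - 1)\<close> arcs, so the count on the right says that
  exactly one edge lies outside the tree. The two directions use fundamental cycles and the fact
  that an even set of tree edges is empty.\<close>

theorem unique_cycle_iff:
  "(\<exists>!C. C \<in> cycle_edge_sets G) \<longleftrightarrow> card (parcs G) = 2 * card (pverts G)"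
proof -
  obtain y where y: "y \<in> pverts G" using verts_ne by blast
  define N where "N = parcs G - tree_arcs y"
  have n: "card (pverts G) \<ge> 1" using y by (metis One_nat_def Suc_leI card_gt_0_iff fin_V empty_iff)
  have cE: "card (parcs G) = 2 * (card (pverts G) - 1) + card N"
    using card_Diff_subset[OF fin_tree[OF y] tree_sub[OF y]] card_mono[OF fin_A tree_sub[OF y]]
      card_tree[OF y] by (simp add: N_def)
  have Nund: "{a, b} \<notin> und ` tree_arcs y" if "(a, b) \<in> N" for a b
    using that tree_und[OF y, of a b] unfolding N_def by blast
  have mem: "und ` set p \<in> cycle_edge_sets G" if "cycle p" "3 \<le> length p" for p
    using that unfolding cycle_edge_sets_def und_eq by blast
  show ?thesis
  proof
    assume ex1: "\<exists>!C. C \<in> cycle_edge_sets G"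
    then obtain p where p: "cycle p" "3 \<le> length p" unfolding cycle_edge_sets_def und_eq by auto
    have "N \<noteq> {}"
    proof
      assume "N = {}"
      then have "parcs G \<subseteq> tree_arcs y" unfolding N_def by blast
      with cycle_set_sub[OF p(1)] have "set p \<subseteq> tree_arcs y" by (rule subset_trans)
      then have "und ` set p \<subseteq> und ` tree_arcs y" by (rule image_mono)
      with cycle_not_in_tree[OF y p] show False by (rule notE)
    qed
    then obtain a b where ab: "(a, b) \<in> N" by auto
    have abG: "(a, b) \<in> parcs G" "(a, b) \<notin> tree_arcs y" using ab by (auto simp: N_def)
    obtain q where q: "cycle q" "3 \<le> length q" "{a, b} \<in> und ` set q"
      by (rule nontree_cycle[OF y abG])
    \<comment> \<open>The fundamental cycle of \<open>{c, d}\<close> has no other non-tree edge.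
      Being the only cycle, it also contains \<open>{a, b}\<close>, so the two edges agree.\<close>
    have "(c, d) \<in> {(a, b), (b, a)}" if "(c, d) \<in> N" for c d
    proof -
      have cd: "(c, d) \<in> parcs G" "(c, d) \<notin> tree_arcs y" using that by (auto simp: N_def)
      obtain r where r: "cycle r" "3 \<le> length r" "und ` set r \<subseteq> insert {c, d} (und ` tree_arcs y)"
        by (rule nontree_cycle[OF y cd])
      have eq: "und ` set q = und ` set r"
        using ex1 mem[OF q(1,2)] mem[OF r(1,2)] by (elim ex1E) metis
      have "{a, b} \<in> insert {c, d} (und ` tree_arcs y)"
        by (rule subsetD[OF r(3)]) (rule q(3)[unfolded eq])
      then have "{a, b} = {c, d}" by (rule insertE) (use Nund[OF ab] in simp_all)
      then show ?thesis by (auto simp: doubleton_eq_iff)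
    qed
    moreover have "(b, a) \<in> N" using nontree_sym_diff[OF y, of a b] ab unfolding N_def by blast
    ultimately have "N = {(a, b), (b, a)}" using ab by (intro equalityI subrelI) (blast, auto)
    moreover have "a \<noteq> b" using abG no_loops' by blast
    ultimately have "card N = 2" by simp
    then show "card (parcs G) = 2 * card (pverts G)" using cE n by simp
  next
    assume "card (parcs G) = 2 * card (pverts G)"
    then have N2: "card N = 2" using cE n by simp
    then have "N \<noteq> {}" by auto
    then obtain a b where ab: "(a, b) \<in> N" by auto
    have ba: "(b, a) \<in> N" using nontree_sym_diff[OF y, of a b] ab unfolding N_def by blast
    have abG: "(a, b) \<in> parcs G" "(a, b) \<notin> tree_arcs y" using ab by (auto simp: N_def)
    have "a \<noteq> b" using abG no_loops' by blast
    then have "card {(a, b), (b, a)} = card N" using N2 by simp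
    moreover have "finite N" unfolding N_def by (rule finite_Diff[OF fin_A])
    moreover have "{(a, b), (b, a)} \<subseteq> N" using ab ba by blast
    ultimately have N: "N = {(a, b), (b, a)}" by (intro card_subset_eq[symmetric])
    have und_sub: "und ` parcs G \<subseteq> insert {a, b} (und ` tree_arcs y)"
    proof -
      have "parcs G \<subseteq> tree_arcs y \<union> N" unfolding N_def by blast
      then have "parcs G \<subseteq> tree_arcs y \<union> {(a, b), (b, a)}" unfolding N .
      then have "und ` parcs G \<subseteq> und ` (tree_arcs y \<union> {(a, b), (b, a)})" by (rule image_mono)
      then show ?thesis by (auto simp: insert_commute)
    qed
    obtain q where q: "cycle q" "3 \<le> length q" by (rule nontree_cycle[OF y abG])
    have sub: "und ` set p \<subseteq> insert {a, b} (und ` tree_arcs y)" if "cycle p" for p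
      using image_mono[OF cycle_set_sub[OF that], of und] und_sub by (rule subset_trans)
    have has: "{a, b} \<in> und ` set p" if "cycle p" "3 \<le> length p" for p
    proof (rule ccontr)
      assume "{a, b} \<notin> und ` set p"
      then have "und ` set p \<subseteq> und ` tree_arcs y"
        by (rule iffD1[OF subset_insert sub[OF that(1)]])
      with cycle_not_in_tree[OF y that] show False by (rule notE)
    qed
    \<comment> \<open>Both cycles contain the single non-tree edge, so it cancels in their symmetric
      difference. What remains is an even set of tree edges.\<close>
    have uniq: "und ` set p = und ` set r"
      if p: "cycle p" "3 \<le> length p" and r: "cycle r" "3 \<le> length r" for p r
    proof -
      let ?C = "und ` set p" and ?D = "und ` set r"
      let ?X = "(?C - ?D) \<union> (?D - ?C)"
      have "?X \<subseteq> und ` tree_arcs y"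
        by (rule sym_diff_subset[OF sub[OF p(1)] sub[OF r(1)] has[OF p] has[OF r]])
      moreover have "even (card {e \<in> ?X. x \<in> e})" for x
        unfolding Collect_sym_diff
        by (rule even_card_sym_diff[OF _ _ cycle_even[OF p, of x] cycle_even[OF r, of x]]) simp_all
      ultimately have "?X = {}" by (rule tree_even_empty[OF y])
      then show ?thesis by (rule sym_diff_empty)
    qed
    show "\<exists>!C. C \<in> cycle_edge_sets G"
    proof (rule ex1I)
      show "und ` set q \<in> cycle_edge_sets G" by (rule mem[OF q])
      show "C = und ` set q" if C: "C \<in> cycle_edge_sets G" for C
      proof -
        obtain p where p: "C = und ` set p" "cycle p" "3 \<le> length p"
          using C unfolding cycle_edge_sets_def und_eq by auto
        show ?thesis unfolding p(1) by (rule uniq[OF p(2,3) q])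
      qed
    qed
  qed
qed

end

text \<open>From here on unicyclicity is an arc count and cycles are no longer mentioned.\<close>

lemma unicyclic_iff: "unicyclic G \<longleftrightarrow> conn_graph G \<and> card (parcs G) = 2 * card (pverts G)"
proof -
  have "conn_graph G \<longleftrightarrow> pair_graph G \<and> Digraph_Component.connected (with_proj G)"
    by (simp add: conn_graph_def conn_graph_axioms_def)
  then show ?thesis unfolding unicyclic_def using conn_graph.unique_cycle_iff[of G] by metis
qed

section \<open>An upper bound in terms of the diameter\<close>

lemma sum_dist_end: "2 * (\<Sum>j\<le>i. \<bar>int i - int j\<bar>) = int i * (int i + 1)"
proof (induction i)
  case (Suc i)
  have "(\<Sum>j\<le>Suc i. \<bar>int (Suc i) - int j\<bar>) = int (Suc i) + (\<Sum>j\<le>i. \<bar>int i - int j\<bar>)"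
    by (subst sum.atMost_Suc_shift) simp
  then show ?case using Suc by (simp add: algebra_simps)
qed simp

lemma sum_dist:
  assumes "i \<le> d"
  shows "2 * (\<Sum>j\<le>d. \<bar>int i - int j\<bar>) = int i * (int i + 1) + (int d - int i) * (int d - int i + 1)"
  using assms
proof (induction d rule: dec_induct)
  case base then show ?case using sum_dist_end[of i] by simp
next
  case (step d) then show ?case by (simp add: algebra_simps)
qed

lemma sum_dist_all: "3 * (\<Sum>i\<le>d. \<Sum>j\<le>d. \<bar>int i - int j\<bar>) = int d * (int d + 1) * (int d + 2)"
proof (induction d)
  case (Suc d)
  have "(\<Sum>i\<le>d. \<bar>int i - int (Suc d)\<bar>) = (\<Sum>j\<le>Suc d. \<bar>int (Suc d) - int j\<bar>)"
    by (simp add: abs_minus_commute)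
  moreover have "2 * (\<Sum>j\<le>Suc d. \<bar>int (Suc d) - int j\<bar>) = (int d + 1) * (int d + 2)"
    using sum_dist_end[of "Suc d"] by (simp add: algebra_simps)
  moreover have "(\<Sum>i\<le>Suc d. \<Sum>j\<le>Suc d. \<bar>int i - int j\<bar>) = (\<Sum>i\<le>d. \<Sum>j\<le>d. \<bar>int i - int j\<bar>)
      + (\<Sum>i\<le>d. \<bar>int i - int (Suc d)\<bar>) + (\<Sum>j\<le>Suc d. \<bar>int (Suc d) - int j\<bar>)"
    by (simp add: sum.distrib)
  ultimately show ?case using Suc by (simp add: algebra_simps)
qed simp

text \<open>Going from \<open>d\<close> to \<open>d + 2\<close> adds two end terms equal to
  \<open>d + 2\<close> and shifts the others, so both sides grow by \<open>4 * d + 8\<close>; for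
  even \<open>d\<close> this is an equality. The floor 2 reflects that a vertex off the path is at
  distance at least 1 from both members of a pair.\<close>

lemma sum_max_dist: "(int d + 1)\<^sup>2 + 3 \<le> 2 * (\<Sum>i\<le>d. max 2 \<bar>int d - 2 * int i\<bar>)"
proof (induction d rule: induct_nat_012)
  case (ge2 d)
  have "(\<Sum>i\<le>Suc (Suc d). max 2 \<bar>int (Suc (Suc d)) - 2 * int i\<bar>)
      = 2 * (int d + 2) + (\<Sum>i\<le>d. max 2 \<bar>int d - 2 * int i\<bar>)"
    by (subst sum.atMost_Suc, subst sum.atMost_Suc_shift) simp
  then show ?case using ge2(1) by (simp add: power2_eq_square algebra_simps)
qed simp_all

text \<open>Pairing \<open>i\<close> with \<open>d - i\<close> counts each \<open>g i\<close> twice,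
  which doubles the factor 2 of \<open>sum_max_dist\<close>.\<close>

lemma sum_dist_to_path:
  fixes g :: "nat \<Rightarrow> int"
  assumes "\<And>i. i \<le> d \<Longrightarrow> 1 \<le> g i" "\<And>i. i \<le> d \<Longrightarrow> \<bar>int d - 2 * int i\<bar> \<le> g i + g (d - i)"
  shows "(int d + 1)\<^sup>2 + 3 \<le> 4 * (\<Sum>i\<le>d. g i)"
proof -
  have "(\<Sum>i\<le>d. g (d - i)) = (\<Sum>i\<le>d. g i)"
    using sum.atLeastAtMost_rev[of g 0 d] by (simp add: atLeast0AtMost)
  then have "2 * (\<Sum>i\<le>d. g i) = (\<Sum>i\<le>d. g i + g (d - i))" by (simp add: sum.distrib)
  also have "\<dots> \<ge> (\<Sum>i\<le>d. max 2 \<bar>int d - 2 * int i\<bar>)"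
  proof (rule sum_mono)
    fix i assume "i \<in> {..d}"
    then show "max 2 \<bar>int d - 2 * int i\<bar> \<le> g i + g (d - i)"
      using assms(1)[of i] assms(1)[of "d - i"] assms(2)[of i] by simp
  qed
  finally show ?thesis using sum_max_dist[of d] by linarith
qed

section \<open>Lower bounds for the degree distance and the transmissions\<close>

context conn_graph
begin

lemma degree_eq: "degree G x = card {e \<in> parcs G. fst e = x}"
  by (simp add: out_degree_def out_arcs_def)

lemma sum_degree: "(\<Sum>x\<in>pverts G. degree G x * t x) = (\<Sum>e\<in>parcs G. t (fst e))"
proof -
  have "(\<Sum>e\<in>parcs G. t (fst e)) = (\<Sum>x\<in>pverts G. \<Sum>e\<in>{e \<in> parcs G. fst e = x}. t (fst e))"
    by (rule sum.group[symmetric]) (auto intro: in_arcsD1)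
  also have "\<dots> = (\<Sum>x\<in>pverts G. degree G x * t x)"
  proof (rule sum.cong[OF refl])
    fix x
    have "(\<Sum>e\<in>{e \<in> parcs G. fst e = x}. t (fst e)) = (\<Sum>e\<in>{e \<in> parcs G. fst e = x}. t x)"
      by (rule sum.cong) auto
    then show "(\<Sum>e\<in>{e \<in> parcs G. fst e = x}. t (fst e)) = degree G x * t x"
      unfolding degree_eq by simp
  qed
  finally show ?thesis by simp
qed

lemma degree_distance_arcs: "degree_distance G = (\<Sum>e\<in>parcs G. transmission G (fst e))"
  unfolding degree_distance_def by (rule sum_degree)

lemma degree_distance_swap:
  "degree_distance G = (\<Sum>y\<in>pverts G. \<Sum>e\<in>parcs G. gdist G y (fst e))"
proof -
  have "degree_distance G = (\<Sum>e\<in>parcs G. \<Sum>y\<in>pverts G. gdist G y (fst e))"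
    unfolding degree_distance_arcs transmission_def
    by (intro sum.cong refl gdist_sym) (auto intro: in_arcsD1)
  then show ?thesis by (simp add: sum.swap[of _ "parcs G"])
qed

text \<open>Each vertex \<open>x\<close> other than \<open>y\<close> contributes
  \<open>gdist G y x\<close> through the arc to its parent and one less through the opposite arc.
  The total saving \<open>n - 1\<close> is added on the left to avoid subtraction of
  naturals.\<close>

lemma sum_tree_arcs:
  assumes y: "y \<in> pverts G"
  shows "(\<Sum>e\<in>tree_arcs y. gdist G y (fst e)) + (card (pverts G) - 1) = 2 * transmission G y"
proof -
  let ?W = "pverts G - {y}"
  have up: "(\<Sum>e\<in>up_arcs y. gdist G y (fst e)) = (\<Sum>x\<in>?W. gdist G y x)"
    unfolding up_arcs_def by (subst sum.reindex) (auto simp: inj_on_def)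
  have "(up_arcs y)\<inverse> = (\<lambda>x. (par y x, x)) ` ?W" unfolding up_arcs_def by auto
  then have down: "(\<Sum>e\<in>(up_arcs y)\<inverse>. gdist G y (fst e)) = (\<Sum>x\<in>?W. gdist G y (par y x))"
    by (subst \<open>(up_arcs y)\<inverse> = _\<close>, subst sum.reindex) (auto simp: inj_on_def)
  have "(\<Sum>x\<in>?W. gdist G y (par y x)) + card ?W = (\<Sum>x\<in>?W. gdist G y (par y x) + 1)"
    unfolding sum.distrib by simp
  also have "\<dots> = (\<Sum>x\<in>?W. gdist G y x)"
    by (rule sum.cong) (use par(2)[OF y] in auto)
  finally have "(\<Sum>x\<in>?W. gdist G y (par y x)) + (card (pverts G) - 1) = (\<Sum>x\<in>?W. gdist G y x)"
    using y by simp
  moreover have "transmission G y = (\<Sum>x\<in>?W. gdist G y x)"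
    unfolding transmission_def using y by (simp add: sum.remove[of _ y])
  moreover have "(\<Sum>e\<in>tree_arcs y. gdist G y (fst e))
      = (\<Sum>e\<in>up_arcs y. gdist G y (fst e)) + (\<Sum>e\<in>(up_arcs y)\<inverse>. gdist G y (fst e))"
    unfolding tree_arcs_def using fin_up[OF y] up_disjoint[OF y] by (intro sum.union_disjoint) auto
  ultimately show ?thesis using up down by linarith
qed

text \<open>A non-tree edge provides two opposite arcs, and at least one of them starts at a vertex
  other than \<open>y\<close>. It adds 1 or more to the sum over the tree.\<close>

lemma sum_arcs_ge:
  assumes y: "y \<in> pverts G" and card: "card (parcs G) = 2 * card (pverts G)"
  shows "2 * transmission G y + 1 \<le> (\<Sum>e\<in>parcs G. gdist G y (fst e)) + (card (pverts G) - 1)"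
proof -
  have "card (pverts G) \<ge> 1" using verts_ne by (simp add: Suc_leI card_gt_0_iff)
  then have "card (tree_arcs y) \<noteq> card (parcs G)" using card_tree[OF y] card by simp
  then have "tree_arcs y \<noteq> parcs G" by metis
  then obtain e where e: "e \<in> parcs G" "e \<notin> tree_arcs y" using tree_sub[OF y] by (metis subsetI antisym)
  obtain a b where ab: "e = (a, b)" by (cases e)
  have ba: "(b, a) \<in> parcs G - tree_arcs y" using nontree_sym_diff[OF y, of a b] e ab by (simp del: Diff_iff) simp
  have V: "a \<in> pverts G" "b \<in> pverts G" "a \<noteq> b" using e ab in_arcsD1[of a b] in_arcsD2[of a b] no_loops'[of a b] by auto
  have "\<exists>f \<in> parcs G - tree_arcs y. 1 \<le> gdist G y (fst f)"
  proof (cases "a = y")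
    case True then show ?thesis using ba V gdist_eq_0[OF y V(2)] by (intro bexI[of _ "(b, a)"]) (auto simp: Suc_le_eq)
  next
    case False then show ?thesis using e ab gdist_eq_0[OF y V(1)] by (intro bexI[of _ "(a, b)"]) (auto simp: Suc_le_eq)
  qed
  then obtain f where f: "f \<in> parcs G - tree_arcs y" "1 \<le> gdist G y (fst f)" by (elim bexE)
  have "gdist G y (fst f) \<le> (\<Sum>e\<in>parcs G - tree_arcs y. gdist G y (fst e))"
    by (rule member_le_sum[OF f(1)]) simp_all
  moreover have "(\<Sum>e\<in>parcs G. gdist G y (fst e))
      = (\<Sum>e\<in>parcs G - tree_arcs y. gdist G y (fst e)) + (\<Sum>e\<in>tree_arcs y. gdist G y (fst e))"
    by (rule sum.subset_diff[OF tree_sub[OF y] fin_A])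
  ultimately show ?thesis using f(2) sum_tree_arcs[OF y] by linarith
qed

text \<open>Each of the \<open>n\<close> roots loses at most \<open>n - 2\<close> against twice its
  transmission: \<open>n - 1\<close> along the tree, less the 1 gained from a non-tree arc.\<close>

lemma degree_distance_ge:
  assumes card: "card (parcs G) = 2 * card (pverts G)"
  defines "n \<equiv> int (card (pverts G))"
  shows "int (degree_distance G) \<ge> 2 * (\<Sum>y\<in>pverts G. int (transmission G y)) - n * (n - 2)"
proof -
  have n: "card (pverts G) \<ge> 1" using verts_ne by (simp add: Suc_leI card_gt_0_iff)
  have "(\<Sum>y\<in>pverts G. 2 * int (transmission G y) + 1)
      \<le> (\<Sum>y\<in>pverts G. (\<Sum>e\<in>parcs G. int (gdist G y (fst e))) + (n - 1))"
  proof (rule sum_mono)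
    fix y assume "y \<in> pverts G"
    from sum_arcs_ge[OF this card]
    have "int (2 * transmission G y + 1) \<le> int ((\<Sum>e\<in>parcs G. gdist G y (fst e)) + (card (pverts G) - 1))"
      by (simp only: of_nat_le_iff)
    then show "2 * int (transmission G y) + 1 \<le> (\<Sum>e\<in>parcs G. int (gdist G y (fst e))) + (n - 1)"
      using n by (simp add: n_def of_nat_diff)
  qed
  also have "\<dots> = int (degree_distance G) + n * (n - 1)"
    unfolding degree_distance_swap by (simp add: sum.distrib n_def)
  finally show ?thesis by (simp add: sum.distrib sum_distrib_left n_def algebra_simps)
qed

text \<open>Ordered pairs are split by whether their ends lie on the geodesic. Pairs on it are
  exact, and mixed pairs are bounded by \<open>sum_dist_to_path\<close>. The
  \<open>r * (r - 1)\<close> pairs off it are at distance at least 2 unless adjacent, and at most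
  \<open>2 * (n - d)\<close> are adjacent, because the path itself uses \<open>2 * d\<close> of the
  \<open>2 * n\<close> arcs.\<close>

lemma sum_transmission_ge:
  assumes card: "card (parcs G) = 2 * card (pverts G)" and p: "geodesic p d"
  defines "n \<equiv> int (card (pverts G))" and "r \<equiv> int (card (pverts G)) - int d - 1"
  shows "6 * (\<Sum>y\<in>pverts G. int (transmission G y)) \<ge>
    2 * int d * (int d + 1) * (int d + 2) + 3 * r * ((int d + 1)\<^sup>2 + 3) + 12 * r * (r - 1) - 12 * (n - int d)"
proof -
  let ?V = "pverts G" and ?P = "p ` {..d}"
  let ?g = "\<lambda>x y. int (gdist G x y)"
  define Q where "Q = ?V - ?P"
  have PV: "?P \<subseteq> ?V" using geodesic_V[OF p] by auto
  have finQ: "finite Q" by (simp add: Q_def)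
  have "card ?P = d + 1" using card_image[OF geodesic_inj[OF p]] by simp
  then have r: "r = int (card Q)" using card_Diff_subset[OF _ PV] card_mono[OF fin_V PV]
    unfolding r_def Q_def by (simp add: of_nat_diff)
  have split: "(\<Sum>x\<in>?V. f x) = (\<Sum>x\<in>Q. f x) + (\<Sum>i\<le>d. f (p i))" for f :: "'a \<Rightarrow> int"
    using sum.subset_diff[OF PV fin_V, of f] sum.reindex[OF geodesic_inj[OF p], of f] unfolding Q_def by simp
  have "(\<Sum>y\<in>?V. int (transmission G y)) = (\<Sum>x\<in>?V. \<Sum>y\<in>?V. ?g x y)"
    by (simp add: transmission_def)
  also have "\<dots> = (\<Sum>x\<in>Q. \<Sum>y\<in>Q. ?g x y) + (\<Sum>x\<in>Q. \<Sum>i\<le>d. ?g x (p i)) + (\<Sum>i\<le>d. \<Sum>y\<in>Q. ?g (p i) y)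
      + (\<Sum>i\<le>d. \<Sum>j\<le>d. ?g (p i) (p j))"
    by (simp add: split sum.distrib)
  also have "(\<Sum>i\<le>d. \<Sum>y\<in>Q. ?g (p i) y) = (\<Sum>x\<in>Q. \<Sum>i\<le>d. ?g x (p i))"
  proof (subst sum.swap, intro sum.cong refl)
    fix x i assume "x \<in> Q" "i \<in> {..d}"
    then show "?g (p i) x = ?g x (p i)" using gdist_sym[of "p i" x] geodesic_V[OF p] by (simp add: Q_def)
  qed
  also have "(\<Sum>i\<le>d. \<Sum>j\<le>d. ?g (p i) (p j)) = (\<Sum>i\<le>d. \<Sum>j\<le>d. \<bar>int i - int j\<bar>)"
    by (intro sum.cong refl geodesicD[OF p]) auto
  finally have SD: "(\<Sum>y\<in>?V. int (transmission G y)) = (\<Sum>x\<in>Q. \<Sum>y\<in>Q. ?g x y)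
    + 2 * (\<Sum>x\<in>Q. \<Sum>i\<le>d. ?g x (p i)) + (\<Sum>i\<le>d. \<Sum>j\<le>d. \<bar>int i - int j\<bar>)" by simp
  have QP: "r * ((int d + 1)\<^sup>2 + 3) \<le> 4 * (\<Sum>x\<in>Q. \<Sum>i\<le>d. ?g x (p i))"
  proof -
    have "(int d + 1)\<^sup>2 + 3 \<le> 4 * (\<Sum>i\<le>d. ?g x (p i))" if x: "x \<in> Q" for x
    proof (rule sum_dist_to_path)
      have xV: "x \<in> ?V" using x by (simp add: Q_def)
      fix i assume i: "i \<le> d"
      have "x \<noteq> p i" using x i by (auto simp: Q_def)
      then have "gdist G x (p i) \<noteq> 0" using gdist_eq_0[OF xV geodesic_V[OF p i]] by simp
      then show "1 \<le> ?g x (p i)" by simp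
      have di: "d - i \<le> d" by simp
      have "gdist G (p i) (p (d - i)) \<le> gdist G (p i) x + gdist G x (p (d - i))"
        by (rule gdist_triangle[OF geodesic_V[OF p i] xV geodesic_V[OF p di]])
      moreover have "gdist G (p i) x = gdist G x (p i)" by (rule gdist_sym[OF geodesic_V[OF p i] xV])
      moreover have "?g (p i) (p (d - i)) = \<bar>int d - 2 * int i\<bar>"
        using geodesicD[OF p i di] i by (simp add: of_nat_diff)
      ultimately show "\<bar>int d - 2 * int i\<bar> \<le> ?g x (p i) + ?g x (p (d - i))" by linarith
    qed
    then have "(\<Sum>x\<in>Q. (int d + 1)\<^sup>2 + 3) \<le> (\<Sum>x\<in>Q. 4 * (\<Sum>i\<le>d. ?g x (p i)))" by (rule sum_mono)
    then show ?thesis by (simp add: r sum_distrib_left)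
  qed
  define A where "A = parcs G \<inter> Q \<times> Q"
  define K where "K = (\<lambda>i. (p i, p (Suc i))) ` {..<d}"
  have K: "K \<subseteq> parcs G" "K\<inverse> \<subseteq> parcs G" using geodesic_arc_iff[OF p] unfolding K_def by auto
  have injp: "p i = p j \<longleftrightarrow> i = j" if "i \<le> d" "j \<le> d" for i j
    using geodesic_inj[OF p] that by (auto dest: inj_onD)
  have cK: "card K = d" unfolding K_def
    by (subst card_image) (auto simp: inj_on_def injp)
  have finK: "finite K" by (simp add: K_def)
  have "K \<inter> K\<inverse> = {}" unfolding K_def by (auto simp: injp)
  then have "card (K \<union> K\<inverse>) = 2 * d" using cK finK by (subst card_Un_disjoint) auto
  moreover have "A \<inter> (K \<union> K\<inverse>) = {}" unfolding A_def K_def Q_def by auto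
  moreover have "card (A \<union> (K \<union> K\<inverse>)) \<le> card (parcs G)"
    using K by (intro card_mono) (auto simp: A_def)
  ultimately have "card A + 2 * d \<le> 2 * card ?V"
    using card finK by (subst (asm) card_Un_disjoint) (auto simp: A_def)
  then have cA: "int (card A) \<le> 2 * (n - int d)" by (simp add: n_def)
  have QQ: "2 * r * (r - 1) \<le> (\<Sum>x\<in>Q. \<Sum>y\<in>Q. ?g x y) + int (card A)"
  proof -
    have "(\<Sum>x\<in>Q. \<Sum>y\<in>Q. if x = y then 0 else 2) \<le> (\<Sum>x\<in>Q. \<Sum>y\<in>Q. ?g x y + (if (x, y) \<in> A then 1 else 0))"
    proof (intro sum_mono)
      fix x y assume xy: "x \<in> Q" "y \<in> Q"
      then have V: "x \<in> ?V" "y \<in> ?V" by (auto simp: Q_def)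
      consider "x = y" | "x \<noteq> y" "gdist G x y = 1" | "2 \<le> gdist G x y"
        using gdist_eq_0[OF V] by linarith
      then show "(if x = y then 0 else 2) \<le> ?g x y + (if (x, y) \<in> A then 1 else 0)"
      proof cases
        case 2 then have "(x, y) \<in> A" using gdist_1_arc[OF V] xy by (simp add: A_def)
        then show ?thesis using 2 by simp
      qed simp_all
    qed
    also have "\<dots> = (\<Sum>x\<in>Q. \<Sum>y\<in>Q. ?g x y) + (\<Sum>x\<in>Q. \<Sum>y\<in>Q. if (x, y) \<in> A then 1 else 0)"
      by (simp add: sum.distrib)
    also have "(\<Sum>x\<in>Q. \<Sum>y\<in>Q. if (x, y) \<in> A then 1 else 0) = (\<Sum>e\<in>Q \<times> Q. if e \<in> A then 1 else (0::int))"
      by (simp add: sum.cartesian_product)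
    also have "\<dots> = (\<Sum>e\<in>(Q \<times> Q) \<inter> A. 1)" using finQ by (subst sum.inter_restrict) auto
    also have "(Q \<times> Q) \<inter> A = A" by (auto simp: A_def)
    finally have "(\<Sum>x\<in>Q. \<Sum>y\<in>Q. if x = y then 0 else 2) \<le> (\<Sum>x\<in>Q. \<Sum>y\<in>Q. ?g x y) + int (card A)" by simp
    moreover have "(\<Sum>x\<in>Q. \<Sum>y\<in>Q. if x = y then 0 else (2::int)) = (\<Sum>x\<in>Q. 2 * (r - 1))"
    proof (intro sum.cong refl)
      fix x assume x: "x \<in> Q"
      have "(\<Sum>y\<in>Q. if x = y then 0 else (2::int))
          = (if x = x then 0 else 2) + (\<Sum>y\<in>Q - {x}. if x = y then 0 else 2)"
        by (rule sum.remove[OF finQ x])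
      also have "(\<Sum>y\<in>Q - {x}. if x = y then 0 else (2::int)) = (\<Sum>y\<in>Q - {x}. 2)"
        by (rule sum.cong) auto
      finally show "(\<Sum>y\<in>Q. if x = y then 0 else (2::int)) = 2 * (r - 1)"
        using x finQ card_gt_0_iff[of Q] by (auto simp: r of_nat_diff Suc_leI)
    qed
    ultimately show ?thesis by (simp add: r algebra_simps)
  qed
  show ?thesis using SD QP QQ cA sum_dist_all[of d] by (simp add: algebra_simps)
qed

theorem reverse_degree_distance_le:
  assumes card: "card (parcs G) = 2 * card (pverts G)"
  defines "n \<equiv> int (card (pverts G))" and "d \<equiv> int (diameter G)"
  shows "3 * reverse_degree_distance G \<le> 6 * n * (n - 1) * d + 3 * n * (n - 2)
    - (2 * d * (d + 1) * (d + 2) + 3 * (n - d - 1) * ((d + 1)\<^sup>2 + 3)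
       + 12 * (n - d - 1) * (n - d - 2) - 12 * (n - d))"
proof -
  obtain p where p: "geodesic p (diameter G)" by (rule diametral_geodesic)
  have "int (card (uedges G)) = n" using card card_arcs_uedges by (simp add: n_def)
  then have "reverse_degree_distance G = 2 * (n - 1) * n * d - int (degree_distance G)"
    by (simp add: reverse_degree_distance_def n_def d_def)
  moreover note degree_distance_ge[OF card, folded n_def]
  moreover note sum_transmission_ge[OF card p, folded n_def d_def]
  ultimately show ?thesis by (simp add: algebra_simps)
qed

end

section \<open>Graphs with explicit adjacency and distances\<close>

text \<open>A labelling of \<open>G\<close> by \<open>{..<n}\<close> under which its arcs become
  \<open>R\<close>; here \<open>R\<close> contains both orientations of every edge.\<close>

definition copy_via :: "(nat \<Rightarrow> 'a) \<Rightarrow> 'a ugraph \<Rightarrow> nat \<Rightarrow> nat rel \<Rightarrow> bool" where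
  "copy_via \<phi> G n R \<longleftrightarrow> bij_betw \<phi> {..<n} (pverts G) \<and> parcs G = map_prod \<phi> \<phi> ` R"

definition copy :: "'a ugraph \<Rightarrow> nat \<Rightarrow> nat rel \<Rightarrow> bool" where
  "copy G n R \<longleftrightarrow> (\<exists>\<phi>. copy_via \<phi> G n R)"

text \<open>One labelling composed with the inverse of the other. That \<open>R\<close> stays within
  \<open>{..<n}\<close> ensures that the inverse is genuine at all endpoints.\<close>

lemma copy_iso:
  assumes G: "copy G n R" and H: "copy H n R" and R: "R \<subseteq> {..<n} \<times> {..<n}"
  shows "graph_iso G H"
proof -
  obtain \<phi> \<psi> where \<phi>: "bij_betw \<phi> {..<n} (pverts G)" "parcs G = map_prod \<phi> \<phi> ` R"
    and \<psi>: "bij_betw \<psi> {..<n} (pverts H)" "parcs H = map_prod \<psi> \<psi> ` R"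
    using G H unfolding copy_def copy_via_def by auto
  define f where "f = \<psi> \<circ> inv_into {..<n} \<phi>"
  have f: "bij_betw f (pverts G) (pverts H)" unfolding f_def
    by (rule bij_betw_trans[OF bij_betw_inv_into[OF \<phi>(1)] \<psi>(1)])
  have f\<phi>: "f (\<phi> i) = \<psi> i" if "i < n" for i
    unfolding f_def using that \<phi>(1) by (simp add: bij_betw_def inv_into_f_f)
  have A: "parcs H = map_prod f f ` parcs G"
  proof -
    have "map_prod f f ` parcs G = (\<lambda>e. map_prod f f (map_prod \<phi> \<phi> e)) ` R" unfolding \<phi>(2) image_image ..
    also have "\<dots> = map_prod \<psi> \<psi> ` R" using R by (intro image_cong) (auto simp: f\<phi>)
    finally show ?thesis unfolding \<psi>(2) by simp
  qed
  have AV: "parcs G \<subseteq> pverts G \<times> pverts G" unfolding \<phi>(2) using R \<phi>(1) by (auto simp: bij_betw_def)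
  define hom where "hom = \<lparr>iso_verts = f, iso_arcs = map_prod f f, iso_head = snd, iso_tail = fst\<rparr>"
  have inj: "inj_on f (pverts G)" using f by (rule bij_betw_imp_inj_on)
  have "inj_on (map_prod f f) (parcs G)"
    by (rule inj_on_subset[OF map_prod_inj_on[OF inj inj] AV])
  moreover have "wf_digraph (with_proj G)" using AV by unfold_locales auto
  ultimately have "pre_digraph.digraph_isomorphism (with_proj G) hom"
    unfolding pre_digraph.digraph_isomorphism_def hom_def using inj by auto
  moreover have "with_proj H = app_iso hom (with_proj G)"
    unfolding app_iso_def hom_def using A f by (simp add: with_proj_def bij_betw_def)
  ultimately show ?thesis unfolding digraph_iso_def by blast
qed

text \<open>A certificate that \<open>\<delta>\<close> is the distance function of \<open>R\<close>,
  of the form needed for \<open>gdist_eq_potential\<close> at every start vertex. No walk has to be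
  exhibited, and \<open>\<delta>_pred\<close> yields connectedness as well.\<close>

locale dist_fun =
  fixes n :: nat and R :: "nat rel" and \<delta> :: "nat \<Rightarrow> nat \<Rightarrow> nat"
  assumes n: "0 < n" and R: "R \<subseteq> {..<n} \<times> {..<n}" and R_sym: "(i, j) \<in> R \<Longrightarrow> (j, i) \<in> R"
    and R_irrefl: "(i, i) \<notin> R"
    and \<delta>_refl: "i < n \<Longrightarrow> \<delta> i i = 0"
    and \<delta>_lip: "i < n \<Longrightarrow> (j, k) \<in> R \<Longrightarrow> \<delta> i k \<le> \<delta> i j + 1"
    and \<delta>_pred: "i < n \<Longrightarrow> j < n \<Longrightarrow> j \<noteq> i \<Longrightarrow> \<exists>k. (k, j) \<in> R \<and> \<delta> i j = Suc (\<delta> i k)"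
begin

lemma finR: "finite R" using R by (rule finite_subset) simp

context
  fixes G :: "'a ugraph" and \<phi> assumes copy: "copy_via \<phi> G n R"
begin

lemma bij: "bij_betw \<phi> {..<n} (pverts G)" and A: "parcs G = map_prod \<phi> \<phi> ` R"
  using copy by (auto simp: copy_via_def)

lemma V: "pverts G = \<phi> ` {..<n}" using bij by (simp add: bij_betw_def)

lemma inj: "inj_on \<phi> {..<n}" using bij by (simp add: bij_betw_def)

lemma \<phi>_eq: "i < n \<Longrightarrow> j < n \<Longrightarrow> \<phi> i = \<phi> j \<longleftrightarrow> i = j"
  using inj by (auto dest: inj_onD)

lemma arc_iff:
  assumes "i < n" "j < n"
  shows "(\<phi> i, \<phi> j) \<in> parcs G \<longleftrightarrow> (i, j) \<in> R"
proof
  assume "(\<phi> i, \<phi> j) \<in> parcs G"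
  then obtain k l where kl: "(k, l) \<in> R" "\<phi> i = \<phi> k" "\<phi> j = \<phi> l" unfolding A by auto
  then have "k < n" "l < n" using R by auto
  then have "i = k" "j = l" using kl \<phi>_eq assms by blast+
  then show "(i, j) \<in> R" using kl by simp
next
  assume "(i, j) \<in> R"
  then show "(\<phi> i, \<phi> j) \<in> parcs G" unfolding A by (intro image_eqI[of _ _ "(i, j)"]) simp_all
qed

lemma copy_arcE:
  assumes "(u, v) \<in> parcs G"
  obtains i j where "u = \<phi> i" "v = \<phi> j" "(i, j) \<in> R" "i < n" "j < n"
  using assms R unfolding A by auto

lemma pair_graph_copy: "pair_graph G"
proof unfold_locales
  show "finite (pverts G)" unfolding V by simp
  show "finite (parcs G)" unfolding A using finR by simp
  show "fst e \<in> pverts G" "snd e \<in> pverts G" if "e \<in> parcs G" for e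
    using copy_arcE[of "fst e" "snd e"] that unfolding V by auto
  show "fst e \<noteq> snd e" if "e \<in> parcs G" for e
    using copy_arcE[of "fst e" "snd e"] that \<phi>_eq R_irrefl by (metis prod.collapse)
  show "symmetric (with_proj G)"
    unfolding symmetric_def with_proj_simps
  proof (rule symI)
    fix u v assume "(u, v) \<in> parcs G"
    then obtain i j where "u = \<phi> i" "v = \<phi> j" "(i, j) \<in> R" "i < n" "j < n" by (rule copy_arcE)
    then show "(v, u) \<in> parcs G" using arc_iff R_sym by simp
  qed
qed

lemma conn_graph_copy: "conn_graph G"
proof -
  interpret pair_graph G by (rule pair_graph_copy)
  have "reachable (with_proj G) (\<phi> i) (\<phi> j)" if i: "i < n" and j: "j < n" for i j
    using j
  proof (induction "\<delta> i j" arbitrary: j)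
    case 0
    then have "j = i" using \<delta>_pred[OF i, of j] by auto
    then show ?case using i reachable_refl[of "\<phi> i"] V by auto
  next
    case (Suc m)
    then have "j \<noteq> i" using \<delta>_refl[OF i] by auto
    then obtain k where k: "(k, j) \<in> R" "\<delta> i j = Suc (\<delta> i k)" using \<delta>_pred[OF i] Suc by blast
    then have "k < n" using R by auto
    then have "reachable (with_proj G) (\<phi> i) (\<phi> k)" using Suc k by simp
    moreover have "(\<phi> k, \<phi> j) \<in> parcs G" using arc_iff k Suc \<open>k < n\<close> by simp
    ultimately show ?case using reachable_adj_trans[of "\<phi> i" "\<phi> k" "\<phi> j"] by simp
  qed
  moreover have "mk_symmetric (with_proj G) = G"
    by (rule pair_pre_digraph.equality) (auto simp: mk_symmetric_def intro: arcs_symmetric)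
  moreover have "pverts G \<noteq> {}" using n unfolding V by auto
  ultimately have "Digraph_Component.connected (with_proj G)"
    unfolding Digraph_Component.connected_def strongly_connected_def by (auto simp: V)
  then show ?thesis by unfold_locales
qed

lemma gdist_copy:
  assumes i: "i < n" and j: "j < n"
  shows "gdist G (\<phi> i) (\<phi> j) = \<delta> i j"
proof -
  interpret conn_graph G by (rule conn_graph_copy)
  define \<psi> where "\<psi> = inv_into {..<n} \<phi>"
  have \<psi>: "\<psi> (\<phi> k) = k" if "k < n" for k using that inj by (simp add: \<psi>_def inv_into_f_f)
  have Vi: "\<phi> k \<in> pverts G" if "k < n" for k using that V by simp
  have "gdist G (\<phi> i) (\<phi> j) = (\<lambda>v. \<delta> i (\<psi> v)) (\<phi> j)"
  proof (rule gdist_eq_potential[OF Vi[OF i] Vi[OF j]])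
    show "\<delta> i (\<psi> (\<phi> i)) = 0" using \<psi> i \<delta>_refl by simp
    show "\<delta> i (\<psi> y) \<le> \<delta> i (\<psi> x) + 1" if xy: "(x, y) \<in> parcs G" for x y
    proof -
      obtain k l where "x = \<phi> k" "y = \<phi> l" "(k, l) \<in> R" "k < n" "l < n" using xy by (rule copy_arcE)
      then show ?thesis using \<psi> \<delta>_lip[OF i] by simp
    qed
    show "\<exists>y. (y, x) \<in> parcs G \<and> \<delta> i (\<psi> x) = Suc (\<delta> i (\<psi> y))" if x: "x \<in> pverts G" "x \<noteq> \<phi> i" for x
    proof -
      obtain l where l: "x = \<phi> l" "l < n" using x(1) V by auto
      then obtain k where k: "(k, l) \<in> R" "\<delta> i l = Suc (\<delta> i k)" using \<delta>_pred[OF i, of l] x(2) by auto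
      then have "k < n" using R by auto
      then show ?thesis using l k \<psi> arc_iff by (intro exI[of _ "\<phi> k"]) simp
    qed
  qed
  then show ?thesis using \<psi> j by simp
qed

lemma card_V_copy: "card (pverts G) = n"
  unfolding V using card_image[OF inj] by simp

lemma card_A_copy: "card (parcs G) = card R"
proof -
  have "inj_on (map_prod \<phi> \<phi>) R" by (rule inj_on_subset[OF map_prod_inj_on[OF inj inj] R])
  then show ?thesis unfolding A by (rule card_image)
qed

lemma transmission_copy: "i < n \<Longrightarrow> transmission G (\<phi> i) = (\<Sum>j<n. \<delta> i j)"
  unfolding transmission_def V by (simp add: sum.reindex[OF inj] gdist_copy)

lemma degree_copy:
  assumes i: "i < n" shows "degree G (\<phi> i) = card {j. (i, j) \<in> R}"
proof -
  have "out_arcs (with_proj G) (\<phi> i) = (\<lambda>j. (\<phi> i, \<phi> j)) ` {j. (i, j) \<in> R}"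
  proof (intro equalityI subrelI)
    fix u v assume "(u, v) \<in> out_arcs (with_proj G) (\<phi> i)"
    then have uv: "(u, v) \<in> parcs G" "u = \<phi> i" by (auto simp: out_arcs_def)
    from uv(1) obtain k l where "u = \<phi> k" "v = \<phi> l" "(k, l) \<in> R" "k < n" "l < n" by (rule copy_arcE)
    then show "(u, v) \<in> (\<lambda>j. (\<phi> i, \<phi> j)) ` {j. (i, j) \<in> R}" using uv(2) \<phi>_eq i by auto
  next
    fix u v assume "(u, v) \<in> (\<lambda>j. (\<phi> i, \<phi> j)) ` {j. (i, j) \<in> R}"
    then show "(u, v) \<in> out_arcs (with_proj G) (\<phi> i)" using arc_iff i R by (auto simp: out_arcs_def)
  qed
  moreover have "inj_on (\<lambda>j. (\<phi> i, \<phi> j)) {j. (i, j) \<in> R}"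
    using R \<phi>_eq by (auto simp: inj_on_def)
  ultimately show ?thesis unfolding out_degree_def by (simp add: card_image)
qed

lemma max_degree_copy:
  assumes "\<And>i. i < n \<Longrightarrow> card {j. (i, j) \<in> R} \<le> D" and "i < n" "card {j. (i, j) \<in> R} = D"
  shows "max_degree G = D"
  unfolding max_degree_def
proof (rule Max_eqI)
  show "finite (degree G ` pverts G)" unfolding V by simp
  show "y \<le> D" if "y \<in> degree G ` pverts G" for y using that assms(1) by (auto simp: V degree_copy)
  show "D \<in> degree G ` pverts G" using assms(2,3) degree_copy[OF assms(2)] unfolding V by force
qed

lemma diameter_copy:
  assumes "\<And>i j. i < n \<Longrightarrow> j < n \<Longrightarrow> \<delta> i j \<le> d" and ij: "i < n" "j < n" "\<delta> i j = d"
  shows "diameter G = d"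
proof -
  interpret conn_graph G by (rule conn_graph_copy)
  show ?thesis
    by (rule diameter_eqI[of _ "\<phi> i" "\<phi> j"]) (use assms in \<open>auto simp: V gdist_copy\<close>)
qed

text \<open>Distributing the degree of a vertex over its edges, each undirected edge contributes the
  transmissions of its two ends; \<open>E\<close> picks one orientation per edge.\<close>

lemma degree_distance_copy:
  assumes E: "R = E \<union> E\<inverse>" "E \<inter> E\<inverse> = {}"
  shows "int (degree_distance G) = (\<Sum>(i, j)\<in>E. (\<Sum>k<n. int (\<delta> i k)) + (\<Sum>k<n. int (\<delta> j k)))"
proof -
  define T where "T i = (\<Sum>k<n. \<delta> i k)" for i
  have "degree_distance G = (\<Sum>i<n. card {j. (i, j) \<in> R} * T i)"
    unfolding degree_distance_def V T_def
    by (simp add: sum.reindex[OF inj] degree_copy transmission_copy)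
  also have "\<dots> = (\<Sum>i<n. \<Sum>j\<in>{j. (i, j) \<in> R}. T i)" by simp
  also have "\<dots> = (\<Sum>e\<in>Sigma {..<n} (\<lambda>i. {j. (i, j) \<in> R}). T (fst e))"
    by (subst sum.Sigma) (use R in \<open>auto intro: finite_subset[of _ "{..<n}"] simp: case_prod_unfold\<close>)
  also have "Sigma {..<n} (\<lambda>i. {j. (i, j) \<in> R}) = R" using R by auto
  also have "(\<Sum>e\<in>R. T (fst e)) = (\<Sum>e\<in>E. T (fst e)) + (\<Sum>e\<in>E\<inverse>. T (fst e))"
    using E finR by (subst E(1), intro sum.union_disjoint) auto
  also have "E\<inverse> = prod.swap ` E" by auto
  also have "(\<Sum>e\<in>prod.swap ` E. T (fst e)) = (\<Sum>e\<in>E. T (snd e))"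
    by (subst sum.reindex) auto
  finally have "degree_distance G = (\<Sum>e\<in>E. T (fst e) + T (snd e))" by (simp add: sum.distrib)
  then show ?thesis by (simp add: T_def case_prod_unfold)
qed

end

end

text \<open>The vertices \<open>0, \<dots>, d\<close> form a path, \<open>d + 1\<close> is joined to \<open>a\<close> and \<open>b\<close>,
  and the vertices from \<open>d + 2\<close> on are pendant at \<open>h\<close>.\<close>

definition ear_edges :: "nat \<Rightarrow> nat \<Rightarrow> nat \<Rightarrow> nat \<Rightarrow> nat \<Rightarrow> nat rel" where
  "ear_edges d a b h n = (\<lambda>i. (i, Suc i)) ` {..<d} \<union> {(Suc d, a), (Suc d, b)} \<union> (\<lambda>j. (h, j)) ` {d + 2..<n}"

definition ear_rel :: "nat \<Rightarrow> nat \<Rightarrow> nat \<Rightarrow> nat \<Rightarrow> nat \<Rightarrow> nat rel" where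
  "ear_rel d a b h n = ear_edges d a b h n \<union> (ear_edges d a b h n)\<inverse>"

text \<open>The distance between the ear vertex \<open>d + 1\<close> and position \<open>i\<close>
  of the path. With \<open>b \<le> a + 2\<close> the middle case concerns only the vertex opposite
  to the ear vertex in a 4-cycle.\<close>

definition ear_gap :: "nat \<Rightarrow> nat \<Rightarrow> nat \<Rightarrow> nat" where
  "ear_gap a b i = (if i \<le> a then a + 1 - i else if i < b then 2 else i + 1 - b)"

definition ear_dist :: "nat \<Rightarrow> nat \<Rightarrow> nat \<Rightarrow> nat \<Rightarrow> nat \<Rightarrow> nat \<Rightarrow> nat" where
  "ear_dist d a b h i j =
    (if i = j then 0
     else if i \<le> d then
       (if j \<le> d then (i - j) + (j - i) else if j = Suc d then ear_gap a b i else (i - h) + (h - i) + 1)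
     else if i = Suc d then (if j \<le> d then ear_gap a b j else ear_gap a b h + 1)
     else if j \<le> d then (j - h) + (h - j) + 1
     else if j = Suc d then ear_gap a b h + 1 else 2)"

text \<open>The same path with all other vertices pendant at \<open>c\<close>, two of them joined by an edge.\<close>

definition triangle_edges :: "nat \<Rightarrow> nat \<Rightarrow> nat \<Rightarrow> nat rel" where
  "triangle_edges d c n = (\<lambda>i. (i, Suc i)) ` {..<d} \<union> {(Suc d, d + 2)} \<union> (\<lambda>j. (c, j)) ` {d + 1..<n}"

definition triangle_rel :: "nat \<Rightarrow> nat \<Rightarrow> nat \<Rightarrow> nat rel" where
  "triangle_rel d c n = triangle_edges d c n \<union> (triangle_edges d c n)\<inverse>"

definition triangle_dist :: "nat \<Rightarrow> nat \<Rightarrow> nat \<Rightarrow> nat \<Rightarrow> nat" where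
  "triangle_dist d c i j =
    (if i = j then 0
     else if i \<le> d then (if j \<le> d then (i - j) + (j - i) else (i - c) + (c - i) + 1)
     else if j \<le> d then (j - c) + (c - j) + 1
     else if i \<le> d + 2 \<and> j \<le> d + 2 then 1 else 2)"

lemma mem_ear_edges:
  "(i, j) \<in> ear_edges d a b h n \<longleftrightarrow>
     (i < d \<and> j = Suc i) \<or> (i = Suc d \<and> (j = a \<or> j = b)) \<or> (i = h \<and> d + 2 \<le> j \<and> j < n)"
  by (simp add: ear_edges_def image_iff) blast

lemma mem_triangle_edges:
  "(i, j) \<in> triangle_edges d c n \<longleftrightarrow>
     (i < d \<and> j = Suc i) \<or> (i = Suc d \<and> j = d + 2) \<or> (i = c \<and> d + 1 \<le> j \<and> j < n)"
  by (simp add: triangle_edges_def image_iff) blast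

lemma mem_ear_rel:
  "(i, j) \<in> ear_rel d a b h n \<longleftrightarrow>
     (i < d \<and> j = Suc i) \<or> (j < d \<and> i = Suc j) \<or>
     (i = Suc d \<and> (j = a \<or> j = b)) \<or> (j = Suc d \<and> (i = a \<or> i = b)) \<or>
     (i = h \<and> d + 2 \<le> j \<and> j < n) \<or> (j = h \<and> d + 2 \<le> i \<and> i < n)"
  unfolding ear_rel_def Un_iff converse_iff mem_ear_edges by blast

lemma mem_triangle_rel:
  "(i, j) \<in> triangle_rel d c n \<longleftrightarrow>
     (i < d \<and> j = Suc i) \<or> (j < d \<and> i = Suc j) \<or>
     (i = Suc d \<and> j = d + 2) \<or> (j = Suc d \<and> i = d + 2) \<or>
     (i = c \<and> d + 1 \<le> j \<and> j < n) \<or> (j = c \<and> d + 1 \<le> i \<and> i < n)"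
  unfolding triangle_rel_def Un_iff converse_iff mem_triangle_edges by blast

text \<open>The bound \<open>b \<le> a + 2\<close> keeps the detour through \<open>d + 1\<close>
  from being a shortcut, so \<open>0, \<dots>, d\<close> remains a geodesic. The ear closes a
  triangle for \<open>b = a + 1\<close> and a 4-cycle for \<open>b = a + 2\<close>. The vertex
  \<open>h\<close> carrying the pendant vertices is left free in order to cover the graphs with
  \<open>k = 1\<close>.\<close>

locale ear =
  fixes d a b h n :: nat
  assumes ab: "a < b" "b \<le> a + 2" "b \<le> d" and h: "h \<le> d" and dn: "d + 2 \<le> n"
begin

lemma ear_dist_simps:
  "i \<le> d \<Longrightarrow> j \<le> d \<Longrightarrow> ear_dist d a b h i j = (i - j) + (j - i)"
  "i \<le> d \<Longrightarrow> ear_dist d a b h i (Suc d) = ear_gap a b i"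
  "i \<le> d \<Longrightarrow> d + 2 \<le> k \<Longrightarrow> ear_dist d a b h i k = (i - h) + (h - i) + 1"
  "j \<le> d \<Longrightarrow> ear_dist d a b h (Suc d) j = ear_gap a b j"
  "ear_dist d a b h i i = 0"
  "d + 2 \<le> k \<Longrightarrow> ear_dist d a b h (Suc d) k = ear_gap a b h + 1"
  "j \<le> d \<Longrightarrow> d + 2 \<le> k \<Longrightarrow> ear_dist d a b h k j = (j - h) + (h - j) + 1"
  "d + 2 \<le> k \<Longrightarrow> ear_dist d a b h k (Suc d) = ear_gap a b h + 1"
  "d + 2 \<le> k \<Longrightarrow> d + 2 \<le> l \<Longrightarrow> ear_dist d a b h k l = (if k = l then 0 else 2)"
  unfolding ear_dist_def by simp_all

lemma gap_Suc: "ear_gap a b (Suc i) \<le> ear_gap a b i + 1" "ear_gap a b i \<le> ear_gap a b (Suc i) + 1"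
  using ab unfolding ear_gap_def by (auto split: if_split)

lemma gap_ab: "ear_gap a b a = 1" "ear_gap a b b = 1"
  using ab unfolding ear_gap_def by simp_all

text \<open>The Lipschitz condition across the two ear edges, in both directions and seen from
  position \<open>i\<close>.\<close>

lemma gap_near:
  "ear_gap a b i \<le> (i - a) + (a - i) + 1" "(i - a) + (a - i) \<le> ear_gap a b i + 1"
  "ear_gap a b i \<le> (i - b) + (b - i) + 1" "(i - b) + (b - i) \<le> ear_gap a b i + 1"
  using ab unfolding ear_gap_def by (auto split: if_split)

lemma ear_dist_fun: "dist_fun n (ear_rel d a b h n) (ear_dist d a b h)"
proof
  show "0 < n" using dn by simp
  have "i < n \<and> j < n" if "(i, j) \<in> ear_rel d a b h n" for i j
    using that ab h dn unfolding mem_ear_rel by linarith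
  then show "ear_rel d a b h n \<subseteq> {..<n} \<times> {..<n}" by auto
  show "(i, j) \<in> ear_rel d a b h n \<Longrightarrow> (j, i) \<in> ear_rel d a b h n" for i j
    unfolding mem_ear_rel by blast
  show "(i, i) \<notin> ear_rel d a b h n" for i
    using ab h unfolding mem_ear_rel by linarith
  show "ear_dist d a b h i i = 0" for i by (simp add: ear_dist_def)
  show "ear_dist d a b h i k \<le> ear_dist d a b h i j + 1" if jk: "(j, k) \<in> ear_rel d a b h n" for i j k
  proof -
    consider "j < d" "k = Suc j" | "k < d" "j = Suc k" | "j = Suc d" "k = a" | "j = Suc d" "k = b"
      | "k = Suc d" "j = a" | "k = Suc d" "j = b" | "j = h" "d + 2 \<le> k" | "k = h" "d + 2 \<le> j"
      using jk unfolding mem_ear_rel by blast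
    note edge = this
    consider "i \<le> d" | "i = Suc d" | "d + 2 \<le> i" by linarith
    then show ?thesis
    proof cases
      case 1
      from edge show ?thesis
        by cases (use 1 ab h gap_near[of i] in \<open>simp_all add: ear_dist_simps, linarith+\<close>)
    next
      case 2
      from edge show ?thesis
        by cases (use 2 ab h gap_Suc[of j] gap_Suc[of k] gap_ab in \<open>simp_all add: ear_dist_simps\<close>)
    next
      case 3
      from edge show ?thesis
        by cases (use 3 ab h gap_near[of h] in \<open>simp_all add: ear_dist_simps, linarith+\<close>)
    qed
  qed
  \<comment> \<open>The witness is the last vertex before \<open>j\<close> on a shortest path from
    \<open>i\<close>.\<close>
  show "\<exists>k. (k, j) \<in> ear_rel d a b h n \<and> ear_dist d a b h i j = Suc (ear_dist d a b h i k)"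
    if ij: "i < n" "j < n" "j \<noteq> i" for i j
  proof -
    consider "j \<le> d" "i \<le> d" "j < i" | "j \<le> d" "i \<le> d" "i < j" | "j \<le> d" "i = Suc d" | "j \<le> d" "d + 2 \<le> i"
      | "j = Suc d" "i \<le> d" | "j = Suc d" "d + 2 \<le> i" | "d + 2 \<le> j" using ij by linarith
    then show ?thesis
    proof cases
      case 1 then show ?thesis by (intro exI[of _ "Suc j"]) (auto simp: mem_ear_rel ear_dist_def)
    next
      case 2 then show ?thesis by (intro exI[of _ "j - 1"]) (auto simp: mem_ear_rel ear_dist_def)
    next
      case 3
      consider "j = a" | "j = b" | "j < a" | "a < j" "j < b" | "b < j" by linarith
      then show ?thesis
      proof cases
        case 1 then show ?thesis using 3 ab by (intro exI[of _ "Suc d"]) (auto simp: mem_ear_rel ear_dist_def ear_gap_def)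
      next
        case 2 then show ?thesis using 3 ab by (intro exI[of _ "Suc d"]) (auto simp: mem_ear_rel ear_dist_def ear_gap_def)
      next
        case 3 then show ?thesis using \<open>j \<le> d\<close> \<open>i = Suc d\<close> ab by (intro exI[of _ "Suc j"]) (auto simp: mem_ear_rel ear_dist_def ear_gap_def)
      next
        case 4 then show ?thesis using 3 ab by (intro exI[of _ "a"]) (auto simp: mem_ear_rel ear_dist_def ear_gap_def)
      next
        case 5 then show ?thesis using 3 ab by (intro exI[of _ "j - 1"]) (auto simp: mem_ear_rel ear_dist_def ear_gap_def)
      qed
    next
      case 4
      consider "j = h" | "j < h" | "h < j" by linarith
      then show ?thesis
      proof cases
        case 1 then show ?thesis using 4 ij by (intro exI[of _ i]) (auto simp: mem_ear_rel ear_dist_def)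
      next
        case 2 then show ?thesis using 4 h by (intro exI[of _ "Suc j"]) (auto simp: mem_ear_rel ear_dist_def)
      next
        case 3 then show ?thesis using 4 h by (intro exI[of _ "j - 1"]) (auto simp: mem_ear_rel ear_dist_def)
      qed
    next
      case 5 then show ?thesis using ab
        by (intro exI[of _ "if i < b then a else b"]) (auto simp: mem_ear_rel ear_dist_def ear_gap_def)
    next
      case 6 then show ?thesis using ab h
        by (intro exI[of _ "if h < b then a else b"]) (auto simp: mem_ear_rel ear_dist_def ear_gap_def)
    next
      case 7 then show ?thesis using h ij
        by (intro exI[of _ h]) (auto simp: mem_ear_rel ear_dist_def)
    qed
  qed
qed

lemma ear_disjoint: "ear_edges d a b h n \<inter> (ear_edges d a b h n)\<inverse> = {}"
  using ab h unfolding ear_edges_def by auto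

lemma sum_ear_edges:
  fixes f :: "nat \<times> nat \<Rightarrow> 'b::comm_monoid_add"
  shows "(\<Sum>e\<in>ear_edges d a b h n. f e) =
    (\<Sum>i<d. f (i, Suc i)) + (f (Suc d, a) + f (Suc d, b)) + (\<Sum>j\<in>{d + 2..<n}. f (h, j))"
proof -
  have "(\<Sum>e\<in>ear_edges d a b h n. f e) = (\<Sum>e\<in>(\<lambda>i. (i, Suc i)) ` {..<d} \<union> {(Suc d, a), (Suc d, b)}. f e)
      + (\<Sum>e\<in>(\<lambda>j. (h, j)) ` {d + 2..<n}. f e)"
    unfolding ear_edges_def using h by (intro sum.union_disjoint) auto
  also have "(\<Sum>e\<in>(\<lambda>i. (i, Suc i)) ` {..<d} \<union> {(Suc d, a), (Suc d, b)}. f e)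
      = (\<Sum>e\<in>(\<lambda>i. (i, Suc i)) ` {..<d}. f e) + (\<Sum>e\<in>{(Suc d, a), (Suc d, b)}. f e)"
    by (intro sum.union_disjoint) auto
  finally show ?thesis using ab by (simp add: sum.reindex inj_on_def)
qed

lemma card_ear_rel: "card (ear_rel d a b h n) = 2 * n"
proof -
  have fin: "finite (ear_edges d a b h n)" by (simp add: ear_edges_def)
  have "card (ear_edges d a b h n) = n"
    using sum_ear_edges[of "\<lambda>_. 1::nat"] dn by simp
  moreover have "card (ear_rel d a b h n) = card (ear_edges d a b h n) + card ((ear_edges d a b h n)\<inverse>)"
    unfolding ear_rel_def using fin ear_disjoint by (intro card_Un_disjoint) auto
  ultimately show ?thesis by simp
qed

lemma sum_vertices:
  fixes f :: "nat \<Rightarrow> 'b::comm_monoid_add"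
  shows "(\<Sum>k<n. f k) = (\<Sum>k\<le>d. f k) + f (Suc d) + (\<Sum>k\<in>{d + 2..<n}. f k)"
proof -
  have iff: "k < n \<longleftrightarrow> k \<le> d \<or> k = Suc d \<or> d + 2 \<le> k \<and> k < n" for k using dn by linarith
  have "{..<n} = {..d} \<union> ({Suc d} \<union> {d + 2..<n})"
    by (intro set_eqI) (simp only: lessThan_iff Un_iff atMost_iff singleton_iff atLeastLessThan_iff, rule iff)
  then have "(\<Sum>k<n. f k) = (\<Sum>k\<in>{..d} \<union> ({Suc d} \<union> {d + 2..<n}). f k)" by (rule arg_cong)
  also have "\<dots> = (\<Sum>k\<le>d. f k) + (\<Sum>k\<in>{Suc d} \<union> {d + 2..<n}. f k)"
    by (rule sum.union_disjoint) auto
  also have "(\<Sum>k\<in>{Suc d} \<union> {d + 2..<n}. f k) = f (Suc d) + (\<Sum>k\<in>{d + 2..<n}. f k)"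
    by (subst sum.union_disjoint) auto
  finally show ?thesis by (simp add: add.assoc)
qed

text \<open>Transmissions in three stages: \<open>tr\<close> in the whole shape, \<open>pd\<close>
  for a position within the bare path, and \<open>gd\<close> for the ear vertex towards the
  path.\<close>

definition tr :: "nat \<Rightarrow> int" where "tr i = (\<Sum>k<n. int (ear_dist d a b h i k))"

definition pd :: "nat \<Rightarrow> int" where "pd i = (\<Sum>j\<le>d. \<bar>int i - int j\<bar>)"

definition gd :: int where "gd = (\<Sum>i\<le>d. int (ear_gap a b i))"

lemma q: "(\<Sum>k\<in>{d + 2..<n}. c) = (int n - int d - 2) * c" for c :: int
  using dn by (simp add: of_nat_diff)

lemma tr_path:
  assumes i: "i \<le> d"
  shows "tr i = pd i + int (ear_gap a b i) + (int n - int d - 2) * (\<bar>int i - int h\<bar> + 1)"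
proof -
  have p: "(\<Sum>k\<le>d. int (ear_dist d a b h i k)) = pd i"
    unfolding pd_def using i by (intro sum.cong) (auto simp: ear_dist_simps)
  have s: "(\<Sum>k\<in>{d + 2..<n}. int (ear_dist d a b h i k)) = (\<Sum>k\<in>{d + 2..<n}. \<bar>int i - int h\<bar> + 1)"
    using i by (intro sum.cong) (auto simp: ear_dist_simps)
  show ?thesis unfolding tr_def sum_vertices p s q ear_dist_simps(2)[OF i] ..
qed

lemma tr_ear: "tr (Suc d) = gd + (int n - int d - 2) * (int (ear_gap a b h) + 1)"
proof -
  have p: "(\<Sum>k\<le>d. int (ear_dist d a b h (Suc d) k)) = gd"
    unfolding gd_def by (intro sum.cong) (auto simp: ear_dist_simps)
  have s: "(\<Sum>k\<in>{d + 2..<n}. int (ear_dist d a b h (Suc d) k)) = (\<Sum>k\<in>{d + 2..<n}. int (ear_gap a b h) + 1)"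
    by (intro sum.cong) (auto simp: ear_dist_simps)
  show ?thesis unfolding tr_def sum_vertices p s q ear_dist_simps(5) by simp
qed

lemma tr_pendant:
  assumes s: "d + 2 \<le> s" "s < n"
  shows "tr s = pd h + int d + 1 + int (ear_gap a b h) + 1 + 2 * (int n - int d - 3)"
proof -
  have "(\<Sum>k\<le>d. int (ear_dist d a b h s k)) = (\<Sum>k\<le>d. \<bar>int h - int k\<bar> + 1)" using s by (intro sum.cong) (auto simp: ear_dist_def)
  moreover have "(\<Sum>k\<in>{d + 2..<n}. int (ear_dist d a b h s k)) = (\<Sum>k\<in>{d + 2..<n}. 2) - 2"
  proof -
    have "(\<Sum>k\<in>{d + 2..<n}. int (ear_dist d a b h s k))
        = int (ear_dist d a b h s s) + (\<Sum>k\<in>{d + 2..<n} - {s}. int (ear_dist d a b h s k))"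
      using s by (intro sum.remove) auto
    also have "(\<Sum>k\<in>{d + 2..<n} - {s}. int (ear_dist d a b h s k)) = (\<Sum>k\<in>{d + 2..<n} - {s}. 2)"
      using s by (intro sum.cong) (auto simp: ear_dist_def)
    also have "\<dots> = (\<Sum>k\<in>{d + 2..<n}. 2) - 2" using s by (subst sum_diff1) auto
    finally show ?thesis by (simp add: ear_dist_def)
  qed
  ultimately show ?thesis using q s unfolding tr_def sum_vertices by (simp add: ear_dist_def pd_def sum.distrib)
qed

lemma pd: "i \<le> d \<Longrightarrow> 2 * pd i = int i * (int i + 1) + (int d - int i) * (int d - int i + 1)"
  unfolding pd_def by (rule sum_dist)

text \<open>Up to the vertex before \<open>b\<close> the ear vertex is one step farther than
  \<open>a\<close> is. From \<open>b\<close> on, leaving through \<open>b\<close> instead of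
  \<open>a\<close> saves \<open>b - a\<close> at each of the \<open>d + 1 - b\<close>
  positions.\<close>

lemma gd: "gd = pd a + (int d + 1) - (int b - int a) * (int d + 1 - int b)"
proof -
  have "gd = (\<Sum>i\<le>d. \<bar>int a - int i\<bar> + 1 - (if b \<le> i then int b - int a else 0))"
    unfolding gd_def using ab by (intro sum.cong refl) (auto simp: ear_gap_def)
  also have "\<dots> = pd a + (int d + 1) - (\<Sum>i\<le>d. if b \<le> i then int b - int a else 0)"
    by (simp add: sum.distrib sum_subtractf pd_def)
  also have "(\<Sum>i\<le>d. if b \<le> i then int b - int a else 0) = (\<Sum>i\<in>{b..d}. int b - int a)"
    by (rule sum.mono_neutral_cong_right) auto
  finally show ?thesis using ab by (simp add: of_nat_diff algebra_simps)
qed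

end

context ear
begin

text \<open>Inner vertices of the path lie on two path edges and the ends on one, hence
  \<open>2 * (\<Sum>i\<le>d. tr i) - tr 0 - tr d\<close>. The ear edges and the \<open>q\<close>
  equal pendant edges make up the rest.\<close>

lemma degree_distance_ear:
  assumes G: "copy G n (ear_rel d a b h n)"
  defines "q \<equiv> int n - int d - 2"
  shows "int (degree_distance G) = 2 * (\<Sum>i\<le>d. tr i) - tr 0 - tr d + 2 * tr (Suc d) + tr a + tr b
     + q * (tr h + (pd h + int d + 2 + int (ear_gap a b h) + 2 * (q - 1)))"
proof -
  interpret D: dist_fun n "ear_rel d a b h n" "ear_dist d a b h" by (rule ear_dist_fun)
  obtain \<phi> where \<phi>: "copy_via \<phi> G n (ear_rel d a b h n)" using G unfolding copy_def by auto
  have "int (degree_distance G) = (\<Sum>(i, j)\<in>ear_edges d a b h n. tr i + tr j)"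
    unfolding tr_def using D.degree_distance_copy[OF \<phi> ear_rel_def ear_disjoint] by simp
  also have "\<dots> = (\<Sum>i<d. tr i + tr (Suc i)) + (2 * tr (Suc d) + tr a + tr b) + (\<Sum>j\<in>{d + 2..<n}. tr h + tr j)"
    by (simp add: sum_ear_edges)
  also have "(\<Sum>j\<in>{d + 2..<n}. tr h + tr j)
      = (\<Sum>j\<in>{d + 2..<n}. tr h + (pd h + int d + 2 + int (ear_gap a b h) + 2 * (q - 1)))"
    by (intro sum.cong) (auto simp: tr_pendant q_def)
  also have "\<dots> = q * (tr h + (pd h + int d + 2 + int (ear_gap a b h) + 2 * (q - 1)))"
    unfolding q q_def ..
  also have "(\<Sum>i<d. tr i + tr (Suc i)) = 2 * (\<Sum>i\<le>d. tr i) - tr 0 - tr d"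
  proof -
    have "(\<Sum>i\<le>d. tr i) = (\<Sum>i<d. tr i) + tr d" by (simp add: lessThan_Suc_atMost[symmetric])
    moreover have "(\<Sum>i\<le>d. tr i) = tr 0 + (\<Sum>i<d. tr (Suc i))" by (simp add: sum.atMost_shift)
    ultimately show ?thesis by (simp add: sum.distrib)
  qed
  finally show ?thesis by simp
qed

lemma sum_tr: "3 * (\<Sum>i\<le>d. tr i) = int d * (int d + 1) * (int d + 2) + 3 * gd
    + 3 * (int n - int d - 2) * (pd h + int d + 1)"
proof -
  have "(\<Sum>i\<le>d. tr i) = (\<Sum>i\<le>d. pd i + int (ear_gap a b i) + (int n - int d - 2) * (\<bar>int h - int i\<bar> + 1))"
    by (intro sum.cong refl) (auto simp: tr_path abs_minus_commute)
  also have "\<dots> = (\<Sum>i\<le>d. pd i) + gd + (int n - int d - 2) * (\<Sum>i\<le>d. \<bar>int h - int i\<bar> + 1)"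
    unfolding sum.distrib sum_distrib_left[symmetric] gd_def ..
  also have "(\<Sum>i\<le>d. \<bar>int h - int i\<bar> + 1) = pd h + int d + 1" by (simp add: sum.distrib pd_def)
  finally show ?thesis using sum_dist_all[of d] unfolding pd_def[symmetric] by (simp add: algebra_simps)
qed

lemma pd_ends: "2 * pd 0 = int d * (int d + 1)" "2 * pd d = int d * (int d + 1)"
  using pd[of 0] pd[of d] by simp_all

lemma pd_add: "i + k \<le> d \<Longrightarrow> pd (i + k) = pd i + int k * (2 * int i + int k - int d)"
  using pd[of i] pd[of "i + k"] by (simp add: algebra_simps)

text \<open>An inner \<open>h\<close> keeps the pendant vertices within \<open>d\<close> of both
  ends of the path; the condition on the gap does the same for their distance to the ear vertex,
  which is one more than the gap.\<close>

lemma diameter_ear: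
  assumes G: "copy G n (ear_rel d a b h n)" and "1 \<le> h" "h < d" "ear_gap a b h < d"
  shows "diameter G = d"
proof -
  interpret D: dist_fun n "ear_rel d a b h n" "ear_dist d a b h" by (rule ear_dist_fun)
  obtain \<phi> where \<phi>: "copy_via \<phi> G n (ear_rel d a b h n)" using G unfolding copy_def by auto
  show ?thesis
  proof (rule D.diameter_copy[OF \<phi>])
    show "ear_dist d a b h i j \<le> d" if "i < n" "j < n" for i j
    proof -
      have gap: "ear_gap a b k \<le> d" if "k \<le> d" for k using ab that by (auto simp: ear_gap_def)
      have hub: "k - h + (h - k) + 1 \<le> d" if "k \<le> d" for k using that assms by linarith
      have path: "k - l + (l - k) \<le> d" if "k \<le> d" "l \<le> d" for k l using that by linarith
      have "2 \<le> d" using assms by linarith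
      consider "i \<le> d" | "i = Suc d" | "d + 2 \<le> i" by linarith
      note ci = this
      consider "j \<le> d" | "j = Suc d" | "d + 2 \<le> j" by linarith
      then show ?thesis
      proof cases
        case 1
        from ci show ?thesis
          by cases (use 1 gap[of j] hub[of j] path[of i j] in \<open>simp_all only: ear_dist_simps\<close>)
      next
        case 2
        from ci show ?thesis
          by cases (use 2 gap[of i] assms(4) in \<open>simp_all add: ear_dist_simps\<close>)
      next
        case 3
        from ci show ?thesis
          by cases (use 3 hub[of i] assms(4) \<open>2 \<le> d\<close> in \<open>simp_all add: ear_dist_simps\<close>)
      qed
    qed
    show "ear_dist d a b h 0 d = d" using ab by (simp add: ear_dist_def)
    show "0 < n" "d < n" using dn by auto
  qed
qed

lemma reverse_ear:
  assumes G: "copy G n (ear_rel d a b h n)" and "1 \<le> h" "h < d" "ear_gap a b h < d"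
  shows "reverse_degree_distance G = 2 * (int n - 1) * int n * int d - int (degree_distance G)"
    and "unicyclic G" and "card (pverts G) = n"
proof -
  interpret D: dist_fun n "ear_rel d a b h n" "ear_dist d a b h" by (rule ear_dist_fun)
  obtain \<phi> where \<phi>: "copy_via \<phi> G n (ear_rel d a b h n)" using G unfolding copy_def by auto
  show n: "card (pverts G) = n" by (rule D.card_V_copy[OF \<phi>])
  have c: "card (parcs G) = 2 * n" using D.card_A_copy[OF \<phi>] card_ear_rel by simp
  have cg: "conn_graph G" by (rule D.conn_graph_copy[OF \<phi>])
  show "unicyclic G" unfolding unicyclic_iff using cg c n by simp
  have "card (uedges G) = n" using conn_graph.card_arcs_uedges[OF cg] c by simp
  then show "reverse_degree_distance G = 2 * (int n - 1) * int n * int d - int (degree_distance G)"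
    unfolding reverse_degree_distance_def n diameter_ear[OF assms] by simp
qed

text \<open>The vertex \<open>a\<close> has two path neighbours, the ear vertex and
  \<open>n - d - 2\<close> pendant neighbours. Every other degree is at most 3.\<close>

lemma max_degree_ear:
  assumes G: "copy G n (ear_rel d a b h n)" and "h = a" "1 \<le> a"
  shows "max_degree G = n - d + 1"
proof -
  interpret D: dist_fun n "ear_rel d a b h n" "ear_dist d a b h" by (rule ear_dist_fun)
  obtain \<phi> where \<phi>: "copy_via \<phi> G n (ear_rel d a b h n)" using G unfolding copy_def by auto
  show ?thesis
  proof (rule D.max_degree_copy[OF \<phi>])
    have "{j. (a, j) \<in> ear_rel d a b h n} = {a - 1, Suc a, Suc d} \<union> {d + 2..<n}"
      using assms ab unfolding mem_ear_rel by auto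
    moreover have "a - 1 \<noteq> Suc a" "a - 1 \<noteq> Suc d" "Suc a \<noteq> Suc d" "\<not> d + 2 \<le> a - 1" "\<not> d + 2 \<le> Suc a"
      using ab assms by linarith+
    moreover from this have "card ({a - 1, Suc a, Suc d} \<union> {d + 2..<n}) = 3 + (n - (d + 2))"
      by (subst card_Un_disjoint) simp_all
    ultimately show "card {j. (a, j) \<in> ear_rel d a b h n} = n - d + 1" using dn by simp
    show "a < n" using ab dn by simp
    then show "card {j. (i, j) \<in> ear_rel d a b h n} \<le> n - d + 1" if "i < n" for i
    proof (cases "i = a")
      case True then show ?thesis using \<open>card {j. (a, j) \<in> ear_rel d a b h n} = n - d + 1\<close> by simp
    next
      case False
      have "{j. (i, j) \<in> ear_rel d a b h n} \<subseteq> (if i \<le> d then {i - 1, Suc i, Suc d} else {a, b})"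
        using False assms ab unfolding mem_ear_rel by auto
      then have "card {j. (i, j) \<in> ear_rel d a b h n} \<le> card (if i \<le> d then {i - 1, Suc i, Suc d} else {a, b})"
        by (intro card_mono) auto
      also have "\<dots> \<le> 3" by (auto simp: card_insert_if)
      finally show ?thesis using dn by simp
    qed
  qed
qed

end

section \<open>Values for the extremal shapes\<close>

text \<open>Twice the transmission of position \<open>c\<close> in a path with \<open>d\<close>
  edges.\<close>

definition pathsum :: "int \<Rightarrow> int \<Rightarrow> int" where
  "pathsum d c = c * (c + 1) + (d - c) * (d - c + 1)"

text \<open>The part of three times the value that is common to both ear shapes and to the off-path
  triangle, when the pendant vertices hang at \<open>c\<close>. The term in \<open>pathsum\<close>
  pulls \<open>c\<close> to the middle; the terms linear in \<open>c\<close> that the ears add pull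
  it slightly below.\<close>

definition rdd_base :: "int \<Rightarrow> int \<Rightarrow> int \<Rightarrow> int" where
  "rdd_base n d c = 6 * n * (n - 1) * d - 2 * d * (d + 1) * (d + 2) - 12 * (n - d - 1) * (d + 1)
     - 12 * (n - d - 1) * (n - d - 2) - 6 * (n - d - 1) - 3 * (2 * (n - d - 1) + 1) * pathsum d c"

lemma rdd_ear3:
  assumes G: "copy G n (ear_rel d c (Suc c) c n)" and c: "1 \<le> c" "Suc c \<le> d" "d + 2 \<le> n"
  shows "3 * reverse_degree_distance G
    = rdd_base n d c + 3 * int n * int n - 9 * int n + 18 * (int d - int c) + 6"
proof -
  interpret ear d c "Suc c" c n using c by unfold_locales auto
  define P where "P = pd c"
  have P: "2 * P = pathsum d c" using pd[of c] c unfolding P_def pathsum_def by simp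
  have g0: "ear_gap c (Suc c) 0 = c + 1" "ear_gap c (Suc c) d = d - c" "ear_gap c (Suc c) c = 1" "ear_gap c (Suc c) (Suc c) = 1"
    using c by (auto simp: ear_gap_def)
  have P1: "pd (Suc c) = P + 2 * int c + 1 - int d" using pd_add[of c 1] c by (simp add: P_def)
  have t: "tr 0 = pd 0 + int c + 1 + (int n - int d - 2) * (int c + 1)"
    "tr d = pd d + (int d - int c) + (int n - int d - 2) * (int d - int c + 1)"
    "tr c = P + 1 + (int n - int d - 2)"
    "tr (Suc c) = P + 2 * int c + 1 - int d + 1 + (int n - int d - 2) * 2"
    using c tr_path[of 0] tr_path[of d] tr_path[of c] tr_path[of "Suc c"]
    by (simp_all add: g0 P1 P_def of_nat_diff)
  have gd': "gd = P + int c + 1" using gd unfolding P_def by simp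
  have "3 * int (degree_distance G) = 2 * (int d * (int d + 1) * (int d + 2) + 3 * gd
    + 3 * (int n - int d - 2) * (P + int d + 1)) + 3 * (- tr 0 - tr d + 2 * tr (Suc d) + tr c + tr (Suc c)
     + (int n - int d - 2) * (tr c + (P + int d + 2 + 1 + 2 * (int n - int d - 2 - 1))))"
    using degree_distance_ear[OF G] sum_tr by (simp add: g0 P_def)
  then have "3 * int (degree_distance G) = 2 * (int d * (int d + 1) * (int d + 2) + 3 * (P + int c + 1)
    + 3 * (int n - int d - 2) * (P + int d + 1))
    - 3 * (int d * (int d + 1) + int d + 1 + (int n - int d - 2) * (int d + 2))
    + 3 * (2 * (P + int c + 1 + (int n - int d - 2) * 2) + P + 1 + (int n - int d - 2)
     + P + 2 * int c + 2 - int d + (int n - int d - 2) * 2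
     + (int n - int d - 2) * (P + 1 + (int n - int d - 2) + (P + int d + 2 + 1 + 2 * (int n - int d - 2 - 1))))"
    unfolding t tr_ear gd' using pd_ends by (simp add: g0 algebra_simps)
  moreover have "reverse_degree_distance G = 2 * (int n - 1) * int n * int d - int (degree_distance G)"
    using reverse_ear(1)[OF G] c by (simp add: g0)
  ultimately show ?thesis unfolding rdd_base_def P[symmetric] by (simp add: algebra_simps)
qed

text \<open>The second alternative for \<open>h\<close> puts a single pendant vertex at
  \<open>c + 1\<close>, the exact centre of the path. The value is the same there, which gives the
  companion graph with \<open>k = 1\<close>.\<close>

lemma rdd_ear4:
  assumes G: "copy G n (ear_rel d c b h n)" and b: "b = c + 2" and c: "1 \<le> c" "c + 2 \<le> d" "d + 2 \<le> n"
    and hc: "h = c \<or> h = Suc c \<and> n = d + 3 \<and> d = 2 * c + 2"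
  shows "3 * reverse_degree_distance G
    = rdd_base n d c + 3 * int n * int n - 12 * int n + 36 * (int d - int c - 1) + 12"
proof -
  interpret ear d c b h n using b c hc by unfold_locales auto
  define P where "P = pd c"
  define q where "q = int n - int d - 2"
  have P: "2 * P = pathsum d c" using pd[of c] c unfolding P_def pathsum_def by simp
  have g0: "ear_gap c b 0 = c + 1" "ear_gap c b d = d - c - 1" "ear_gap c b c = 1"
    "ear_gap c b (Suc c) = 2" "ear_gap c b b = 1"
    using b c by (auto simp: ear_gap_def)
  have P2: "pd b = P + 4 * int c + 4 - 2 * int d" using pd_add[of c 2] b c by (simp add: P_def)
  have P1: "pd (Suc c) = P + 2 * int c + 1 - int d" using pd_add[of c 1] c by (simp add: P_def)
  have cd: "c \<le> d" "b \<le> d" and ib: "int b = int c + 2" using b c by auto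
  have h': "c \<le> h" "h \<le> c + 2" "h \<le> d" using hc c by auto
  have t: "tr 0 = pd 0 + int c + 1 + q * (int h + 1)"
    using tr_path[of 0] unfolding g0 q_def by simp
  have t2: "tr d = pd d + (int d - int c - 1) + q * (int d - int h + 1)"
    using tr_path[of d] h' c unfolding g0 q_def by (simp add: of_nat_diff)
  have t3: "tr c = P + 1 + q * (int h - int c + 1)"
    using tr_path[OF cd(1)] h' unfolding g0 q_def P_def by simp
  have t4: "tr b = P + 4 * int c + 4 - 2 * int d + 1 + q * (int c + 2 - int h + 1)"
    using tr_path[OF cd(2)] h' unfolding g0 P2 q_def ib by simp
  note t = t t2 t3 t4
  have gd': "gd = P + (int d + 1) - 2 * (int d - 1 - int c)" using gd unfolding P_def ib by simp
  note dd = degree_distance_ear[OF G] sum_tr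
  have nq: "int n = q + int d + 2" by (simp add: q_def)
  have rdd: "reverse_degree_distance G = 2 * (int n - 1) * int n * int d - int (degree_distance G)"
    if "ear_gap c b h < d" using reverse_ear(1)[OF G _ _ that] c hc by auto
  from hc show ?thesis
  proof
    assume h: "h = c"
    have "3 * int (degree_distance G) = 2 * (int d * (int d + 1) * (int d + 2) + 3 * gd
      + 3 * q * (P + int d + 1)) + 3 * (- tr 0 - tr d + 2 * tr (Suc d) + tr c + tr b
       + q * (tr c + (P + int d + 2 + 1 + 2 * (q - 1))))"
      using dd by (simp add: h g0 P_def nq)
    then have "3 * int (degree_distance G) = 2 * (int d * (int d + 1) * (int d + 2) + 3 * gd
      + 3 * q * (P + int d + 1))
      - 3 * (int d * (int d + 1) + int d + q * (int d + 2))
      + 3 * (2 * (gd + q * 2) + P + 1 + q + P + 4 * int c + 5 - 2 * int d + q * 3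
       + q * (P + 1 + q + (P + int d + 2 + 1 + 2 * (q - 1))))"
      unfolding t tr_ear using pd_ends by (simp add: h g0 nq algebra_simps)
    then show ?thesis using rdd c unfolding rdd_base_def P[symmetric] gd'
      by (simp add: h g0 nq algebra_simps)
  next
    \<comment> \<open>Compared with \<open>h = c\<close>, the transmission of \<open>h\<close>
      within the path drops by 1, but \<open>h\<close> is now at distance 2 from the ear
      vertex.\<close>
    assume h: "h = Suc c \<and> n = d + 3 \<and> d = 2 * c + 2"
    then have q: "q = 1" and ih: "int h = int c + 1" and d: "int d = 2 * int c + 2" by (auto simp: q_def)
    have gh: "ear_gap c b h = 2" using h g0 by simp
    have hS: "h = Suc c" using h by simp
    have pdh: "pd h = P - 1" unfolding hS P1 using d by simp
    have trh: "tr h = P + 2" using tr_path[OF h'(3)] unfolding gh pdh by (simp add: nq q)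
    have trx: "tr (Suc d) = gd + 3" unfolding tr_ear gh by (simp add: nq q)
    have "3 * int (degree_distance G) = 2 * (int d * (int d + 1) * (int d + 2) + 3 * gd
      + 3 * (P + int d)) + 3 * (- tr 0 - tr d + 2 * tr (Suc d) + tr c + tr b
       + (tr h + (P - 1 + int d + 2 + 2)))"
      using dd unfolding gh pdh by (simp add: nq q)
    moreover have "reverse_degree_distance G = 2 * (int n - 1) * int n * int d - int (degree_distance G)"
      by (rule rdd) (use gh c in simp)
    ultimately have "3 * reverse_degree_distance G = 3 * (2 * (int d + 2) * (int d + 3) * int d) -
     (2 * (int d * (int d + 1) * (int d + 2) + 3 * gd + 3 * (P + int d)) + 3 * (2 * (gd + 3) + tr c + tr b
       + (P + 2 + (P - 1 + int d + 2 + 2))) - 3 * (tr 0 + tr d))"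
      unfolding trh trx nq q by (simp add: algebra_simps)
    moreover have "2 * (tr 0 + tr d) = 2 * (int d * (int d + 1)) + 2 * (int d + int d + 2)"
      using pd_ends unfolding t q ih by simp
    moreover have "tr c = P + 1 + 2" "tr b = P + 4 * int c + 4 - 2 * int d + 1 + 2" unfolding t q ih by simp_all
    moreover have "pathsum (2 * int c + 2) (int c) = 2 * P" using P d by simp
    ultimately show ?thesis unfolding rdd_base_def gd' nq q d by (simp add: algebra_simps)
  qed
qed

section \<open>The shape whose triangle has two vertices off the path\<close>

locale tri =
  fixes d c n :: nat
  assumes c: "1 \<le> c" "c < d" and dn: "d + 3 \<le> n"
begin

lemma tri_dist_simps:
  "i \<le> d \<Longrightarrow> j \<le> d \<Longrightarrow> triangle_dist d c i j = (i - j) + (j - i)"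
  "i \<le> d \<Longrightarrow> Suc d \<le> k \<Longrightarrow> triangle_dist d c i k = (i - c) + (c - i) + 1"
  "j \<le> d \<Longrightarrow> Suc d \<le> k \<Longrightarrow> triangle_dist d c k j = (j - c) + (c - j) + 1"
  "Suc d \<le> k \<Longrightarrow> Suc d \<le> l \<Longrightarrow> triangle_dist d c k l =
     (if k = l then 0 else if k \<le> d + 2 \<and> l \<le> d + 2 then 1 else 2)"
  unfolding triangle_dist_def by simp_all

lemma tri_dist_fun: "dist_fun n (triangle_rel d c n) (triangle_dist d c)"
proof
  show "0 < n" using dn by simp
  have "i < n \<and> j < n" if "(i, j) \<in> triangle_rel d c n" for i j
    using that c dn unfolding mem_triangle_rel by linarith
  then show "triangle_rel d c n \<subseteq> {..<n} \<times> {..<n}" by auto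
  show "(i, j) \<in> triangle_rel d c n \<Longrightarrow> (j, i) \<in> triangle_rel d c n" for i j
    unfolding mem_triangle_rel by blast
  show "(i, i) \<notin> triangle_rel d c n" for i
    using c unfolding mem_triangle_rel by linarith
  show "triangle_dist d c i i = 0" for i by (simp add: triangle_dist_def)
  show "triangle_dist d c i k \<le> triangle_dist d c i j + 1" if jk: "(j, k) \<in> triangle_rel d c n" for i j k
  proof -
    consider "j < d" "k = Suc j" | "k < d" "j = Suc k" | "j = Suc d" "k = d + 2" | "k = Suc d" "j = d + 2"
      | "j = c" "Suc d \<le> k" | "k = c" "Suc d \<le> j"
      using jk unfolding mem_triangle_rel by (metis Suc_eq_plus1)
    note edge = this
    have step: "(Suc x - y) + (y - Suc x) \<le> (x - y) + (y - x) + 1" "(x - y) + (y - x) \<le> (Suc x - y) + (y - Suc x) + 1"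
      for x y :: nat by linarith+
    consider "i \<le> d" | "Suc d \<le> i" by linarith
    then show ?thesis
    proof cases
      case i: 1
      from edge show ?thesis
      proof cases
        case 1 then show ?thesis using i step[of j i] by (simp add: tri_dist_simps)
      next
        case 2 then show ?thesis using i step[of k i] by (simp add: tri_dist_simps)
      qed (use i c in \<open>simp_all add: tri_dist_simps\<close>)
    next
      case i: 2
      from edge show ?thesis
      proof cases
        case 1 then show ?thesis using i step[of j c] by (simp add: tri_dist_simps)
      next
        case 2 then show ?thesis using i step[of k c] by (simp add: tri_dist_simps)
      qed (use i c in \<open>simp_all add: tri_dist_simps\<close>)
    qed
  qed
  show "\<exists>k. (k, j) \<in> triangle_rel d c n \<and> triangle_dist d c i j = Suc (triangle_dist d c i k)"
    if ij: "i < n" "j < n" "j \<noteq> i" for i j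
  proof -
    consider "j \<le> d" "i \<le> d" "j < i" | "j \<le> d" "i \<le> d" "i < j" | "j \<le> d" "Suc d \<le> i"
      | "Suc d \<le> j" "i \<le> d" | "Suc d \<le> j" "Suc d \<le> i" using ij by linarith
    then show ?thesis
    proof cases
      case 1 then show ?thesis by (intro exI[of _ "Suc j"]) (auto simp: mem_triangle_rel tri_dist_simps)
    next
      case 2 then show ?thesis by (intro exI[of _ "j - 1"]) (auto simp: mem_triangle_rel tri_dist_simps)
    next
      case 3
      consider "j = c" | "j < c" | "c < j" by linarith
      then show ?thesis
      proof cases
        case 1 then show ?thesis using c ij 3 by (intro exI[of _ i]) (simp add: mem_triangle_rel tri_dist_simps)
      next
        case 2 then show ?thesis using c 3 by (intro exI[of _ "Suc j"]) (simp add: mem_triangle_rel tri_dist_simps)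
      next
        case j: 3
        then obtain l where "j = Suc l" by (cases j) auto
        then show ?thesis using j 3 by (intro exI[of _ l]) (simp add: mem_triangle_rel tri_dist_simps Suc_diff_le)
      qed
    next
      case 4 then show ?thesis using c ij by (intro exI[of _ c]) (simp add: mem_triangle_rel tri_dist_simps)
    next
      case 5
      show ?thesis
      proof (cases "j \<le> d + 2 \<and> i \<le> d + 2")
        case True
        then have "i = Suc d \<and> j = d + 2 \<or> j = Suc d \<and> i = d + 2" using 5 ij(3) by linarith
        then have "(i, j) \<in> triangle_rel d c n" unfolding mem_triangle_rel by blast
        moreover have "triangle_dist d c i j = 1" "triangle_dist d c i i = 0"
          using True 5 ij(3) by (simp_all add: tri_dist_simps)
        ultimately show ?thesis by (intro exI[of _ i]) simp
      next
        case False
        then have "triangle_dist d c i j = 2" using 5 ij(3) by (auto simp: tri_dist_simps)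
        moreover have "triangle_dist d c i c = 1" using 5 c by (simp add: tri_dist_simps)
        moreover have "(c, j) \<in> triangle_rel d c n" unfolding mem_triangle_rel using 5 ij by simp
        ultimately show ?thesis by (intro exI[of _ c]) simp
      qed
    qed
  qed
qed

lemma tri_disjoint: "triangle_edges d c n \<inter> (triangle_edges d c n)\<inverse> = {}"
  using c unfolding triangle_edges_def by auto

lemma sum_tri_edges:
  fixes f :: "nat \<times> nat \<Rightarrow> 'b::comm_monoid_add"
  shows "(\<Sum>e\<in>triangle_edges d c n. f e) =
    (\<Sum>i<d. f (i, Suc i)) + f (Suc d, d + 2) + (\<Sum>j\<in>{d + 1..<n}. f (c, j))"
proof -
  have "(\<Sum>e\<in>triangle_edges d c n. f e) = (\<Sum>e\<in>(\<lambda>i. (i, Suc i)) ` {..<d} \<union> {(Suc d, d + 2)}. f e)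
      + (\<Sum>e\<in>(\<lambda>j. (c, j)) ` {d + 1..<n}. f e)"
    unfolding triangle_edges_def using c by (intro sum.union_disjoint) auto
  also have "(\<Sum>e\<in>(\<lambda>i. (i, Suc i)) ` {..<d} \<union> {(Suc d, d + 2)}. f e)
      = (\<Sum>e\<in>(\<lambda>i. (i, Suc i)) ` {..<d}. f e) + (\<Sum>e\<in>{(Suc d, d + 2)}. f e)"
    by (intro sum.union_disjoint) auto
  finally show ?thesis by (simp add: sum.reindex inj_on_def)
qed

lemma sum_vertices_tri:
  fixes f :: "nat \<Rightarrow> 'b::comm_monoid_add"
  shows "(\<Sum>k<n. f k) = (\<Sum>k\<le>d. f k) + (\<Sum>k\<in>{d + 1..<n}. f k)"
proof -
  have iff: "k < n \<longleftrightarrow> k \<le> d \<or> d + 1 \<le> k \<and> k < n" for k using dn by linarith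
  have "{..<n} = {..d} \<union> {d + 1..<n}"
    by (intro set_eqI) (simp only: lessThan_iff Un_iff atMost_iff atLeastLessThan_iff, rule iff)
  then have "(\<Sum>k<n. f k) = (\<Sum>k\<in>{..d} \<union> {d + 1..<n}. f k)" by (rule arg_cong)
  also have "\<dots> = (\<Sum>k\<le>d. f k) + (\<Sum>k\<in>{d + 1..<n}. f k)"
    by (rule sum.union_disjoint) auto
  finally show ?thesis .
qed

definition tr :: "nat \<Rightarrow> int" where "tr i = (\<Sum>k<n. int (triangle_dist d c i k))"

definition pd :: "nat \<Rightarrow> int" where "pd i = (\<Sum>j\<le>d. \<bar>int i - int j\<bar>)"

lemma r: "(\<Sum>k\<in>{d + 1..<n}. x) = (int n - int d - 1) * x" for x :: int
  using dn by (simp add: of_nat_diff)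

lemma tr_path:
  assumes i: "i \<le> d"
  shows "tr i = pd i + (int n - int d - 1) * (\<bar>int i - int c\<bar> + 1)"
proof -
  have p: "(\<Sum>k\<le>d. int (triangle_dist d c i k)) = pd i"
    unfolding pd_def using i by (intro sum.cong) (auto simp: tri_dist_simps)
  have s: "(\<Sum>k\<in>{d + 1..<n}. int (triangle_dist d c i k)) = (\<Sum>k\<in>{d + 1..<n}. \<bar>int i - int c\<bar> + 1)"
    using i by (intro sum.cong) (auto simp: tri_dist_simps)
  show ?thesis unfolding tr_def sum_vertices_tri p s r ..
qed

lemma tr_off:
  assumes s: "d + 1 \<le> s" "s < n"
  shows "tr s = pd c + int d + 1 + 2 * (int n - int d - 2) - (if s \<le> d + 2 then 1 else 0)"
proof -
  have p: "(\<Sum>k\<le>d. int (triangle_dist d c s k)) = (\<Sum>k\<le>d. \<bar>int c - int k\<bar> + 1)"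
    using s by (intro sum.cong) (auto simp: tri_dist_simps)
  have p': "(\<Sum>k\<le>d. \<bar>int c - int k\<bar> + 1) = pd c + int d + 1" by (simp add: sum.distrib pd_def)
  \<comment> \<open>All off-path distances are 2, corrected to 0 at \<open>s\<close> itself and to 1
    at its partner in the triangle.\<close>
  have "(\<Sum>k\<in>{d + 1..<n}. int (triangle_dist d c s k)) =
      (\<Sum>k\<in>{d + 1..<n}. 2 - (if k = s then 2 else 0) - (if k = (if s = Suc d then d + 2 else Suc d) \<and> s \<le> d + 2 then 1 else 0))"
    using s by (intro sum.cong) (auto simp: tri_dist_simps)
  also have "\<dots> = (\<Sum>k\<in>{d + 1..<n}. 2) - 2 - (if s \<le> d + 2 then 1 else 0)"
    using s dn by (auto simp: sum_subtractf sum.delta)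
  finally show ?thesis unfolding tr_def sum_vertices_tri p p' r by simp
qed

lemma pd: "i \<le> d \<Longrightarrow> 2 * pd i = int i * (int i + 1) + (int d - int i) * (int d - int i + 1)"
  unfolding pd_def by (rule sum_dist)

text \<open>Diameter and edge count are premises because the shape is only met in given graphs, for
  which both are already known.\<close>

lemma reverse_tri:
  assumes G: "copy G n (triangle_rel d c n)" and dG: "diameter G = d" and card: "card (uedges G) = n"
  shows "3 * reverse_degree_distance G = 6 * int n * (int n - 1) * int d - 2 * int d * (int d + 1) * (int d + 2)
     - 12 * (int n - int d - 1) * (int d + 1) - 12 * (int n - int d - 1) * (int n - int d - 2)
     - 6 * (int n - int d - 1) - 6 * (2 * (int n - int d - 1) + 1) * pd c + 3 * int n * int n - 9 * int n + 24"
proof -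
  interpret D: dist_fun n "triangle_rel d c n" "triangle_dist d c" by (rule tri_dist_fun)
  obtain \<phi> where \<phi>: "copy_via \<phi> G n (triangle_rel d c n)" using G unfolding copy_def by auto
  define R where "R = int n - int d - 1"
  have "int (degree_distance G) = (\<Sum>(i, j)\<in>triangle_edges d c n. tr i + tr j)"
    unfolding tr_def using D.degree_distance_copy[OF \<phi> triangle_rel_def tri_disjoint] by simp
  also have "\<dots> = (\<Sum>i<d. tr i + tr (Suc i)) + (tr (Suc d) + tr (d + 2)) + (\<Sum>j\<in>{d + 1..<n}. tr c + tr j)"
    by (simp add: sum_tri_edges)
  \<comment> \<open>The vertices \<open>d + 1\<close> and \<open>d + 2\<close> are adjacent, so each
    has a transmission smaller by 1 than the other off-path vertices.\<close>
  also have "(\<Sum>j\<in>{d + 1..<n}. tr c + tr j)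
      = (\<Sum>j\<in>{d + 1..<n}. (tr c + pd c + int d + 1 + 2 * (R - 1)) - (if j = Suc d then 1 else 0) - (if j = d + 2 then 1 else 0))"
    by (intro sum.cong) (auto simp: tr_off R_def)
  also have "\<dots> = (\<Sum>j\<in>{d + 1..<n}. tr c + pd c + int d + 1 + 2 * (R - 1)) - 2"
    using dn by (simp add: sum_subtractf sum.delta)
  also have "(\<Sum>j\<in>{d + 1..<n}. tr c + pd c + int d + 1 + 2 * (R - 1)) = R * (tr c + pd c + int d + 1 + 2 * (R - 1))"
    unfolding r R_def ..
  also have "(\<Sum>i<d. tr i + tr (Suc i)) = 2 * (\<Sum>i\<le>d. tr i) - tr 0 - tr d"
  proof -
    have "(\<Sum>i\<le>d. tr i) = (\<Sum>i<d. tr i) + tr d" by (simp add: lessThan_Suc_atMost[symmetric])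
    moreover have "(\<Sum>i\<le>d. tr i) = tr 0 + (\<Sum>i<d. tr (Suc i))" by (simp add: sum.atMost_shift)
    ultimately show ?thesis by (simp add: sum.distrib)
  qed
  finally have dd: "int (degree_distance G) = 2 * (\<Sum>i\<le>d. tr i) - tr 0 - tr d + (tr (Suc d) + tr (d + 2))
     + (R * (tr c + pd c + int d + 1 + 2 * (R - 1)) - 2)" .
  have "(\<Sum>i\<le>d. tr i) = (\<Sum>i\<le>d. pd i + R * (\<bar>int c - int i\<bar> + 1))"
    by (intro sum.cong refl) (auto simp: tr_path R_def abs_minus_commute)
  also have "\<dots> = (\<Sum>i\<le>d. pd i) + R * (\<Sum>i\<le>d. \<bar>int c - int i\<bar> + 1)"
    unfolding sum.distrib sum_distrib_left[symmetric] ..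
  also have "(\<Sum>i\<le>d. \<bar>int c - int i\<bar> + 1) = pd c + int d + 1" by (simp add: sum.distrib pd_def)
  finally have S: "3 * (\<Sum>i\<le>d. tr i) = int d * (int d + 1) * (int d + 2) + 3 * (R * (pd c + int d + 1))"
    using sum_dist_all[of d] unfolding pd_def[symmetric] by linarith
  have t: "tr 0 = pd 0 + R * (int c + 1)" "tr d = pd d + R * (int d - int c + 1)" "tr c = pd c + R"
    using tr_path[of 0] tr_path[of d] tr_path[of c] c by (auto simp: R_def)
  have x: "tr (Suc d) = pd c + int d + 2 * (R - 1)" "tr (d + 2) = pd c + int d + 2 * (R - 1)"
    using tr_off[of "Suc d"] tr_off[of "d + 2"] dn by (auto simp: R_def)
  have e: "2 * pd 0 = int d * (int d + 1)" "2 * pd d = int d * (int d + 1)" using pd[of 0] pd[of d] by simp_all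
  have "3 * int (degree_distance G) = 2 * (int d * (int d + 1) * (int d + 2)) + 6 * (R * (pd c + int d + 1))
     - 3 * (int d * (int d + 1)) - 3 * (R * (int d + 2))
     + 6 * (pd c + int d + 2 * (R - 1)) + 3 * (R * (pd c + R + pd c + int d + 1 + 2 * (R - 1))) - 6"
    unfolding dd t x using S e by (simp add: algebra_simps)
  moreover have "reverse_degree_distance G = 2 * (int n - 1) * int n * int d - int (degree_distance G)"
    unfolding reverse_degree_distance_def dG card D.card_V_copy[OF \<phi>] by simp
  ultimately have "3 * reverse_degree_distance G = 3 * (2 * (int n - 1) * int n * int d)
     - (2 * (int d * (int d + 1) * (int d + 2)) + 6 * (R * (pd c + int d + 1))
     - 3 * (int d * (int d + 1)) - 3 * (R * (int d + 2))
     + 6 * (pd c + int d + 2 * (R - 1)) + 3 * (R * (pd c + R + pd c + int d + 1 + 2 * (R - 1))) - 6)" by linarith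
  moreover have n: "int n = R + int d + 1" by (simp add: R_def)
  ultimately show ?thesis unfolding n by (simp add: algebra_simps)
qed

end

section \<open>Graphs of the largest possible diameter\<close>

context conn_graph
begin

text \<open>For \<open>v\<close> on the path this is a spanning caterpillar: the path with all
  remaining vertices hung on \<open>v\<close>. A unicyclic graph containing it has exactly one
  further edge.\<close>

definition spine_arcs :: "(nat \<Rightarrow> 'a) \<Rightarrow> nat \<Rightarrow> 'a \<Rightarrow> 'a rel" where
  "spine_arcs p d v = {(p i, p j) | i j. i \<le> d \<and> j \<le> d \<and> (i = Suc j \<or> j = Suc i)}
     \<union> {v} \<times> (pverts G - p ` {..d}) \<union> (pverts G - p ` {..d}) \<times> {v}"

text \<open>Lets the path be read backwards, so that an extra edge may be assumed to end at a
  position beyond \<open>c\<close>.\<close>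

lemma spine_arcs_rev: "spine_arcs (\<lambda>i. p (d - i)) d v = spine_arcs p d v"
proof -
  have "(\<lambda>i. p (d - i)) ` {..d} = p ` {..d}"
  proof
    show "(\<lambda>i. p (d - i)) ` {..d} \<subseteq> p ` {..d}" by auto
    show "p ` {..d} \<subseteq> (\<lambda>i. p (d - i)) ` {..d}"
    proof
      fix u assume "u \<in> p ` {..d}"
      then obtain i where "i \<le> d" "u = p i" by auto
      then show "u \<in> (\<lambda>i. p (d - i)) ` {..d}" by (intro image_eqI[of _ _ "d - i"]) auto
    qed
  qed
  moreover have sub: "{(q (d - i), q (d - j)) | i j. i \<le> d \<and> j \<le> d \<and> (i = Suc j \<or> j = Suc i)}
     \<subseteq> {(q i, q j) | i j. i \<le> d \<and> j \<le> d \<and> (i = Suc j \<or> j = Suc i)}" for q :: "nat \<Rightarrow> 'a"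
  proof
    fix e assume "e \<in> {(q (d - i), q (d - j)) | i j. i \<le> d \<and> j \<le> d \<and> (i = Suc j \<or> j = Suc i)}"
    then obtain i j where "e = (q (d - i), q (d - j))" "i \<le> d" "j \<le> d" "i = Suc j \<or> j = Suc i" by blast
    moreover from this have "d - i = Suc (d - j) \<or> d - j = Suc (d - i)" by linarith
    ultimately show "e \<in> {(q i, q j) | i j. i \<le> d \<and> j \<le> d \<and> (i = Suc j \<or> j = Suc i)}"
      using diff_le_self by blast
  qed
  moreover have "{(p i, p j) | i j. i \<le> d \<and> j \<le> d \<and> (i = Suc j \<or> j = Suc i)}
    \<subseteq> {(p (d - i), p (d - j)) | i j. i \<le> d \<and> j \<le> d \<and> (i = Suc j \<or> j = Suc i)}"
  proof
    fix e assume "e \<in> {(p i, p j) | i j. i \<le> d \<and> j \<le> d \<and> (i = Suc j \<or> j = Suc i)}"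
    then obtain i j where ij: "e = (p i, p j)" "i \<le> d" "j \<le> d" "i = Suc j \<or> j = Suc i" by blast
    have "d - i \<le> d \<and> d - j \<le> d \<and> (d - i = Suc (d - j) \<or> d - j = Suc (d - i))" using ij by linarith
    moreover have "e = (p (d - (d - i)), p (d - (d - j)))" using ij by simp
    ultimately show "e \<in> {(p (d - i), p (d - j)) | i j. i \<le> d \<and> j \<le> d \<and> (i = Suc j \<or> j = Suc i)}" by blast
  qed
  ultimately show ?thesis unfolding spine_arcs_def using sub[of p] by (simp add: subset_antisym)
qed

lemma card_neighbours: "card {u. (v, u) \<in> parcs G} = degree G v"
proof -
  have "{e \<in> parcs G. fst e = v} = Pair v ` {u. (v, u) \<in> parcs G}" by auto
  then show ?thesis unfolding degree_eq by (simp add: card_image inj_on_def)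
qed

section \<open>A vertex of large degree against a geodesic\<close>

context
  fixes p d v
  assumes p: "geodesic p d" and v: "v \<in> pverts G"
begin

definition near :: "nat set" where
  "near = {i. i \<le> d \<and> (p i = v \<or> (v, p i) \<in> parcs G)}"

text \<open>Both positions are within distance 1 of \<open>v\<close>, hence within distance 2 of
  each other. On a geodesic this bounds the difference of the indices.\<close>

lemma near_close:
  assumes "i \<in> near" "j \<in> near" shows "i \<le> j + 2"
proof -
  have close: "gdist G v (p k) \<le> 1" "p k \<in> pverts G" if "k \<in> near" for k
    using that v gdist_arc[of v "p k"] geodesic_V[OF p] unfolding near_def by auto
  have "gdist G (p i) (p j) \<le> gdist G (p i) v + gdist G v (p j)"
    by (rule gdist_triangle) (use close assms v in auto)
  also have "\<dots> \<le> 2" using close[OF assms(1)] close[OF assms(2)] gdist_sym[OF v close(2)[OF assms(1)]] by simp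
  finally have "int (gdist G (p i) (p j)) \<le> 2" by simp
  moreover have "i \<le> d" "j \<le> d" using assms by (auto simp: near_def)
  ultimately show ?thesis using geodesicD[OF p, of i j] by linarith
qed

lemma near_sub: "near \<noteq> {} \<Longrightarrow> near \<subseteq> {Min near..Min near + 2}"
proof
  fix i assume i: "i \<in> near"
  have fin: "finite near" by (rule finite_subset[of _ "{..d}"]) (auto simp: near_def)
  have "Min near \<in> near" using fin i by (intro Min_in) auto
  then show "i \<in> {Min near..Min near + 2}" using near_close[OF i] Min_le[OF fin i] by simp
qed

lemma card_near_le: "card near \<le> 3"
proof (cases "near = {}")
  case False then show ?thesis using card_mono[OF _ near_sub] by simp
qed simp

text \<open>Inclusion and exclusion for the closed neighbourhood of \<open>v\<close>, with
  \<open>degree G v + 1\<close> vertices, and the path, with \<open>d + 1\<close>.\<close>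

lemma card_near_ge: "degree G v + d + 2 = card near + card (insert v {u. (v, u) \<in> parcs G} \<union> p ` {..d})"
proof -
  let ?W = "insert v {u. (v, u) \<in> parcs G}"
  have W: "?W \<subseteq> pverts G" using v in_arcsD2 by auto
  then have finW: "finite ?W" by (rule finite_subset) simp
  have "finite {u. (v, u) \<in> parcs G}" using finW by simp
  moreover have "v \<notin> {u. (v, u) \<in> parcs G}" using no_loops'[of v v] by auto
  ultimately have "card ?W = degree G v + 1" unfolding card_neighbours[symmetric] by simp
  moreover have "card (p ` {..d}) = d + 1" using card_image[OF geodesic_inj[OF p]] by simp
  moreover have "?W \<inter> p ` {..d} = p ` near" unfolding near_def by auto
  moreover have "card (p ` near) = card near"
    by (rule card_image, rule inj_on_subset[OF geodesic_inj[OF p]]) (auto simp: near_def)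
  ultimately show ?thesis using card_Un_Int[OF finW, of "p ` {..d}"] by simp
qed

lemma cover_sub: "insert v {u. (v, u) \<in> parcs G} \<union> p ` {..d} \<subseteq> pverts G"
  using v in_arcsD2 geodesic_V[OF p] by auto

lemma degree_diameter_le: "degree G v + d \<le> card (pverts G) + 1"
  using card_near_ge card_near_le card_mono[OF fin_V cover_sub] by linarith

text \<open>Equality forces three consecutive positions near \<open>v\<close> and leaves no vertex
  outside the closed neighbourhood and the path. The arc count then places \<open>v\<close> on the
  path and leaves room for a single edge besides the spine.\<close>

lemma extremal_structure:
  assumes card: "card (parcs G) = 2 * card (pverts G)" and eq: "degree G v + d = card (pverts G) + 1"
  obtains c x y where "1 \<le> c" "c < d" "v = p c" "parcs G = spine_arcs p d v \<union> {(x, y), (y, x)}"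
    "x \<in> pverts G - p ` {..d}" "x \<noteq> y"
    "y \<in> pverts G - p ` {..d} \<or> (\<exists>j\<le>d. y = p j \<and> j \<noteq> c \<and> j \<le> c + 2 \<and> c \<le> j + 2)"
proof -
  let ?N = "{u. (v, u) \<in> parcs G}"
  define S where "S = pverts G - p ` {..d}"
  have near3: "card near = 3" and cover: "card (insert v ?N \<union> p ` {..d}) = card (pverts G)"
    using card_near_ge card_near_le card_mono[OF fin_V cover_sub] eq by linarith+
  have coverV: "insert v ?N \<union> p ` {..d} = pverts G" by (rule card_subset_eq[OF fin_V cover_sub cover])
  define m where "m = Min near"
  have ne: "near \<noteq> {}"
  proof
    assume "near = {}"
    then have "card near = 0" by (simp only: card.empty)
    then show False using near3 by linarith
  qed
  have sub3: "near \<subseteq> {m..m + 2}" using near_sub[OF ne] unfolding m_def by assumption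
  have near: "near = {m..m + 2}"
    by (rule card_subset_eq[OF finite_atLeastAtMost sub3]) (simp only: near3, simp)
  have m2: "m + 2 \<in> near" unfolding near by simp
  then have md: "m + 2 \<le> d" unfolding near_def by blast
  have injp: "p i = p j \<longleftrightarrow> i = j" if "i \<le> d" "j \<le> d" for i j
    using geodesic_inj[OF p] that by (auto dest: inj_onD)
  define A where "A = (\<lambda>i. (p i, p (Suc i))) ` {..<d}"
  have AG: "A \<subseteq> parcs G" using geodesic_arc_iff[OF p] unfolding A_def by auto
  have cA: "card A = d" unfolding A_def by (subst card_image) (auto simp: inj_on_def injp)
  have Adisj: "A \<inter> A\<inverse> = {}" unfolding A_def by (auto simp: injp)
  have finA: "finite A" by (simp add: A_def)
  have finN: "finite ?N" using in_arcsD2 by (intro finite_subset[OF _ fin_V]) auto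
  \<comment> \<open>Off the path, the star of \<open>v\<close> would share no arc with the path, and
    together they would have \<open>2 * (d + degree G v) = 2 * n + 2\<close> arcs, two too
    many.\<close>
  have "v \<in> p ` {..d}"
  proof (rule ccontr)
    assume nv: "v \<notin> p ` {..d}"
    define B where "B = Pair v ` ?N"
    have cB: "card B = degree G v" unfolding B_def by (subst card_image) (auto simp: inj_on_def card_neighbours)
    have finB: "finite B" using finN by (simp add: B_def)
    have BG: "B \<subseteq> parcs G" by (auto simp: B_def)
    have Bdisj: "B \<inter> B\<inverse> = {}" unfolding B_def using no_loops'[of v v] by auto
    have nvA: "fst e \<noteq> v \<and> snd e \<noteq> v" if "e \<in> A \<union> A\<inverse>" for e using that nv unfolding A_def by auto
    have vB: "fst e = v \<or> snd e = v" if "e \<in> B \<union> B\<inverse>" for e using that unfolding B_def by auto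
    have "(A \<union> A\<inverse>) \<inter> (B \<union> B\<inverse>) = {}" using nvA vB by blast
    then have "card ((A \<union> A\<inverse>) \<union> (B \<union> B\<inverse>)) = card (A \<union> A\<inverse>) + card (B \<union> B\<inverse>)"
      using finA finB by (intro card_Un_disjoint) auto
    also have "card (A \<union> A\<inverse>) = 2 * d" using cA finA Adisj by (subst card_Un_disjoint) auto
    also have "card (B \<union> B\<inverse>) = 2 * degree G v" using cB finB Bdisj by (subst card_Un_disjoint) auto
    finally have "2 * d + 2 * degree G v \<le> card (parcs G)"
      using AG BG sym_arc card_mono[OF fin_A, of "(A \<union> A\<inverse>) \<union> (B \<union> B\<inverse>)"] by auto
    then show False using eq card by linarith
  qed
  then obtain c where c: "c \<le> d" "v = p c" by auto
  have "c \<in> near" unfolding near_def using c by blast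
  have nb: "i = c \<or> i = Suc c \<or> c = Suc i" if "i \<in> near" for i
    using that c geodesic_arc_iff[OF p, of c i] injp[of i c] unfolding near_def by auto
  have "m \<in> near" "c \<in> {m..m + 2}" using \<open>c \<in> near\<close> unfolding near by simp_all
  \<comment> \<open>Both \<open>m\<close> and \<open>m + 2\<close> are positions at most one away
    from \<open>c\<close>, so \<open>c\<close> lies between them; this also makes it an inner
    position.\<close>
  then have c1: "c = m + 1" using nb[OF \<open>m \<in> near\<close>] nb[OF m2] by simp linarith
  have SN: "(v, s) \<in> parcs G" if "s \<in> S" for s
  proof -
    have "s \<in> insert v ?N \<union> p ` {..d}" "s \<notin> p ` {..d}" using that coverV by (auto simp: S_def)
    moreover have "s \<noteq> v" using that c by (auto simp: S_def)
    ultimately show ?thesis by auto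
  qed
  have finS: "finite S" by (simp add: S_def)
  have "p ` {..d} \<subseteq> pverts G" using geodesic_V[OF p] by auto
  then have cS: "card S + d + 1 = card (pverts G)"
    using card_image[OF geodesic_inj[OF p]] card_mono[OF fin_V, of "p ` {..d}"] unfolding S_def
    by (subst card_Diff_subset) auto
  have notS: "p i \<notin> S" if "i \<le> d" for i using that by (auto simp: S_def)
  define B where "B = Pair v ` S"
  have cB: "card B = card S" unfolding B_def by (simp add: card_image inj_on_def)
  have spine: "spine_arcs p d v = (A \<union> B) \<union> (A \<union> B)\<inverse>"
  proof -
    have "{(p i, p j) | i j. i \<le> d \<and> j \<le> d \<and> (i = Suc j \<or> j = Suc i)} = A \<union> A\<inverse>"
    proof (intro equalityI subsetI)
      fix e assume "e \<in> {(p i, p j) | i j. i \<le> d \<and> j \<le> d \<and> (i = Suc j \<or> j = Suc i)}"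
      then obtain i j where "e = (p i, p j)" "i \<le> d" "j \<le> d" "i = Suc j \<or> j = Suc i" by blast
      then show "e \<in> A \<union> A\<inverse>" unfolding A_def by auto
    next
      fix e assume "e \<in> A \<union> A\<inverse>"
      then obtain i where "i < d" "e = (p i, p (Suc i)) \<or> e = (p (Suc i), p i)" unfolding A_def by auto
      then have "Suc i \<le> d" "i \<le> d" "e = (p i, p (Suc i)) \<or> e = (p (Suc i), p i)" by auto
      then show "e \<in> {(p i, p j) | i j. i \<le> d \<and> j \<le> d \<and> (i = Suc j \<or> j = Suc i)}" by blast
    qed
    moreover have "{v} \<times> S = B" "S \<times> {v} = B\<inverse>" unfolding B_def by auto
    ultimately show ?thesis unfolding spine_arcs_def S_def[symmetric] by auto
  qed
  have sub: "spine_arcs p d v \<subseteq> parcs G" unfolding spine using AG SN sym_arc by (auto simp: B_def)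
  have vB: "snd e \<in> S \<and> fst e \<notin> S" if "e \<in> B" for e using that c notS unfolding B_def by auto
  have vA: "snd e \<notin> S \<and> fst e \<notin> S" if "e \<in> A" for e using that notS unfolding A_def by auto
  have dAB: "A \<inter> B = {}" using vA vB by blast
  have "(A \<union> B) \<inter> (A \<union> B)\<inverse> = {}"
  proof -
    have False if "(s, t) \<in> A \<union> B" "(t, s) \<in> A \<union> B" for s t
      using that Adisj vA[of "(s, t)"] vA[of "(t, s)"] vB[of "(s, t)"] vB[of "(t, s)"] by auto
    then show ?thesis by auto
  qed
  then have "card (spine_arcs p d v) = 2 * card (A \<union> B)"
    unfolding spine using finA finS by (subst card_Un_disjoint) (auto simp: B_def)
  also have "card (A \<union> B) = d + card S" using finA finS dAB cA cB by (subst card_Un_disjoint) (auto simp: B_def)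
  finally have cspine': "card (spine_arcs p d v) = 2 * (d + card S)" .
  \<comment> \<open>The spine has \<open>2 * (n - 1)\<close> arcs, so exactly two are missing; by
    symmetry they form one edge.\<close>
  have cspine: "card (spine_arcs p d v) + 2 = card (parcs G)" unfolding card cspine' cS[symmetric] by simp
  define M where "M = parcs G - spine_arcs p d v"
  have cM: "card M = 2" using cspine card_Diff_subset[OF finite_subset[OF sub fin_A] sub] by (simp add: M_def)
  have spine_sym: "(s, t) \<in> spine_arcs p d v \<Longrightarrow> (t, s) \<in> spine_arcs p d v" for s t unfolding spine by blast
  have Msym: "(t, s) \<in> M" if "(s, t) \<in> M" for s t using that sym_arc spine_sym unfolding M_def by blast
  have "M \<noteq> {}" using cM by auto
  have both: "parcs G = spine_arcs p d v \<union> {(x, y), (y, x)}" if "(x, y) \<in> M" for x y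
  proof -
    have "x \<noteq> y" using that no_loops' by (auto simp: M_def)
    then have "card {(x, y), (y, x)} = card M" using cM by simp
    moreover have "{(x, y), (y, x)} \<subseteq> M" using that Msym by blast
    moreover have "finite M" using cM by (metis card.infinite zero_neq_numeral)
    ultimately have "{(x, y), (y, x)} = M" by (intro card_subset_eq)
    then show ?thesis using sub unfolding M_def by blast
  qed
  have main: "1 \<le> c \<and> c < d" using c1 md by simp
  note obt = that
  have S_or: "u \<in> S \<or> (\<exists>j\<le>d. u = p j)" if "u \<in> pverts G" for u using that by (auto simp: S_def)
  have fin: thesis if xy: "(x, y) \<in> M" and x: "x \<in> S" for x y
  proof (rule obt[of c x y])
    have xyG: "(x, y) \<in> parcs G" "(x, y) \<notin> spine_arcs p d v" using xy by (auto simp: M_def)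
    show "1 \<le> c" "c < d" using main by auto
    show "v = p c" by (rule c(2))
    show "parcs G = spine_arcs p d v \<union> {(x, y), (y, x)}" by (rule both[OF xy])
    show "x \<in> pverts G - p ` {..d}" using x by (simp only: S_def)
    show "x \<noteq> y" using xyG no_loops' by blast
    have yV: "y \<in> pverts G" and xV: "x \<in> pverts G" using xyG(1) in_arcsD1 in_arcsD2 by blast+
    from S_or[OF yV] show "y \<in> pverts G - p ` {..d} \<or> (\<exists>j\<le>d. y = p j \<and> j \<noteq> c \<and> j \<le> c + 2 \<and> c \<le> j + 2)"
    proof
      assume "y \<in> S" then show ?thesis by (simp only: S_def simp_thms)
    next
      assume "\<exists>j\<le>d. y = p j"
      then obtain j where j: "j \<le> d" "y = p j" by blast
      have "j \<noteq> c"
      proof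
        assume "j = c"
        then have "(x, y) \<in> spine_arcs p d v" using x j c(2) unfolding spine_arcs_def S_def by simp
        then show False using xyG(2) by contradiction
      qed
      \<comment> \<open>The detour through \<open>x\<close> has length 2, so a path vertex joined to
        \<open>x\<close> is at most two positions away from \<open>c\<close>.\<close>
      have "gdist G v y \<le> gdist G v x + gdist G x y" by (rule gdist_triangle[OF v xV yV])
      then have "gdist G (p c) (p j) \<le> 2" using gdist_arc[OF SN[OF x]] gdist_arc[OF xyG(1)] j c(2) by simp
      then have "j \<le> c + 2 \<and> c \<le> j + 2" using geodesicD[OF p c(1) j(1)] by linarith
      then show ?thesis using j \<open>j \<noteq> c\<close> by blast
    qed
  qed
  obtain x y where xy: "(x, y) \<in> M" using \<open>M \<noteq> {}\<close> by auto
  have xyG: "(x, y) \<in> parcs G" "(x, y) \<notin> spine_arcs p d v" using xy by (auto simp: M_def)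
  have yV: "y \<in> pverts G" and xV: "x \<in> pverts G" using xyG(1) in_arcsD1 in_arcsD2 by blast+
  \<comment> \<open>The missing edge cannot have both ends on the path: a geodesic has no chord, and
    its own arcs belong to the spine.\<close>
  consider "x \<in> S" | "y \<in> S" | i j where "i \<le> d" "j \<le> d" "x = p i" "y = p j"
    using S_or[OF yV] S_or[OF xV] by metis
  then show thesis
  proof cases
    case 1 then show ?thesis by (rule fin[OF xy])
  next
    case 2 then show ?thesis by (rule fin[OF Msym[OF xy]])
  next
    case 3
    then have "i = Suc j \<or> j = Suc i" using geodesic_arc_iff[OF p 3(1,2)] xyG(1) by simp
    then have "(x, y) \<in> spine_arcs p d v" unfolding spine_arcs_def using 3 by blast
    then show ?thesis using xyG(2) by contradiction
  qed
qed

end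

end

section \<open>Numbering the vertices of an extremal graph\<close>

definition append_enum :: "(nat \<Rightarrow> 'a) \<Rightarrow> nat \<Rightarrow> 'a list \<Rightarrow> nat \<Rightarrow> 'a" where
  "append_enum p d L i = (if i \<le> d then p i else L ! (i - Suc d))"

lemma bij_append_enum:
  assumes p: "inj_on p {..d}" and L: "distinct L" "set L \<inter> p ` {..d} = {}" and n: "n = Suc d + length L"
  shows "bij_betw (append_enum p d L) {..<n} (p ` {..d} \<union> set L)"
    and "append_enum p d L ` {Suc d..<n} = set L"
proof -
  have 1: "bij_betw (append_enum p d L) {..d} (p ` {..d})"
    using p by (auto simp: bij_betw_def append_enum_def inj_on_def)
  have inj: "inj_on (append_enum p d L) {Suc d..<n}"
  proof (rule inj_onI)
    fix i j assume ij: "i \<in> {Suc d..<n}" "j \<in> {Suc d..<n}" "append_enum p d L i = append_enum p d L j"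
    then have "L ! (i - Suc d) = L ! (j - Suc d)" by (simp add: append_enum_def)
    moreover have "i - Suc d < length L" "j - Suc d < length L" using ij n by auto
    ultimately have "i - Suc d = j - Suc d" using L(1) nth_eq_iff_index_eq by blast
    then show "i = j" using ij by auto
  qed
  show im: "append_enum p d L ` {Suc d..<n} = set L"
  proof (intro equalityI subsetI)
    fix s assume "s \<in> append_enum p d L ` {Suc d..<n}"
    then obtain i where "Suc d \<le> i" "i < n" "s = L ! (i - Suc d)" by (auto simp: append_enum_def)
    moreover from this have "i - Suc d < length L" using n by linarith
    ultimately show "s \<in> set L" by simp
  next
    fix s assume "s \<in> set L"
    then obtain k where "k < length L" "s = L ! k" by (auto simp: in_set_conv_nth)
    then show "s \<in> append_enum p d L ` {Suc d..<n}"
      using n by (intro image_eqI[of _ _ "Suc d + k"]) (auto simp: append_enum_def)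
  qed
  have 2: "bij_betw (append_enum p d L) {Suc d..<n} (set L)" using inj im by (simp add: bij_betw_def)
  have iff: "k < n \<longleftrightarrow> k \<le> d \<or> Suc d \<le> k \<and> k < n" for k using n by linarith
  have "{..<n} = {..d} \<union> {Suc d..<n}"
    by (intro set_eqI) (simp only: lessThan_iff Un_iff atMost_iff atLeastLessThan_iff, rule iff)
  then show "bij_betw (append_enum p d L) {..<n} (p ` {..d} \<union> set L)"
    using bij_betw_combine[OF 1 2] L(2) by (simp add: Int_commute)
qed

context conn_graph
begin

context
  fixes p d v c x y n
  assumes p: "geodesic p d" and v: "v = p c" and c: "c \<le> d"
    and arcs: "parcs G = spine_arcs p d v \<union> {(x, y), (y, x)}"
    and x: "x \<in> pverts G - p ` {..d}" and n: "card (pverts G) = n"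
begin

lemma spine_cases:
  assumes "(s, t) \<in> parcs G"
  obtains i j where "s = p i" "t = p j" "i \<le> d" "j \<le> d" "i = Suc j \<or> j = Suc i"
  | "s = v" "t \<in> pverts G - p ` {..d}" | "t = v" "s \<in> pverts G - p ` {..d}"
  | "s = x" "t = y" | "s = y" "t = x"
  using assms unfolding arcs spine_arcs_def by blast

text \<open>Listing \<open>x\<close> first among the off-path vertices gives it the number
  \<open>d + 1\<close>, the one that both kinds of shape reserve for an end of the extra
  edge.\<close>

lemma spine_enum:
  assumes xs: "distinct (x # xs)" "set (x # xs) = pverts G - p ` {..d}"
  defines "\<phi> \<equiv> append_enum p d (x # xs)"
  shows "bij_betw \<phi> {..<n} (pverts G)" "\<phi> ` {Suc d..<n} = pverts G - p ` {..d}" "n = Suc d + length (x # xs)"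
    "\<And>i. i \<le> d \<Longrightarrow> \<phi> i = p i" "\<phi> (Suc d) = x"
proof -
  have P: "p ` {..d} \<subseteq> pverts G" using geodesic_V[OF p] by auto
  have "card (set (x # xs)) = card (pverts G) - card (p ` {..d})"
    unfolding xs(2) using P by (intro card_Diff_subset) auto
  moreover have "card (p ` {..d}) = Suc d" using card_image[OF geodesic_inj[OF p]] by simp
  moreover have "card (p ` {..d}) \<le> card (pverts G)" by (rule card_mono[OF fin_V P])
  moreover have "card (set (x # xs)) = length (x # xs)" by (rule distinct_card[OF xs(1)])
  ultimately show len: "n = Suc d + length (x # xs)" using n by linarith
  have "set (x # xs) \<inter> p ` {..d} = {}" unfolding xs(2) by blast
  note E = bij_append_enum[OF geodesic_inj[OF p] xs(1) this len]
  show "\<phi> ` {Suc d..<n} = pverts G - p ` {..d}" unfolding \<phi>_def E(2) xs(2) ..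
  have "p ` {..d} \<union> set (x # xs) = pverts G" unfolding xs(2) using P by blast
  then show "bij_betw \<phi> {..<n} (pverts G)" using E(1) unfolding \<phi>_def by (simp only:)
  show "\<phi> i = p i" if "i \<le> d" for i using that by (simp add: \<phi>_def append_enum_def)
  show "\<phi> (Suc d) = x" by (simp add: \<phi>_def append_enum_def)
qed

lemma arcs_intros:
  "i < d \<Longrightarrow> (p i, p (Suc i)) \<in> parcs G" "s \<in> pverts G - p ` {..d} \<Longrightarrow> (v, s) \<in> parcs G" "(x, y) \<in> parcs G"
proof -
  show "(p i, p (Suc i)) \<in> parcs G" if "i < d" using geodesic_arc_iff[OF p, of i "Suc i"] that by simp
  show "(v, s) \<in> parcs G" if "s \<in> pverts G - p ` {..d}" using that unfolding arcs spine_arcs_def by blast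
  show "(x, y) \<in> parcs G" unfolding arcs by blast
qed

lemma map_prod_mem: "(i, j) \<in> R \<Longrightarrow> s = \<phi> i \<Longrightarrow> t = \<phi> j \<Longrightarrow> (s, t) \<in> map_prod \<phi> \<phi> ` R"
  by (intro image_eqI[of _ _ "(i, j)"]) simp_all

lemma ear_copy:
  assumes y: "y = p b" "b \<le> d"
  shows "copy G n (ear_rel d c b c n)"
proof -
  let ?S = "pverts G - p ` {..d}"
  obtain xs where xs': "distinct xs" "set xs = ?S - {x}" using finite_distinct_list[of "?S - {x}"] by auto
  have xs: "distinct (x # xs)" "set (x # xs) = ?S" using xs' x by auto
  define \<phi> where "\<phi> = append_enum p d (x # xs)"
  note E = spine_enum[OF xs, folded \<phi>_def]
  have S: "\<phi> j \<in> ?S" if "Suc d \<le> j" "j < n" for j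
  proof -
    have "\<phi> j \<in> \<phi> ` {Suc d..<n}" using that by (intro imageI) simp
    then show ?thesis unfolding E(2) .
  qed
  have surj: "s = x \<or> (\<exists>j. d + 2 \<le> j \<and> j < n \<and> s = \<phi> j)" if s: "s \<in> ?S" for s
  proof -
    obtain j where j: "Suc d \<le> j" "j < n" "s = \<phi> j" using s unfolding E(2)[symmetric] by auto
    show ?thesis
    proof (cases "j = Suc d")
      case True then show ?thesis using j E(5) by simp
    next
      case False then have "d + 2 \<le> j" using j by simp
      then show ?thesis using j by blast
    qed
  qed
  have xm: "(Suc d, c) \<in> ear_rel d c b c n" "(Suc d, b) \<in> ear_rel d c b c n"
    "(c, Suc d) \<in> ear_rel d c b c n" "(b, Suc d) \<in> ear_rel d c b c n" by (simp_all add: mem_ear_rel)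
  have "parcs G = map_prod \<phi> \<phi> ` ear_rel d c b c n"
  proof (intro equalityI subrelI)
    fix s t assume "(s, t) \<in> parcs G"
    then show "(s, t) \<in> map_prod \<phi> \<phi> ` ear_rel d c b c n"
    proof (cases rule: spine_cases)
      case (1 i j)
      then have "(i, j) \<in> ear_rel d c b c n" unfolding mem_ear_rel by linarith
      then show ?thesis by (rule map_prod_mem) (use 1 E(4) in auto)
    next
      case 2
      from surj[OF 2(2)] show ?thesis
      proof
        assume "t = x" then show ?thesis using 2(1) v c E(4,5) by (intro map_prod_mem[OF xm(3)]) auto
      next
        assume "\<exists>j. d + 2 \<le> j \<and> j < n \<and> t = \<phi> j"
        then obtain j where j: "d + 2 \<le> j" "j < n" "t = \<phi> j" by blast
        then have "(c, j) \<in> ear_rel d c b c n" unfolding mem_ear_rel by blast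
        then show ?thesis by (rule map_prod_mem) (use j 2 v c E(4) in auto)
      qed
    next
      case 3
      from surj[OF 3(2)] show ?thesis
      proof
        assume "s = x" then show ?thesis using 3(1) v c E(4,5) by (intro map_prod_mem[OF xm(1)]) auto
      next
        assume "\<exists>j. d + 2 \<le> j \<and> j < n \<and> s = \<phi> j"
        then obtain j where j: "d + 2 \<le> j" "j < n" "s = \<phi> j" by blast
        then have "(j, c) \<in> ear_rel d c b c n" unfolding mem_ear_rel by blast
        then show ?thesis by (rule map_prod_mem) (use j 3 v c E(4) in auto)
      qed
    next
      case 4 then show ?thesis using y E(4,5) by (intro map_prod_mem[OF xm(2)]) auto
    next
      case 5 then show ?thesis using y E(4,5) by (intro map_prod_mem[OF xm(4)]) auto
    qed
  next
    fix s t assume "(s, t) \<in> map_prod \<phi> \<phi> ` ear_rel d c b c n"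
    then obtain i j where ij: "(i, j) \<in> ear_rel d c b c n" "s = \<phi> i" "t = \<phi> j" by auto
    have E': "(\<phi> i, \<phi> j) \<in> parcs G" if "(i, j) \<in> ear_edges d c b c n" for i j
    proof -
      consider "i < d" "j = Suc i" | "i = Suc d" "j = c" | "i = Suc d" "j = b" | "i = c" "Suc d \<le> j" "j < n"
        using \<open>(i, j) \<in> ear_edges d c b c n\<close> unfolding mem_ear_edges by fastforce
      then show ?thesis
      proof cases
        case 1 then show ?thesis using arcs_intros(1)[of i] E(4)[of i] E(4)[of j] by simp
      next
        case 2 then show ?thesis using sym_arc[OF arcs_intros(2)[OF x]] E(4)[OF c] E(5) v by simp
      next
        case 3 then show ?thesis using arcs_intros(3) E(4)[OF y(2)] E(5) y by simp
      next
        case 4 then show ?thesis using arcs_intros(2)[OF S[of j]] E(4)[OF c] v by simp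
      qed
    qed
    show "(s, t) \<in> parcs G"
      using ij E' sym_arc unfolding ear_rel_def by auto
  qed
  then show ?thesis unfolding copy_def copy_via_def using E(1) by blast
qed

lemma triangle_copy:
  assumes y: "y \<in> pverts G - p ` {..d}" "y \<noteq> x"
  shows "copy G n (triangle_rel d c n)" "d + 3 \<le> n"
proof -
  let ?S = "pverts G - p ` {..d}"
  obtain xs where xs': "distinct xs" "set xs = ?S - {x, y}" using finite_distinct_list[of "?S - {x, y}"] by auto
  have xs: "distinct (x # y # xs)" "set (x # y # xs) = ?S" using xs' x y by auto
  define \<phi> where "\<phi> = append_enum p d (x # y # xs)"
  note E = spine_enum[OF xs, folded \<phi>_def]
  show dn: "d + 3 \<le> n" using E(3) by simp
  have Ey: "\<phi> (d + 2) = y" by (simp add: \<phi>_def append_enum_def)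
  have S: "\<phi> j \<in> ?S" if "Suc d \<le> j" "j < n" for j
  proof -
    have "\<phi> j \<in> \<phi> ` {Suc d..<n}" using that by (intro imageI) simp
    then show ?thesis unfolding E(2) .
  qed
  have surj: "\<exists>j. d + 1 \<le> j \<and> j < n \<and> s = \<phi> j" if s: "s \<in> ?S" for s
  proof -
    obtain j where j: "Suc d \<le> j" "j < n" "s = \<phi> j" using s unfolding E(2)[symmetric] by auto
    then have "d + 1 \<le> j" by simp
    then show ?thesis using j by blast
  qed
  have xm: "(Suc d, d + 2) \<in> triangle_rel d c n" "(d + 2, Suc d) \<in> triangle_rel d c n" by (simp_all add: mem_triangle_rel)
  have "parcs G = map_prod \<phi> \<phi> ` triangle_rel d c n"
  proof (intro equalityI subrelI)
    fix s t assume "(s, t) \<in> parcs G"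
    then show "(s, t) \<in> map_prod \<phi> \<phi> ` triangle_rel d c n"
    proof (cases rule: spine_cases)
      case (1 i j)
      then have "(i, j) \<in> triangle_rel d c n" unfolding mem_triangle_rel by linarith
      then show ?thesis by (rule map_prod_mem) (use 1 E(4) in auto)
    next
      case 2
      obtain j where j: "d + 1 \<le> j" "j < n" "t = \<phi> j" using surj[OF 2(2)] by blast
      then have "(c, j) \<in> triangle_rel d c n" unfolding mem_triangle_rel by blast
      then show ?thesis by (rule map_prod_mem) (use j 2 v c E(4) in auto)
    next
      case 3
      obtain j where j: "d + 1 \<le> j" "j < n" "s = \<phi> j" using surj[OF 3(2)] by blast
      then have "(j, c) \<in> triangle_rel d c n" unfolding mem_triangle_rel by blast
      then show ?thesis by (rule map_prod_mem) (use j 3 v c E(4) in auto)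
    next
      case 4 then show ?thesis using E(5) Ey by (intro map_prod_mem[OF xm(1)]) auto
    next
      case 5 then show ?thesis using E(5) Ey by (intro map_prod_mem[OF xm(2)]) auto
    qed
  next
    fix s t assume "(s, t) \<in> map_prod \<phi> \<phi> ` triangle_rel d c n"
    then obtain i j where ij: "(i, j) \<in> triangle_rel d c n" "s = \<phi> i" "t = \<phi> j" by auto
    have E': "(\<phi> i, \<phi> j) \<in> parcs G" if "(i, j) \<in> triangle_edges d c n" for i j
    proof -
      consider "i < d" "j = Suc i" | "i = Suc d" "j = d + 2" | "i = c" "Suc d \<le> j" "j < n"
        using \<open>(i, j) \<in> triangle_edges d c n\<close> unfolding mem_triangle_edges by fastforce
      then show ?thesis
      proof cases
        case 1 then show ?thesis using arcs_intros(1)[of i] E(4)[of i] E(4)[of j] by simp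
      next
        case 2 show ?thesis unfolding 2 Ey E(5) by (rule arcs_intros(3))
      next
        case 3 then show ?thesis using arcs_intros(2)[OF S[of j]] E(4)[OF c] v by simp
      qed
    qed
    show "(s, t) \<in> parcs G"
      using ij E' sym_arc unfolding triangle_rel_def by auto
  qed
  then show "copy G n (triangle_rel d c n)" unfolding copy_def copy_via_def using E(1) by blast
qed

end

text \<open>The extra edge joins \<open>x\<close> to another off-path vertex, which gives the
  triangle shape, or to a position one or two steps from \<open>c\<close>, which gives an ear. Ears
  on the lower side are reflected.\<close>

theorem extremal_copy:
  assumes card: "card (parcs G) = 2 * card (pverts G)" and n: "card (pverts G) = n" and d: "diameter G = d"
    and eq: "max_degree G + d = n + 1"
  shows "\<exists>c\<ge>1. c < d \<and> (d + 3 \<le> n \<and> copy G n (triangle_rel d c n) \<or> copy G n (ear_rel d c (Suc c) c n)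
    \<or> c + 2 \<le> d \<and> copy G n (ear_rel d c (c + 2) c n))"
proof -
  have "max_degree G \<in> degree G ` pverts G" unfolding max_degree_def using verts_ne by (intro Max_in) auto
  then obtain v where v: "v \<in> pverts G" "degree G v = max_degree G" by auto
  obtain p where p: "geodesic p d" using diametral_geodesic d by metis
  have "degree G v + d = card (pverts G) + 1" using v eq n by simp
  from extremal_structure[OF p v(1) card this] obtain c x y where
    c: "1 \<le> c" "c < d" and vc: "v = p c" and A: "parcs G = spine_arcs p d v \<union> {(x, y), (y, x)}"
    and x: "x \<in> pverts G - p ` {..d}" and xy: "x \<noteq> y"
    and y: "y \<in> pverts G - p ` {..d} \<or> (\<exists>j\<le>d. y = p j \<and> j \<noteq> c \<and> j \<le> c + 2 \<and> c \<le> j + 2)" by blast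
  have cd: "c \<le> d" using c by simp
  from y show ?thesis
  proof
    assume "y \<in> pverts G - p ` {..d}"
    from triangle_copy[OF p vc cd A x n this] xy c show ?thesis by blast
  next
    assume "\<exists>j\<le>d. y = p j \<and> j \<noteq> c \<and> j \<le> c + 2 \<and> c \<le> j + 2"
    then obtain j where j: "j \<le> d" "y = p j" "j \<noteq> c" "j \<le> c + 2" "c \<le> j + 2" by blast
    consider "j = Suc c" | "j = c + 2" | "c = Suc j" | "c = j + 2" using j(3-5) by linarith
    then show ?thesis
    proof cases
      case 1 then show ?thesis using ear_copy[OF p vc cd A x n j(2,1)] c by blast
    next
      case 2 then show ?thesis using ear_copy[OF p vc cd A x n j(2,1)] c j(1) by blast
    next
      \<comment> \<open>On the reversed geodesic \<open>c\<close> becomes \<open>d - c\<close> and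
        the attachment point becomes its successor.\<close>
      case 3
      have "copy G n (ear_rel d (d - c) (d - j) (d - c) n)"
      proof (rule ear_copy[OF geodesic_rev[OF p]])
        show "v = p (d - (d - c))" "y = p (d - (d - j))" using vc j cd by simp_all
        show "parcs G = spine_arcs (\<lambda>i. p (d - i)) d v \<union> {(x, y), (y, x)}" unfolding spine_arcs_rev by (rule A)
        have "(\<lambda>i. p (d - i)) ` {..d} \<subseteq> p ` {..d}" by auto
        then show "x \<in> pverts G - (\<lambda>i. p (d - i)) ` {..d}" using x by blast
      qed (use n in simp_all)
      moreover have "d - j = Suc (d - c)" using 3 c by simp
      moreover have "1 \<le> d - c" "d - c < d" using c by simp_all
      ultimately show ?thesis by metis
    next
      case 4
      have "copy G n (ear_rel d (d - c) (d - j) (d - c) n)"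
      proof (rule ear_copy[OF geodesic_rev[OF p]])
        show "v = p (d - (d - c))" "y = p (d - (d - j))" using vc j cd by simp_all
        show "parcs G = spine_arcs (\<lambda>i. p (d - i)) d v \<union> {(x, y), (y, x)}" unfolding spine_arcs_rev by (rule A)
        have "(\<lambda>i. p (d - i)) ` {..d} \<subseteq> p ` {..d}" by auto
        then show "x \<in> pverts G - (\<lambda>i. p (d - i)) ` {..d}" using x by blast
      qed (use n in simp_all)
      moreover have "d - j = (d - c) + 2" "(d - c) + 2 \<le> d" using 4 c by simp_all
      moreover have "1 \<le> d - c" "d - c < d" using c by simp_all
      ultimately show ?thesis by metis
    qed
  qed
qed

end

section \<open>The graphs of the paper as explicit shapes\<close>

text \<open>How the vertices of the ear graphs are numbered in \<^const>\<open>U_graph\<close>; here \<open>l\<close> is half the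
  length of the cycle, rounded down.\<close>

definition U_label :: "nat \<Rightarrow> nat \<Rightarrow> nat \<Rightarrow> nat \<Rightarrow> nat" where
  "U_label l a d i = (if i < a then l + 1 + a - i else if i \<le> a + l then i - a else if i \<le> d then i + 1
     else if i = Suc d then l + 1 else i)"

lemma mem_path_edges:
  "(u, w) \<in> path_edges v s l \<longleftrightarrow> (0 < l \<and> u = v \<and> w = s) \<or> (s \<le> u \<and> w = Suc u \<and> w < s + l)"
proof
  assume "(u, w) \<in> path_edges v s l"
  then obtain j where "j < l" "w = s + j" "u = (if j = 0 then v else s + (j - 1))"
    unfolding path_edges_def by auto
  then show "(0 < l \<and> u = v \<and> w = s) \<or> (s \<le> u \<and> w = Suc u \<and> w < s + l)" by (cases j) auto
next
  assume "(0 < l \<and> u = v \<and> w = s) \<or> (s \<le> u \<and> w = Suc u \<and> w < s + l)"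
  then show "(u, w) \<in> path_edges v s l"
  proof
    assume "0 < l \<and> u = v \<and> w = s" then show ?thesis unfolding path_edges_def by force
  next
    assume "s \<le> u \<and> w = Suc u \<and> w < s + l"
    then have "w - s < l" "w = s + (w - s)" "u = s + (w - s - 1)" "w - s \<noteq> 0" by auto
    then have "(u, w) = (if w - s = 0 then v else s + (w - s - 1), s + (w - s)) \<and> w - s < l" by simp
    then show ?thesis unfolding path_edges_def by blast
  qed
qed

lemma mem_pendant_edges: "(u, w) \<in> pendant_edges v s l \<longleftrightarrow> u = v \<and> s \<le> w \<and> w < s + l"
proof -
  have "(\<exists>j<l. w = s + j) \<longleftrightarrow> s \<le> w \<and> w < s + l" by (auto simp: le_iff_add)
  then show ?thesis unfolding pendant_edges_def by auto
qed

lemma mem_cycle_edges: "(u, w) \<in> cycle_edges (l + 2) \<longleftrightarrow> (u \<le> l \<and> w = Suc u) \<or> (u = Suc l \<and> w = 0)"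
proof -
  have "Suc i mod (l + 2) = (if i \<le> l then Suc i else 0)" if "i < l + 2" for i
  proof (cases "i \<le> l")
    case False
    then have "Suc i = l + 2" using that by linarith
    then show ?thesis using False by simp
  qed simp
  then have "(u, w) \<in> cycle_edges (l + 2) \<longleftrightarrow> u < l + 2 \<and> w = (if u \<le> l then Suc u else 0)"
    unfolding cycle_edges_def by auto
  then show ?thesis by (cases "u \<le> l") auto
qed

context
  fixes l a b d k n :: nat
  assumes l: "l = 1 \<or> l = 2" and k: "k \<le> l" and d: "d = a + l + b" and n: "d + 2 \<le> n"
begin

definition U_edges :: "nat rel" where
  "U_edges = cycle_edges (l + 2) \<union> path_edges 0 (l + 2) a \<union> path_edges l (l + 2 + a) b \<union> pendant_edges k (d + 2) (n - d - 2)"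

lemma U_graph_eq: "U_graph k n (l + 2) d a b = \<lparr>pverts = {..<n}, parcs = U_edges \<union> U_edges\<inverse>\<rparr>"
proof -
  have "(l + 2) div 2 = l" "(l + 2 + 1) div 2 = 2" "l + 2 + a + b = d + 2" using l d by auto
  then show ?thesis using n unfolding U_graph_def U_edges_def pendant_count_def Let_def by simp
qed

lemma mem_U_edges:
  "(u, w) \<in> U_edges \<longleftrightarrow> (u \<le> l \<and> w = Suc u) \<or> (u = Suc l \<and> w = 0)
     \<or> (0 < a \<and> u = 0 \<and> w = l + 2) \<or> (l + 2 \<le> u \<and> w = Suc u \<and> w < l + 2 + a)
     \<or> (0 < b \<and> u = l \<and> w = l + 2 + a) \<or> (l + 2 + a \<le> u \<and> w = Suc u \<and> w < d + 2)
     \<or> (u = k \<and> d + 2 \<le> w \<and> w < n)"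
proof -
  have "l + 2 + a + b = d + 2" "d + 2 + (n - d - 2) = n" using d n by auto
  then show ?thesis unfolding U_edges_def Un_iff mem_cycle_edges mem_path_edges mem_pendant_edges by (simp only: disj_assoc)
qed

lemma U_label_bij: "bij_betw (U_label l a d) {..<n} {..<n}"
proof -
  have inj: "inj_on (U_label l a d) {..<n}"
  proof (rule inj_onI)
    fix i j assume "U_label l a d i = U_label l a d j"
    then show "i = j" using d unfolding U_label_def by (simp split: if_splits)
  qed
  have "U_label l a d i < n" if "i < n" for i
    using d n that unfolding U_label_def by (simp split: if_split, arith)
  then have "U_label l a d ` {..<n} \<subseteq> {..<n}" by auto
  then show ?thesis using inj endo_inj_surj[of "{..<n}" "U_label l a d"] by (simp add: bij_betw_def)
qed

lemma dle: "a + l + b \<le> d" "d \<le> a + l + b" using d by simp_all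

text \<open>Orientation need not be preserved: the ear path runs along the first attached path
  towards the cycle, whereas \<open>path_edges\<close> lists that path away from it.\<close>

lemma U_edges_image:
  assumes "(i, j) \<in> ear_edges d a (a + l) (a + k) n"
  shows "(U_label l a d i, U_label l a d j) \<in> U_edges \<union> U_edges\<inverse>"
proof -
  let ?\<phi> = "U_label l a d"
  have in1: ?thesis if "?\<phi> i = u" "?\<phi> j = w" "(u, w) \<in> U_edges" for u w
    unfolding that(1,2) using that(3) by (rule UnI1)
  have in2: ?thesis if "?\<phi> i = u" "?\<phi> j = w" "(w, u) \<in> U_edges" for u w
    unfolding that(1,2) by (rule UnI2) (rule converseI[OF that(3)])
  from assms consider "i < d" "j = Suc i" | "i = Suc d" "j = a" | "i = Suc d" "j = a + l" | "i = a + k" "d + 2 \<le> j" "j < n"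
    unfolding mem_ear_edges by blast
  then show ?thesis
  proof cases
    case ij: 1
    \<comment> \<open>The diametral path traverses, in this order: the path at \<open>v_0\<close>,
      its attaching edge, half of the cycle, the attaching edge of the other path, and that
      path.\<close>
    consider "Suc i < a" | "Suc i = a" | "a \<le> i" "i < a + l" | "i = a + l" | "a + l < i" by linarith
    then show ?thesis
    proof cases
      case 1
      then have "Suc (l + a - i) = l + 1 + a - i" "l + 2 \<le> l + a - i" "Suc (l + a - i) < l + 2 + a" by linarith+
      then show ?thesis using 1 ij
        by (intro in2[of "Suc (l + a - i)" "l + a - i"]) (auto simp: U_label_def mem_U_edges)
    next
      case 2 then show ?thesis using ij by (intro in2[of "l + 2" 0]) (auto simp: U_label_def mem_U_edges)
    next
      case 3 then show ?thesis using ij dle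
        by (intro in1[of "i - a" "Suc (i - a)"]) (auto simp: U_label_def mem_U_edges Suc_diff_le)
    next
      case 4 then show ?thesis using ij dle
        by (intro in1[of l "l + 2 + a"]) (auto simp: U_label_def mem_U_edges)
    next
      case 5 then show ?thesis using ij dle
        by (intro in1[of "Suc i" "Suc (Suc i)"]) (auto simp: U_label_def mem_U_edges)
    qed
  next
    case 2 then show ?thesis using dle by (intro in1[of "Suc l" 0]) (auto simp: U_label_def mem_U_edges)
  next
    case 3 then show ?thesis using dle by (intro in2[of "Suc l" l]) (auto simp: U_label_def mem_U_edges)
  next
    case 4 then show ?thesis using dle k by (intro in1[of k j]) (auto simp: U_label_def mem_U_edges)
  qed
qed

lemma U_edges_preimage:
  assumes "(u, w) \<in> U_edges"
  shows "\<exists>i j. (i, j) \<in> ear_rel d a (a + l) (a + k) n \<and> U_label l a d i = u \<and> U_label l a d j = w"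
proof -
  let ?P = "\<lambda>i j. (i, j) \<in> ear_rel d a (a + l) (a + k) n \<and> U_label l a d i = u \<and> U_label l a d j = w"
  from assms consider "u \<le> l" "w = Suc u" | "u = Suc l" "w = 0"
    | "0 < a" "u = 0" "w = l + 2" | "l + 2 \<le> u" "w = Suc u" "w < l + 2 + a"
    | "0 < b" "u = l" "w = l + 2 + a" | "l + 2 + a \<le> u" "w = Suc u" "w < d + 2"
    | "u = k" "d + 2 \<le> w" "w < n" unfolding mem_U_edges by blast
  then show ?thesis
  proof cases
    case 1
    show ?thesis
    proof (cases "u = l")
      case True then have "?P (a + l) (Suc d)" using 1 dle by (simp add: mem_ear_rel U_label_def)
      then show ?thesis by blast
    next
      case False then have "?P (a + u) (a + w)" using 1 dle by (simp add: mem_ear_rel U_label_def)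
      then show ?thesis by blast
    qed
  next
    case 2 then have "?P (Suc d) a" using dle l by (simp add: mem_ear_rel U_label_def) then show ?thesis by blast
  next
    case 3
    then obtain e where "a = Suc e" by (cases a) auto
    then have "?P a e" using 3 dle by (simp add: mem_ear_rel U_label_def)
    then show ?thesis by blast
  next
    case 4
    define i where "i = l + a - u"
    have "u = l + 1 + a - Suc i" "w = l + 1 + a - i" "Suc i < a" using 4 by (auto simp: i_def)
    then have "?P (Suc i) i" using dle by (simp add: mem_ear_rel U_label_def)
    then show ?thesis by blast
  next
    case 5
    then have "?P (a + l) (Suc (a + l))" using dle by (simp add: mem_ear_rel U_label_def)
    then show ?thesis by blast
  next
    case 6
    then obtain i where i: "u = Suc i" by (cases u) auto
    then have "?P i u" using dle 6 by (simp add: mem_ear_rel U_label_def)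
    then show ?thesis by blast
  next
    case 7 then have "?P (a + k) w" using dle k by (simp add: mem_ear_rel U_label_def) then show ?thesis by blast
  qed
qed

text \<open>The ear vertex is the one cycle vertex off the diametral path, and \<open>v_k\<close>
  sits at position \<open>a + k\<close> of that path.\<close>

theorem U_graph_copy: "copy (U_graph k n (l + 2) d a b) n (ear_rel d a (a + l) (a + k) n)"
proof -
  let ?\<phi> = "U_label l a d" and ?R = "ear_rel d a (a + l) (a + k) n"
  have sym: "(j, i) \<in> ?R" if "(i, j) \<in> ?R" for i j using that unfolding ear_rel_def by blast
  have "U_edges \<union> U_edges\<inverse> = map_prod ?\<phi> ?\<phi> ` ?R"
  proof (intro equalityI subrelI)
    fix u w assume "(u, w) \<in> U_edges \<union> U_edges\<inverse>"
    then consider "(u, w) \<in> U_edges" | "(w, u) \<in> U_edges" by blast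
    then show "(u, w) \<in> map_prod ?\<phi> ?\<phi> ` ?R"
    proof cases
      case 1
      then obtain i j where "(i, j) \<in> ?R" "?\<phi> i = u" "?\<phi> j = w" using U_edges_preimage by blast
      then show ?thesis by (intro image_eqI[of _ _ "(i, j)"]) simp_all
    next
      case 2
      then obtain i j where "(i, j) \<in> ?R" "?\<phi> i = w" "?\<phi> j = u" using U_edges_preimage by blast
      then show ?thesis using sym by (intro image_eqI[of _ _ "(j, i)"]) simp_all
    qed
  next
    fix u w assume "(u, w) \<in> map_prod ?\<phi> ?\<phi> ` ?R"
    then obtain i j where ij: "(i, j) \<in> ?R" "u = ?\<phi> i" "w = ?\<phi> j" by auto
    then have "(i, j) \<in> ear_edges d a (a + l) (a + k) n \<or> (j, i) \<in> ear_edges d a (a + l) (a + k) n"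
      unfolding ear_rel_def by blast
    then show "(u, w) \<in> U_edges \<union> U_edges\<inverse>" using U_edges_image ij by blast
  qed
  then show ?thesis unfolding copy_def copy_via_def U_graph_eq using U_label_bij by auto
qed

end

text \<open>The sum \<open>g + t\<close> fixes the parity of \<open>g - t\<close>, so the next
  larger candidate difference is \<open>g - t + 2\<close>. Being too large for the bound, it
  certifies that \<open>(g, t)\<close> is optimal.\<close>

lemma opt_lengths_eq:
  assumes gt: "g + t = d - m div 2" and le: "real g - real t \<le> alpha n m d + 1" and less: "alpha n m d + 1 < real g - real t + 2"
  shows "opt_lengths n m d = (g, t)"
  unfolding opt_lengths_def
proof (rule the_equality)
  have mem: "(g, t) \<in> admissible_lengths n m d" using gt le by (simp add: admissible_lengths_def)
  have max: "int (fst q) - int (snd q) \<le> int g - int t" if "q \<in> admissible_lengths n m d" for q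
  proof (rule ccontr)
    assume c: "\<not> int (fst q) - int (snd q) \<le> int g - int t"
    have s: "fst q + snd q = g + t" "real (fst q) - real (snd q) \<le> alpha n m d + 1"
      using that gt by (auto simp: admissible_lengths_def)
    then have "fst q \<ge> g + 1" "snd q + 1 \<le> t" using c by linarith+
    then have "real (fst q) \<ge> real g + 1" "real (snd q) + 1 \<le> real t" by linarith+
    then show False using s(2) less by linarith
  qed
  show "(g, t) \<in> admissible_lengths n m d \<and>
      (\<forall>q\<in>admissible_lengths n m d. int (fst q) - int (snd q) \<le> int (fst (g, t)) - int (snd (g, t)))"
    using mem max by simp
  show "p = (g, t)" if "p \<in> admissible_lengths n m d \<and>
      (\<forall>q\<in>admissible_lengths n m d. int (fst q) - int (snd q) \<le> int (fst p) - int (snd p))" for p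
  proof -
    have "int g - int t = int (fst p) - int (snd p)" using that mem max[of p] by fastforce
    moreover have "fst p + snd p = g + t" using that gt by (auto simp: admissible_lengths_def)
    ultimately have "fst p = g" "snd p = t" by linarith+
    then show ?thesis by (simp add: prod_eq_iff)
  qed
qed

text \<open>With \<open>h\<close> pendant vertices \<open>alpha\<close> is
  \<open>h / (h + 3/2)\<close>, which lies in [0, 1). The difference is therefore 0 or 1, according
  to the parity of \<open>d - 1\<close>.\<close>

lemma opt_lengths_3:
  assumes "1 \<le> d" "d + 2 \<le> n"
  shows "opt_lengths n 3 d = (d div 2, d - 1 - d div 2)"
proof (rule opt_lengths_eq)
  define h where "h = n - d - 2"
  have al': "alpha n 3 d = real h / (real h + 3 / 2)"
    unfolding alpha_def pendant_count_def h_def using assms by (simp add: of_nat_diff)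
  have al: "0 \<le> alpha n 3 d" "alpha n 3 d < 1" unfolding al' by (simp_all add: divide_simps)
  have "int (d div 2) - int (d - 1 - d div 2) \<in> {0, 1}" using assms by auto
  then have "real (d div 2) - real (d - 1 - d div 2) \<in> {0, 1}" by auto
  then show "real (d div 2) - real (d - 1 - d div 2) \<le> alpha n 3 d + 1"
    "alpha n 3 d + 1 < real (d div 2) - real (d - 1 - d div 2) + 2" using al by auto
  show "d div 2 + (d - 1 - d div 2) = d - 3 div 2" using assms by simp
qed

text \<open>Now \<open>alpha\<close> is \<open>2 * h / (h + 3/2)\<close>. It is below 1 for
  \<open>h \<le> 1\<close>, so the difference is 0 or 1; for \<open>h \<ge> 2\<close> it lies in [1,
  2), so the difference is 1 or 2. This is the origin of the case distinction at
  \<open>n \<le> d + 3\<close>.\<close>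

lemma opt_lengths_4:
  assumes "4 \<le> d" "d + 2 \<le> n" and c: "c = (if n \<le> d + 3 then (d - 1) div 2 else d div 2)"
  shows "opt_lengths n 4 d = (c, d - 2 - c)"
proof (rule opt_lengths_eq)
  define h where "h = n - d - 2"
  have al: "alpha n 4 d = 2 * real h / (real h + 3 / 2)"
    unfolding alpha_def pendant_count_def h_def using assms(1,2) by (simp add: of_nat_diff)
  show "c + (d - 2 - c) = d - 4 div 2" using assms by auto
  show "real c - real (d - 2 - c) \<le> alpha n 4 d + 1"
  proof (cases "n \<le> d + 3")
    case True
    then have "c \<le> d - 2 - c + 1" using c assms(1) by simp
    then have "real c - real (d - 2 - c) \<le> 1" by linarith
    moreover have "0 \<le> alpha n 4 d" unfolding al by simp
    ultimately show ?thesis by linarith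
  next
    case False
    then have "c \<le> d - 2 - c + 2" using c assms(1) by simp
    then have "real c - real (d - 2 - c) \<le> 2" by linarith
    moreover have "2 \<le> h" using False by (simp add: h_def)
    then have "1 \<le> alpha n 4 d" unfolding al by (simp add: divide_simps)
    ultimately show ?thesis by linarith
  qed
  show "alpha n 4 d + 1 < real c - real (d - 2 - c) + 2"
  proof (cases "n \<le> d + 3")
    case True
    then have "h \<le> 1" by (simp add: h_def)
    then have "alpha n 4 d < 1" unfolding al by (simp add: divide_simps)
    moreover have "d - 2 - c \<le> c" using True c assms(1) by simp
    then have "real (d - 2 - c) \<le> real c" by linarith
    ultimately show ?thesis by linarith
  next
    case False
    have "alpha n 4 d < 2" unfolding al by (simp add: divide_simps)
    moreover have "d - 2 - c + 1 \<le> c" using False c assms(1) by simp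
    then have "real (d - 2 - c) + 1 \<le> real c" by linarith
    ultimately show ?thesis by linarith
  qed
qed

section \<open>Comparison of the values\<close>

text \<open>Three times the value of the ear shape with \<open>b = c + 1\<close>;
  \<open>val4\<close> is the same for \<open>b = c + 2\<close>.\<close>

definition val3 :: "int \<Rightarrow> int \<Rightarrow> int \<Rightarrow> int" where
  "val3 n d c = rdd_base n d c + 3 * n * n - 9 * n + 18 * (d - c) + 6"

definition val4 :: "int \<Rightarrow> int \<Rightarrow> int \<Rightarrow> int" where
  "val4 n d c = rdd_base n d c + 3 * n * n - 12 * n + 36 * (d - c - 1) + 12"

text \<open>The factored form isolates the displacement \<open>c - c0\<close> and the imbalance
  \<open>2 * c0 - d\<close>, as required by \<open>slope_pos\<close>.\<close>

lemma val3_diff: "val3 n d c0 - val3 n d c = 6 * ((c - c0) * ((2 * (n - d - 1) + 1) * ((c - c0) + (2 * c0 - d)) + 3))"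
  unfolding val3_def rdd_base_def pathsum_def by (simp add: algebra_simps)

lemma val4_diff: "val4 n d c0 - val4 n d c = 6 * ((c - c0) * ((2 * (n - d - 1) + 1) * ((c - c0) + (2 * c0 - d)) + 6))"
  unfolding val4_def rdd_base_def pathsum_def by (simp add: algebra_simps)

text \<open>As a quadratic in \<open>k\<close> the expression has the roots 0 and
  \<open>- t - B / R\<close>. The second lies strictly between -1 and 0 or between 0 and 1, so no
  nonzero integer falls between the roots or on them.\<close>

lemma slope_pos:
  fixes k R B t :: int
  assumes "k \<noteq> 0" "0 < B" "B < R" "t = 0 \<or> t = -1"
  shows "0 < k * (R * (k + t) + B)"
proof (cases "0 < k")
  case True
  then have "0 \<le> R * (k + t)" using assms by (intro mult_nonneg_nonneg) auto
  then show ?thesis using True assms by (intro mult_pos_pos) auto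
next
  case False
  then have "R * (k + t) \<le> R * (-1)" using assms by (intro mult_left_mono) auto
  then show ?thesis using False assms by (intro mult_neg_neg) auto
qed

lemma div2_shift: "2 * int (d div 2) - int d = 0 \<or> 2 * int (d div 2) - int d = -1"
  by linarith

lemma val3_less:
  assumes "d + 3 \<le> n" "c \<noteq> d div 2"
  shows "val3 (int n) (int d) (int c) < val3 (int n) (int d) (int (d div 2))"
proof -
  have "0 < (int c - int (d div 2)) * ((2 * (int n - int d - 1) + 1) * ((int c - int (d div 2)) + (2 * int (d div 2) - int d)) + 3)"
    by (rule slope_pos[OF _ _ _ div2_shift]) (use assms in auto)
  then show ?thesis using val3_diff[of "int n" "int d" "int (d div 2)" "int c"] by linarith
qed

lemma square_succ_nonneg: "0 \<le> k * (k + 1)" for k :: int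
  by (cases "0 \<le> k") (auto intro: mult_nonneg_nonneg mult_nonpos_nonpos)

text \<open>For \<open>n = d + 2\<close> there are no pendant vertices and \<open>R = B = 3\<close>,
  so \<open>slope_pos\<close> does not apply. The loss becomes a multiple of
  \<open>k * (k + 1)\<close> or \<open>k * k\<close>; the first vanishes at \<open>k = -1\<close>,
  the mirror image of the same graph.\<close>

lemma val3_le:
  assumes "d + 2 \<le> n"
  shows "val3 (int n) (int d) (int c) \<le> val3 (int n) (int d) (int (d div 2))"
proof (cases "n = d + 2")
  case True
  define k where "k = int c - int (d div 2)"
  have D: "val3 (int n) (int d) (int (d div 2)) - val3 (int n) (int d) (int c) = 6 * (k * (3 * (k + (2 * int (d div 2) - int d)) + 3))"
    unfolding val3_diff k_def using True by simp
  have "0 \<le> k * (3 * (k + (2 * int (d div 2) - int d)) + 3)"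
    using div2_shift[of d]
  proof
    assume e: "2 * int (d div 2) - int d = 0"
    have "k * (3 * (k + 0) + 3) = 3 * (k * (k + 1))" by (simp add: algebra_simps)
    then show ?thesis unfolding e using square_succ_nonneg[of k] by linarith
  next
    assume e: "2 * int (d div 2) - int d = -1"
    have "k * (3 * (k + -1) + 3) = 3 * (k * k)" by (simp add: algebra_simps)
    then show ?thesis unfolding e using zero_le_square[of k] by linarith
  qed
  then show ?thesis using D by linarith
next
  case False
  then show ?thesis using val3_less[of d n c] assms by (cases "c = d div 2") auto
qed

text \<open>The maximiser of \<open>val4\<close>; it coincides with the first length computed in
  \<open>opt_lengths_4\<close>.\<close>

definition best4 :: "nat \<Rightarrow> nat \<Rightarrow> nat" where
  "best4 n d = (if n \<le> d + 3 then (d - 1) div 2 else d div 2)"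

text \<open>The excluded position \<open>c + 1 = best4 n d\<close> is a true tie: without pendant
  vertices and with \<open>d\<close> odd it is the reflection of the best position.\<close>

lemma val4_less:
  assumes "d + 2 \<le> n" "1 \<le> d" "c \<noteq> best4 n d" "n = d + 2 \<and> odd d \<longrightarrow> c + 1 \<noteq> best4 n d"
  shows "val4 (int n) (int d) (int c) < val4 (int n) (int d) (int (best4 n d))"
proof -
  define k where "k = int c - int (best4 n d)"
  define t where "t = 2 * int (best4 n d) - int d"
  have k0: "k \<noteq> 0" using assms by (auto simp: k_def)
  have "0 < k * ((2 * (int n - int d - 1) + 1) * (k + t) + 6)"
  proof -
    \<comment> \<open>The coefficient \<open>R\<close> is 3, 5 or at least 7, to be compared with
      \<open>B = 6\<close>. In the first two cases multiples of \<open>R\<close> are moved from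
      \<open>B\<close> into the imbalance \<open>t\<close>.\<close>
    consider "n = d + 2" "even d" | "n = d + 2" "odd d" | "n = d + 3" "even d" | "n = d + 3" "odd d" | "d + 4 \<le> n"
      using assms(1) by linarith
    then show ?thesis
    proof cases
      case 1
      then have "2 * ((d - 1) div 2) + 2 = d" using assms(2) by presburger
      then have "t = -2" using 1 by (simp add: t_def best4_def)
      then have "k * ((2 * (int n - int d - 1) + 1) * (k + t) + 6) = 3 * (k * k)" using 1 by (simp add: algebra_simps)
      moreover have "0 < k * k" using k0 by (simp add: zero_less_mult_iff) linarith
      ultimately show ?thesis by linarith
    next
      case 2
      then have "t = -1" by (auto simp: t_def best4_def elim!: oddE)
      then have e: "k * ((2 * (int n - int d - 1) + 1) * (k + t) + 6) = 3 * (k * (k + 1))" using 2 by (simp add: algebra_simps)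
      have "k \<noteq> -1" using 2 assms(4) by (auto simp: k_def)
      then have "0 < k \<or> k + 1 < 0" using k0 by linarith
      then have "0 < k * (k + 1)" by (auto intro: mult_pos_pos mult_neg_neg)
      then show ?thesis using e by linarith
    next
      case 3
      then have "2 * ((d - 1) div 2) + 2 = d" using assms(2) by presburger
      then have "t = -2" using 3 by (simp add: t_def best4_def)
      \<comment> \<open>Here \<open>5 * (k - 2) + 6 = 5 * (k - 1) + 1\<close>, which
        \<open>slope_pos\<close> covers with \<open>B = 1\<close> and \<open>t = -1\<close>.\<close>
      then have "k * ((2 * (int n - int d - 1) + 1) * (k + t) + 6) = k * (5 * (k + (-1)) + 1)" using 3 by (simp add: algebra_simps)
      moreover have "0 < k * (5 * (k + (-1)) + 1)" by (rule slope_pos[OF k0]) auto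
      ultimately show ?thesis by (simp only:)
    next
      case 4
      then have "t = -1" by (auto simp: t_def best4_def elim!: oddE)
      then have "k * ((2 * (int n - int d - 1) + 1) * (k + t) + 6) = k * (5 * (k + 0) + 1)" using 4 by (simp add: algebra_simps)
      moreover have "0 < k * (5 * (k + 0) + 1)" by (rule slope_pos[OF k0]) auto
      ultimately show ?thesis by (simp only:)
    next
      case 5
      then have "t = 0 \<or> t = -1" using div2_shift[of d] by (auto simp: t_def best4_def)
      then show ?thesis using 5 k0 by (intro slope_pos) auto
    qed
  qed
  then show ?thesis using val4_diff[of "int n" "int d" "int (best4 n d)" "int c"] unfolding k_def t_def by linarith
qed

text \<open>The right-hand side of \<open>reverse_degree_distance_le\<close>, as a function of the
  diameter.\<close>

definition crude :: "int \<Rightarrow> int \<Rightarrow> int" where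
  "crude n d = 6 * n * (n - 1) * d + 3 * n * (n - 2) - (2 * d * (d + 1) * (d + 2) + 3 * (n - d - 1) * ((d + 1)\<^sup>2 + 3)
       + 12 * (n - d - 1) * (n - d - 2) - 12 * (n - d))"

lemma crude_step:
  assumes "0 \<le> d" "d + 3 \<le> n"
  shows "crude n d \<le> crude n (d + 1)"
proof -
  define s where "s = n - d - 1"
  have n: "n = d + s + 1" and s: "2 \<le> s" using assms by (auto simp: s_def)
  have "crude n (d + 1) - crude n d = 3 * d * d + 6 * d * s + 6 * s * s + 21 * s - 27 + 0"
    unfolding crude_def n by (simp add: power2_eq_square algebra_simps)
  moreover have "2 * 2 \<le> s * s" by (rule mult_mono) (use s in auto)
  moreover have "0 \<le> d * d" "0 \<le> d * s" using assms s by auto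
  ultimately show ?thesis using s by linarith
qed

lemma crude_mono:
  assumes "i \<le> j" "j + 2 \<le> n"
  shows "crude (int n) (int i) \<le> crude (int n) (int j)"
  using assms
proof (induction j rule: dec_induct)
  case (step j)
  then have "crude (int n) (int j) \<le> crude (int n) (int j + 1)" by (intro crude_step) auto
  then show ?case using step by (simp add: add.commute)
qed simp

text \<open>By monotonicity only diameter \<open>d - 1\<close> needs attention. With
  \<open>r = n - d - 1\<close>, twice the gap is at least
  \<open>3 * (D - 2 * r + 1)^2 + 18 * r - 30\<close>. For \<open>r \<ge> 2\<close> this is positive
  at once, and for \<open>r = 1\<close> because \<open>D \<ge> 4\<close>.\<close>

lemma crude_less_val3:
  assumes "4 \<le> d" "d + 2 \<le> n" "e < d"
  shows "crude (int n) (int e) < val3 (int n) (int d) (int (d div 2))"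
proof -
  define D where "D = int d"
  define r where "r = int n - D - 1"
  define c where "c = int (d div 2)"
  have n: "int n = D + r + 1" and D4: "4 \<le> D" and r1: "1 \<le> r" using assms by (auto simp: r_def D_def)
  have "crude (int n) (int e) \<le> crude (int n) (int (d - 1))" using assms by (intro crude_mono) auto
  moreover have "int (d - 1) = D - 1" using assms by (simp add: D_def of_nat_diff)
  moreover have "2 * crude (int n) (D - 1) < 2 * val3 (int n) D c"
  proof -
    have c: "2 * c = D \<or> 2 * c = D - 1" using div2_shift[of d] unfolding c_def D_def by linarith
    \<comment> \<open>Attained for odd \<open>D\<close>. Together with
      \<open>36 * (D - c) \<ge> 18 * D\<close> it removes the rounding in \<open>d div 2\<close>
      from the estimate.\<close>
    have ps: "2 * pathsum D c \<le> (D + 1) * (D + 1)"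
      using c
    proof
      assume "2 * c = D" then have D: "D = 2 * c" by simp
      show ?thesis unfolding D pathsum_def by (simp add: algebra_simps)
    next
      assume "2 * c = D - 1" then have D: "D = 2 * c + 1" by simp
      show ?thesis unfolding D pathsum_def by (simp add: algebra_simps)
    qed
    have "(2 * r + 1) * (2 * pathsum D c) \<le> (2 * r + 1) * ((D + 1) * (D + 1))"
      using ps r1 by (intro mult_left_mono) auto
    note b1 = this
    have b2: "2 * val3 (int n) D c = 2 * (6 * (D + r + 1) * (D + r) * D - 2 * D * (D + 1) * (D + 2) - 12 * r * (D + 1)
       - 12 * r * (r - 1) - 6 * r) - 3 * ((2 * r + 1) * (2 * pathsum D c))
       + 2 * (3 * (D + r + 1) * (D + r + 1) - 9 * (D + r + 1)) + 36 * (D - c) + 12"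
      unfolding val3_def rdd_base_def n by (simp add: algebra_simps)
    have b3: "2 * (6 * (D + r + 1) * (D + r) * D - 2 * D * (D + 1) * (D + 2) - 12 * r * (D + 1)
       - 12 * r * (r - 1) - 6 * r) - 3 * ((2 * r + 1) * ((D + 1) * (D + 1)))
       + 2 * (3 * (D + r + 1) * (D + r + 1) - 9 * (D + r + 1)) + 18 * D + 12 - 2 * crude (int n) (D - 1)
       = 3 * (D - 2 * r + 1)\<^sup>2 + 18 * r - 30"
      unfolding crude_def n by (simp add: power2_eq_square algebra_simps)
    have b4: "0 < 3 * (D - 2 * r + 1)\<^sup>2 + 18 * r - 30"
    proof (cases "r = 1")
      case True
      have "3 * 3 \<le> (D - 1) * (D - 1)" using D4 by (intro mult_mono) auto
      then show ?thesis using True by (simp add: power2_eq_square algebra_simps)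
    next
      case False
      then show ?thesis using r1 zero_le_power2[of "D - 2 * r + 1"] by linarith
    qed
    have cle: "2 * c \<le> D" using c by auto
    \<comment> \<open>Stated for variables, so that the long products enter the linear arithmetic as
      atoms.\<close>
    have "w < v" if "p \<le> q" "v = a - 3 * p + b + 36 * (D - c) + 12" "a - 3 * q + b + 18 * D + 12 - w = z" "0 < z"
      for w v p q a b z :: int using that cle unfolding right_diff_distrib by linarith
    from this[OF b1 b2 b3 b4] show ?thesis .
  qed
  ultimately show ?thesis unfolding c_def D_def by simp
qed

text \<open>With \<open>n = d + 2\<close> no pendant vertex distinguishes \<open>a\<close> from
  \<open>a + 2\<close>, so reversing the path preserves the shape and exchanges the lengths of its
  two arms.\<close>

lemma ear_swap_copy:
  assumes G: "copy G n (ear_rel d a (a + 2) a n)" and n: "n = d + 2" and a: "a + 2 \<le> d"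
  shows "copy G n (ear_rel d (d - a - 2) (d - a) (d - a - 2) n)"
proof -
  obtain \<phi> where \<phi>: "bij_betw \<phi> {..<n} (pverts G)" "parcs G = map_prod \<phi> \<phi> ` ear_rel d a (a + 2) a n"
    using G unfolding copy_def copy_via_def by auto
  define \<rho> where "\<rho> i = (if i \<le> d then d - i else i)" for i
  have inv: "\<rho> (\<rho> i) = i" for i by (simp add: \<rho>_def)
  have lt: "\<rho> i < n" if "i < n" for i using that n by (auto simp: \<rho>_def)
  have bij: "bij_betw \<rho> {..<n} {..<n}"
    by (rule bij_betw_byWitness[of _ \<rho>]) (use inv lt in auto)
  \<comment> \<open>Stated for a general \<open>b'\<close> because both inclusions are instances:
    \<open>b' = a + 2\<close> and \<open>b' = d - a\<close>.\<close>
  have R: "(\<rho> i, \<rho> j) \<in> ear_rel d (d - b') (d - b' + 2) (d - b') n"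
    if "(i, j) \<in> ear_rel d (b' - 2) b' (b' - 2) n" "2 \<le> b'" "b' \<le> d" for i j b'
  proof -
    have "i < d \<and> j = Suc i \<or> j < d \<and> i = Suc j \<or> i = Suc d \<and> (j = b' - 2 \<or> j = b') \<or> j = Suc d \<and> (i = b' - 2 \<or> i = b')"
      using that(1) n unfolding mem_ear_rel by linarith
    then consider "i < d" "j = Suc i" | "j < d" "i = Suc j" | "i = Suc d" "j = b' - 2" | "i = Suc d" "j = b'"
      | "j = Suc d" "i = b' - 2" | "j = Suc d" "i = b'" by blast
    moreover have e: "Suc (Suc d) - b' = Suc (Suc (d - b'))" using that by linarith
    ultimately show ?thesis unfolding mem_ear_rel
      by cases (use that e in \<open>simp_all add: \<rho>_def Suc_diff_Suc\<close>)
  qed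
  have R1: "(\<rho> i, \<rho> j) \<in> ear_rel d (d - a - 2) (d - a) (d - a - 2) n" if "(i, j) \<in> ear_rel d a (a + 2) a n" for i j
  proof -
    have "d - (a + 2) = d - a - 2" "d - (a + 2) + 2 = d - a" using a by simp_all
    then show ?thesis using R[of i j "a + 2"] that a by simp
  qed
  have R2: "(\<rho> i, \<rho> j) \<in> ear_rel d a (a + 2) a n" if "(i, j) \<in> ear_rel d (d - a - 2) (d - a) (d - a - 2) n" for i j
    using R[of i j "d - a"] that a by simp
  have "parcs G = map_prod (\<phi> \<circ> \<rho>) (\<phi> \<circ> \<rho>) ` ear_rel d (d - a - 2) (d - a) (d - a - 2) n"
    unfolding \<phi>(2)
  proof (intro equalityI subrelI)
    fix u w assume "(u, w) \<in> map_prod \<phi> \<phi> ` ear_rel d a (a + 2) a n"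
    then obtain i j where "(i, j) \<in> ear_rel d a (a + 2) a n" "u = \<phi> i" "w = \<phi> j" by auto
    then show "(u, w) \<in> map_prod (\<phi> \<circ> \<rho>) (\<phi> \<circ> \<rho>) ` ear_rel d (d - a - 2) (d - a) (d - a - 2) n"
      using R1 inv by (intro image_eqI[of _ _ "(\<rho> i, \<rho> j)"]) auto
  next
    fix u w assume "(u, w) \<in> map_prod (\<phi> \<circ> \<rho>) (\<phi> \<circ> \<rho>) ` ear_rel d (d - a - 2) (d - a) (d - a - 2) n"
    then obtain i j where "(i, j) \<in> ear_rel d (d - a - 2) (d - a) (d - a - 2) n" "u = \<phi> (\<rho> i)" "w = \<phi> (\<rho> j)" by auto
    then show "(u, w) \<in> map_prod \<phi> \<phi> ` ear_rel d a (a + 2) a n"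
      using R2 by (intro image_eqI[of _ _ "(\<rho> i, \<rho> j)"]) auto
  qed
  moreover have "bij_betw (\<phi> \<circ> \<rho>) {..<n} (pverts G)" by (rule bij_betw_trans[OF bij \<phi>(1)])
  ultimately show ?thesis unfolding copy_def copy_via_def by blast
qed

section \<open>The candidates and their uniqueness for fixed parameters\<close>

context
  fixes n \<Delta> d :: nat
  assumes n6: "6 \<le> n" and \<Delta>3: "3 \<le> \<Delta>" and \<Delta>n: "\<Delta> \<le> n - 3" and d: "d = n - \<Delta> + 1"
begin

lemma d_bounds: "4 \<le> d" "d + 2 \<le> n" "\<Delta> + d = n + 1" "n - d + 1 = \<Delta>"
  using n6 \<Delta>3 \<Delta>n d by auto

lemma ear_in_class:
  assumes G: "copy G n (ear_rel d c b c n)" and c: "1 \<le> c" "c < b" "b \<le> c + 2" "b \<le> d"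
  shows "G \<in> unicyclic_class n \<Delta>"
proof -
  interpret ear d c b c n using c d_bounds by unfold_locales auto
  have "ear_gap c b c = 1" using c by (simp add: ear_gap_def)
  then have g: "ear_gap c b c < d" using d_bounds by simp
  have cd: "c < d" using c by simp
  have "unicyclic G" by (rule reverse_ear(2)[OF G c(1) cd g])
  moreover have "card (pverts G) = n" by (rule reverse_ear(3)[OF G c(1) cd g])
  moreover have "max_degree G = \<Delta>" using max_degree_ear[OF G refl c(1)] d_bounds(4) by simp
  ultimately show ?thesis unfolding unicyclic_class_def by blast
qed

lemma best4_bounds: "1 \<le> best4 n d" "best4 n d + 2 \<le> d"
  using d_bounds by (auto simp: best4_def)

lemma U_opt_3_copy: "copy (U_opt n 3 d) n (ear_rel d (d div 2) (Suc (d div 2)) (d div 2) n)"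
proof -
  have "d = d div 2 + 1 + (d - 1 - d div 2)" using d_bounds(1) by linarith
  from U_graph_copy[of 1 0, OF _ _ this d_bounds(2)]
  have "copy (U_graph 0 n (1 + 2) d (d div 2) (d - 1 - d div 2)) n (ear_rel d (d div 2) (d div 2 + 1) (d div 2 + 0) n)" by simp
  moreover have "(1::nat) + 2 = 3" "d div 2 + 1 = Suc (d div 2)" "d div 2 + 0 = d div 2" by simp_all
  moreover have "opt_lengths n 3 d = (d div 2, d - 1 - d div 2)" using d_bounds by (intro opt_lengths_3) auto
  ultimately show ?thesis unfolding U_opt_def by (simp only: fst_conv snd_conv)
qed

lemma U_opt_4_eq: "U_opt n 4 d = U_graph 0 n 4 d (best4 n d) (d - 2 - best4 n d)"
  unfolding U_opt_def opt_lengths_4[OF d_bounds(1,2) best4_def] by simp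

lemma U_4_copy:
  assumes "k \<le> 2"
  shows "copy (U_graph k n 4 d (best4 n d) (d - 2 - best4 n d)) n
    (ear_rel d (best4 n d) (best4 n d + 2) (best4 n d + k) n)"
proof -
  have "d = best4 n d + 2 + (d - 2 - best4 n d)" using best4_bounds by linarith
  from U_graph_copy[of 2 k, OF _ assms this d_bounds(2)]
  have "copy (U_graph k n (2 + 2) d (best4 n d) (d - 2 - best4 n d)) n
    (ear_rel d (best4 n d) (best4 n d + 2) (best4 n d + k) n)" by simp
  then show ?thesis by simp
qed

lemma U_opt_4_copy: "copy (U_opt n 4 d) n (ear_rel d (best4 n d) (best4 n d + 2) (best4 n d) n)"
  using U_4_copy[of 0] unfolding U_opt_4_eq by simp

text \<open>Three times the value of the candidate with a triangle; \<open>max4\<close> belongs to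
  the one with a 4-cycle.\<close>

definition max3 :: int where "max3 = val3 (int n) (int d) (int (d div 2))"

definition max4 :: int where "max4 = val4 (int n) (int d) (int (best4 n d))"

lemma U_opt_3: "U_opt n 3 d \<in> unicyclic_class n \<Delta>" "3 * reverse_degree_distance (U_opt n 3 d) = max3"
proof -
  have c: "1 \<le> d div 2" "Suc (d div 2) \<le> d" using d_bounds(1) by linarith+
  show "U_opt n 3 d \<in> unicyclic_class n \<Delta>" by (rule ear_in_class[OF U_opt_3_copy]) (use c in auto)
  show "3 * reverse_degree_distance (U_opt n 3 d) = max3"
    unfolding max3_def val3_def by (rule rdd_ear3[OF U_opt_3_copy c d_bounds(2)])
qed

lemma U_opt_4: "U_opt n 4 d \<in> unicyclic_class n \<Delta>" "3 * reverse_degree_distance (U_opt n 4 d) = max4"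
proof -
  show "U_opt n 4 d \<in> unicyclic_class n \<Delta>" by (rule ear_in_class[OF U_opt_4_copy]) (use best4_bounds in auto)
  show "3 * reverse_degree_distance (U_opt n 4 d) = max4"
    unfolding max4_def val4_def by (rule rdd_ear4[OF U_opt_4_copy refl best4_bounds d_bounds(2)]) simp
qed

lemma ear_rel_subset: "c < d \<Longrightarrow> b \<le> d \<Longrightarrow> ear_rel d c b c n \<subseteq> {..<n} \<times> {..<n}"
proof
  fix e assume c: "c < d" "b \<le> d" and e: "e \<in> ear_rel d c b c n"
  obtain i j where ij: "e = (i, j)" by (cases e)
  have "i < n \<and> j < n" using e c d_bounds(2) unfolding ij mem_ear_rel by linarith
  then show "e \<in> {..<n} \<times> {..<n}" unfolding ij by simp
qed

text \<open>Smaller diameters and off-path triangles stay below \<open>max3\<close>, and an ear in a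
  wrong position loses against its own kind. For \<Delta> = 3 the triangle optimum may be attained
  in two mirrored positions; no isomorphism is claimed there, which is enough since
  \<open>max3 < max4\<close> in that case.\<close>

lemma classify:
  fixes H :: "'a ugraph"
  assumes H: "H \<in> unicyclic_class n \<Delta>"
  shows "3 * reverse_degree_distance H < max3 \<or> 3 * reverse_degree_distance H < max4
    \<or> (3 * reverse_degree_distance H = max3 \<and> (\<Delta> = 3 \<or> graph_iso H (U_opt n 3 d)))
    \<or> (3 * reverse_degree_distance H = max4 \<and> graph_iso H (U_opt n 4 d))"
proof -
  have cH: "conn_graph H" and A: "card (parcs H) = 2 * card (pverts H)" and nH: "card (pverts H) = n"
    and DH: "max_degree H = \<Delta>" using H unfolding unicyclic_class_def unicyclic_iff by auto
  interpret conn_graph H by (rule cH)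
  have "max_degree H \<in> degree H ` pverts H" unfolding max_degree_def using verts_ne by (intro Max_in) auto
  then obtain v where v: "v \<in> pverts H" "degree H v = \<Delta>" using DH by auto
  obtain p where p: "geodesic p (diameter H)" by (rule diametral_geodesic)
  have "\<Delta> + diameter H \<le> n + 1" using degree_diameter_le[OF p v(1)] v(2) nH by simp
  then consider "diameter H < d" | "diameter H = d" using d_bounds(3) by linarith
  then show ?thesis
  proof cases
    case 1
    have "3 * reverse_degree_distance H \<le> crude (int n) (int (diameter H))"
      using reverse_degree_distance_le[OF A] unfolding nH crude_def by linarith
    also have "\<dots> < max3" unfolding max3_def by (rule crude_less_val3[OF d_bounds(1,2) 1])
    finally show ?thesis by simp
  next
    case 2
    obtain c where c: "1 \<le> c" "c < d" and
      alt: "d + 3 \<le> n \<and> copy H n (triangle_rel d c n) \<or> copy H n (ear_rel d c (Suc c) c n)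
      \<or> c + 2 \<le> d \<and> copy H n (ear_rel d c (c + 2) c n)"
      using extremal_copy[OF A nH 2] DH d_bounds(3) by auto
    from alt consider "d + 3 \<le> n" "copy H n (triangle_rel d c n)" | "copy H n (ear_rel d c (Suc c) c n)"
      | "c + 2 \<le> d" "copy H n (ear_rel d c (c + 2) c n)" by blast
    then show ?thesis
    proof cases
      case t: 1
      interpret T: tri d c n using c t(1) by unfold_locales auto
      have "card (uedges H) = n" using card_arcs_uedges A nH by simp
      note R = T.reverse_tri[OF t(2) 2 this]
      have "2 * T.pd c = pathsum (int d) (int c)" using T.pd[of c] c unfolding pathsum_def by simp
      then have pc: "6 * (2 * (int n - int d - 1) + 1) * T.pd c = 3 * (2 * (int n - int d - 1) + 1) * pathsum (int d) (int c)"
        by (simp flip: \<open>2 * T.pd c = pathsum (int d) (int c)\<close>)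
      have R': "3 * reverse_degree_distance H = val3 (int n) (int d) (int c) + 18 - 18 * (int d - int c)"
        using R unfolding pc val3_def rdd_base_def by simp
      show ?thesis
      \<comment> \<open>The value is \<open>val3\<close> at \<open>c\<close> plus
        \<open>18 - 18 * (d - c)\<close>. In the middle position \<open>d - c \<ge> 2\<close> makes
        the correction negative; elsewhere it is at most 0 and \<open>val3\<close> itself is
        smaller.\<close>
      proof (cases "c = d div 2")
        case True
        then have "2 \<le> d - c" using d_bounds(1) by linarith
        then have "18 * (int d - int c) > 18" using c unfolding right_diff_distrib by linarith
        then have "3 * reverse_degree_distance H < max3" using R' unfolding max3_def True by linarith
        then show ?thesis by blast
      next
        case False
        have "18 * (int d - int c) \<ge> 18" using c unfolding right_diff_distrib by linarith
        then have "3 * reverse_degree_distance H < max3"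
          using R' val3_less[OF t(1) False] unfolding max3_def by linarith
        then show ?thesis by blast
      qed
    next
      case e: 2
      have R: "3 * reverse_degree_distance H = val3 (int n) (int d) (int c)"
        unfolding val3_def by (rule rdd_ear3[OF e c(1) _ d_bounds(2)]) (use c in simp)
      show ?thesis
      proof (cases "c = d div 2")
        case True
        have "graph_iso H (U_opt n 3 d)"
          by (rule copy_iso[OF e[unfolded True] U_opt_3_copy ear_rel_subset]) (use c True in auto)
        then show ?thesis using R unfolding max3_def True by blast
      next
        case False
        show ?thesis
        proof (cases "\<Delta> = 3")
          case True
          then show ?thesis using R val3_le[OF d_bounds(2), of c] unfolding max3_def by linarith
        next
          case D: False
          then have "d + 3 \<le> n" using d_bounds \<Delta>3 by linarith
          then show ?thesis using R val3_less[of d n c] False unfolding max3_def by simp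
        qed
      qed
    next
      case e: 3
      have R: "3 * reverse_degree_distance H = val4 (int n) (int d) (int c)"
        unfolding val4_def by (rule rdd_ear4[OF e(2) refl c(1) e(1) d_bounds(2)]) simp
      consider "c = best4 n d" | "c \<noteq> best4 n d" "\<not> (n = d + 2 \<and> odd d \<and> c + 1 = best4 n d)"
        | "n = d + 2" "odd d" "c + 1 = best4 n d" by blast
      then show ?thesis
      proof cases
        case b: 1
        have "graph_iso H (U_opt n 4 d)"
          by (rule copy_iso[OF e(2)[unfolded b] U_opt_4_copy ear_rel_subset]) (use best4_bounds in auto)
        then show ?thesis using R unfolding max4_def b by blast
      next
        case 2
        have "val4 (int n) (int d) (int c) < max4" unfolding max4_def
          by (rule val4_less[OF d_bounds(2) _ 2(1)]) (use 2 d_bounds in auto)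
        then show ?thesis using R by simp
      next
        \<comment> \<open>The tied position of a 4-cycle without pendant vertices: reflecting the
          path turns it into the best one, so the graph is still the candidate.\<close>
        case 3
        have m: "d - c - 2 = best4 n d" "d - c = best4 n d + 2"
          using 3 e(1) by (auto simp: best4_def elim!: oddE)
        have "copy H n (ear_rel d (d - c - 2) (d - c) (d - c - 2) n)"
          by (rule ear_swap_copy[OF e(2) 3(1) e(1)])
        then have cp: "copy H n (ear_rel d (best4 n d) (best4 n d + 2) (best4 n d) n)" unfolding m(2) diff_add_inverse2 .
        have "graph_iso H (U_opt n 4 d)"
          by (rule copy_iso[OF cp U_opt_4_copy ear_rel_subset]) (use best4_bounds in auto)
        moreover have "3 * reverse_degree_distance H = max4"
          unfolding max4_def val4_def by (rule rdd_ear4[OF cp refl best4_bounds d_bounds(2)]) simp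
        ultimately show ?thesis by blast
      qed
    qed
  qed
qed

lemma maximal_max:
  fixes G :: "nat ugraph"
  assumes G: "is_maximal n \<Delta> G"
  shows "G \<in> unicyclic_class n \<Delta>" "max3 \<le> 3 * reverse_degree_distance G" "max4 \<le> 3 * reverse_degree_distance G"
proof -
  have g: "G \<in> unicyclic_class n \<Delta>"
    "\<And>H :: nat ugraph. H \<in> unicyclic_class n \<Delta> \<Longrightarrow> reverse_degree_distance H \<le> reverse_degree_distance G"
    using G unfolding is_maximal_def by auto
  show "G \<in> unicyclic_class n \<Delta>" by (rule g(1))
  show "max3 \<le> 3 * reverse_degree_distance G" using g(2)[OF U_opt_3(1)] U_opt_3(2) by linarith
  show "max4 \<le> 3 * reverse_degree_distance G" using g(2)[OF U_opt_4(1)] U_opt_4(2) by linarith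
qed

lemma class_le:
  fixes H :: "'a ugraph"
  assumes "H \<in> unicyclic_class n \<Delta>"
  shows "3 * reverse_degree_distance H \<le> max max3 max4"
  using classify[OF assms] by linarith

text \<open>Both candidates belong to the class, so a maximal graph reaches \<open>max4\<close>.
  This exceeds \<open>max3\<close> and leaves only the last alternative of
  \<open>classify\<close>.\<close>

lemma unique_4:
  assumes "max3 < max4"
  shows "unique_maximal_graphs n \<Delta> {U_opt n 4 d}"
proof -
  have "is_maximal n \<Delta> (U_opt n 4 d)" unfolding is_maximal_def
  proof (intro conjI allI impI)
    show "U_opt n 4 d \<in> unicyclic_class n \<Delta>" by (rule U_opt_4(1))
    fix H :: "nat ugraph" assume "H \<in> unicyclic_class n \<Delta>"
    then show "reverse_degree_distance H \<le> reverse_degree_distance (U_opt n 4 d)"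
      using class_le[of H] U_opt_4(2) assms by linarith
  qed
  moreover have "graph_iso G (U_opt n 4 d)" if "is_maximal n \<Delta> G" for G :: "nat ugraph"
    using classify[OF maximal_max(1)[OF that]] maximal_max(2,3)[OF that] assms by linarith
  ultimately show ?thesis unfolding unique_maximal_graphs_def by blast
qed

lemma unique_3:
  assumes "max4 < max3" "\<Delta> \<noteq> 3"
  shows "unique_maximal_graphs n \<Delta> {U_opt n 3 d}"
proof -
  have "is_maximal n \<Delta> (U_opt n 3 d)" unfolding is_maximal_def
  proof (intro conjI allI impI)
    show "U_opt n 3 d \<in> unicyclic_class n \<Delta>" by (rule U_opt_3(1))
    fix H :: "nat ugraph" assume "H \<in> unicyclic_class n \<Delta>"
    then show "reverse_degree_distance H \<le> reverse_degree_distance (U_opt n 3 d)"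
      using class_le[of H] U_opt_3(2) assms by linarith
  qed
  moreover have "graph_iso G (U_opt n 3 d)" if "is_maximal n \<Delta> G" for G :: "nat ugraph"
    using classify[OF maximal_max(1)[OF that]] maximal_max(2,3)[OF that] assms by linarith
  ultimately show ?thesis unfolding unique_maximal_graphs_def by blast
qed

lemma unique_34:
  assumes "max4 = max3" "\<Delta> \<noteq> 3"
  shows "unique_maximal_graphs n \<Delta> {U_opt n 3 d, U_opt n 4 d}"
proof -
  have "is_maximal n \<Delta> U" if "U \<in> {U_opt n 3 d, U_opt n 4 d}" for U unfolding is_maximal_def
  proof (intro conjI allI impI)
    show "U \<in> unicyclic_class n \<Delta>" using that U_opt_3(1) U_opt_4(1) by blast
    have U: "3 * reverse_degree_distance U = max3" using that U_opt_3(2) U_opt_4(2) assms(1) by auto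
    fix H :: "nat ugraph" assume "H \<in> unicyclic_class n \<Delta>"
    then show "reverse_degree_distance H \<le> reverse_degree_distance U"
      using class_le[of H] U assms by linarith
  qed
  moreover have "graph_iso G (U_opt n 3 d) \<or> graph_iso G (U_opt n 4 d)" if "is_maximal n \<Delta> G" for G :: "nat ugraph"
    using classify[OF maximal_max(1)[OF that]] maximal_max(2,3)[OF that] assms by linarith
  ultimately show ?thesis unfolding unique_maximal_graphs_def by blast
qed

text \<open>Both candidates use the same position, so \<open>rdd_base\<close> cancels and
  \<open>18 * (d - d div 2) - 3 * n - 30\<close> is left. Its sign decides between triangle and
  4-cycle.\<close>

lemma max_diff:
  assumes "best4 n d = d div 2"
  shows "max4 - max3 = 3 * (6 * int ((n - \<Delta>) div 2) - (int n + 4))"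
proof -
  have e: "d - d div 2 = (n - \<Delta>) div 2 + 1" using d by linarith
  have "int d - int (d div 2) = int (d - d div 2)" by linarith
  then have "int d - int (d div 2) = int ((n - \<Delta>) div 2) + 1" unfolding e by simp
  then show ?thesis unfolding max4_def max3_def val4_def val3_def assms by simp
qed

text \<open>The 4-cycle sits one position lower, which costs \<open>6 * R\<close>. The result is
  \<open>6 * d - 18\<close> for \<open>n = d + 2\<close> and \<open>6 * d - 33\<close> for
  \<open>n = d + 3\<close>. The latter is negative only for \<open>d = 4\<close>, the smallest even
  diameter here, and this is the exception \<open>n = 7\<close>.\<close>

lemma max_diff_pred:
  assumes "best4 n d + 1 = d div 2" "even d"
  shows "max4 - max3 = 6 * (2 * (int n - int d - 1) + 1) * (-1) + 9 * int d + 6 - 3 * int n"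
proof -
  obtain e where e: "d = 2 * e" using assms(2) by (elim evenE)
  then have b: "int (best4 n d) = int e - 1" "d div 2 = e" using assms(1) by auto
  show ?thesis unfolding max4_def max3_def val4_def val3_def b rdd_base_def pathsum_def
    using e by (simp add: algebra_simps)
qed

end

text \<open>In the clause for \<Delta> = 4 and odd \<open>n > 7\<close>, \<open>U 1\<close> has
  maximum degree 3 and thus lies outside the class. The clause therefore asserts that it has the
  maximal value, not that it is maximal in the class.\<close>

theorem theorem4:
  fixes n \<Delta> :: nat
  assumes "6 \<le> n" and "3 \<le> \<Delta>" and "\<Delta> \<le> n - 3"
  shows
    "(\<Delta> = 3 \<longrightarrow> unique_maximal_graphs n \<Delta> {U_opt n 4 (n - 2)}) \<and>
     (\<Delta> = 4 \<and> n = 7 \<longrightarrow> unique_maximal_graphs n \<Delta> {U_opt 7 3 4}) \<and>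
     (\<Delta> = 4 \<and> 7 < n \<and> odd n \<longrightarrow>
        (let a = (n - 5) div 2; U = (\<lambda>k. U_graph k n 4 (n - 3) a a) in
           is_maximal n \<Delta> (U 0) \<and>
           reverse_degree_distance (U 1) = reverse_degree_distance (U 0) \<and>
           (\<forall>G :: nat ugraph. is_maximal n \<Delta> G \<longrightarrow> (\<exists>k \<in> {0, 1}. graph_iso G (U k))))) \<and>
     ((\<Delta> = 4 \<and> even n) \<or> 5 \<le> \<Delta> \<longrightarrow>
        (real ((n - \<Delta>) div 2) > (real n + 4) / 6 \<longrightarrow>
           unique_maximal_graphs n \<Delta> {U_opt n 4 (n - \<Delta> + 1)}) \<and>
        (real ((n - \<Delta>) div 2) = (real n + 4) / 6 \<longrightarrow>
           unique_maximal_graphs n \<Delta> {U_opt n 3 (n - \<Delta> + 1), U_opt n 4 (n - \<Delta> + 1)}) \<and>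
        (real ((n - \<Delta>) div 2) < (real n + 4) / 6 \<longrightarrow>
           unique_maximal_graphs n \<Delta> {U_opt n 3 (n - \<Delta> + 1)}))"
proof -
  define d where "d = n - \<Delta> + 1"
  note A = assms d_def
  have d4: "4 \<le> d" "\<Delta> + d = n + 1" using assms by (auto simp: d_def)
  have part1: "unique_maximal_graphs n \<Delta> {U_opt n 4 (n - 2)}" if "\<Delta> = 3"
  proof -
    have nd: "n = d + 2" "n - 2 = d" using that assms by (auto simp: d_def)
    have "max3 n d < max4 n d"
    proof (cases "even d")
      case True
      then have "best4 n d + 1 = d div 2" using d4 nd by (auto simp: best4_def elim!: evenE)
      from max_diff_pred[OF A this True] show ?thesis using nd d4 by simp
    next
      case False
      then have "best4 n d = d div 2" using nd by (auto simp: best4_def elim!: oddE)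
      from max_diff[OF A this] have "max4 n d - max3 n d = 3 * (6 * int ((n - \<Delta>) div 2) - (int n + 4))" .
      moreover have "2 * ((n - \<Delta>) div 2) = n - 3" using False nd that by (auto elim!: oddE)
      then have "2 * int ((n - \<Delta>) div 2) = int n - 3" using assms that by linarith
      \<comment> \<open>The difference equals \<open>3 * (2 * n - 13)\<close>, which is positive
        from \<open>n = 7\<close> on; for \<open>n = 6\<close> the diameter is 4, which is
        even.\<close>
      moreover have "6 < n" using False nd(1) d4(1) by presburger
      ultimately show ?thesis unfolding right_diff_distrib distrib_left by linarith
    qed
    from unique_4[OF A this] show ?thesis unfolding nd(2) .
  qed
  have odd4: "best4 n d + 1 = d div 2" "even d" "int d = int n - 3" if "\<Delta> = 4" "odd n"
  proof -
    have nd: "n = d + 3" using that assms by (auto simp: d_def)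
    then show "even d" using that by simp
    then show "best4 n d + 1 = d div 2" using nd d4 by (auto simp: best4_def elim!: evenE)
    show "int d = int n - 3" using nd by simp
  qed
  have part2: "unique_maximal_graphs n \<Delta> {U_opt 7 3 4}" if "\<Delta> = 4" "n = 7"
  proof -
    have "odd n" using that by simp
    from max_diff_pred[OF A odd4(1,2)[OF that(1) this]] odd4(3)[OF that(1) this]
    have "max4 n d < max3 n d" using that by simp
    from unique_3[OF A this] show ?thesis using that by (simp add: d_def)
  qed
  have part3: "let a = (n - 5) div 2; U = (\<lambda>k. U_graph k n 4 (n - 3) a a) in
           is_maximal n \<Delta> (U 0) \<and>
           reverse_degree_distance (U 1) = reverse_degree_distance (U 0) \<and>
           (\<forall>G :: nat ugraph. is_maximal n \<Delta> G \<longrightarrow> (\<exists>k \<in> {0, 1}. graph_iso G (U k)))"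
    if "\<Delta> = 4" "7 < n" "odd n"
  proof -
    note o = odd4[OF that(1,3)]
    \<comment> \<open>This makes \<open>d \<ge> 6\<close>, so that \<open>6 * d - 33\<close> is
      positive.\<close>
    have "9 \<le> n" using that(2,3) by presburger
    then have "max3 n d < max4 n d" using max_diff_pred[OF A o(1,2)] o(3) by simp
    note u = unique_4[OF A this]
    define a where "a = (n - 5) div 2"
    have nd: "n - 3 = d" "n = d + 3" using that assms by (auto simp: d_def)
    have da: "d = 2 * a + 2" using o(2) nd d4 unfolding a_def by (auto elim!: evenE)
    have ab: "best4 n d = a" "d - 2 - a = a" using o(1) da by auto
    have U: "U_opt n 4 d = U_graph 0 n 4 (n - 3) a a"
      using U_opt_4_eq[OF A] unfolding ab nd(1) .
    \<comment> \<open>The pendant vertex sits at position \<open>a + 1\<close>, the centre of the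
      path because \<open>d = 2 * a + 2\<close>; this is the second alternative of
      \<open>rdd_ear4\<close>.\<close>
    have "copy (U_graph 1 n 4 d a a) n (ear_rel d a (a + 2) (a + 1) n)"
      using U_4_copy[OF A, of 1] unfolding ab by simp
    from rdd_ear4[OF this refl] da d4 nd
    have "3 * reverse_degree_distance (U_graph 1 n 4 d a a) = val4 (int n) (int d) (int a)" unfolding val4_def by simp
    moreover have "3 * reverse_degree_distance (U_opt n 4 d) = val4 (int n) (int d) (int a)"
      using U_opt_4(2)[OF A] unfolding max4_def[OF A] ab .
    ultimately have "reverse_degree_distance (U_graph 1 n 4 (n - 3) a a) = reverse_degree_distance (U_graph 0 n 4 (n - 3) a a)"
      unfolding U nd(1) by linarith
    then show ?thesis using u unfolding U unique_maximal_graphs_def Let_def a_def[symmetric] by auto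
  qed
  have best: "best4 n d = d div 2" if "(\<Delta> = 4 \<and> even n) \<or> 5 \<le> \<Delta>"
    using that
  proof
    assume "\<Delta> = 4 \<and> even n"
    then have "n = d + 3" "odd d" using d4 by (auto simp: d_def)
    then show ?thesis by (auto simp: best4_def elim!: oddE)
  next
    assume "5 \<le> \<Delta>" then show ?thesis using d4 by (simp add: best4_def)
  qed
  have part4: "(real ((n - \<Delta>) div 2) > (real n + 4) / 6 \<longrightarrow> unique_maximal_graphs n \<Delta> {U_opt n 4 d}) \<and>
        (real ((n - \<Delta>) div 2) = (real n + 4) / 6 \<longrightarrow> unique_maximal_graphs n \<Delta> {U_opt n 3 d, U_opt n 4 d}) \<and>
        (real ((n - \<Delta>) div 2) < (real n + 4) / 6 \<longrightarrow> unique_maximal_graphs n \<Delta> {U_opt n 3 d})"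
    if "(\<Delta> = 4 \<and> even n) \<or> 5 \<le> \<Delta>"
  proof -
    note D = max_diff[OF A best[OF that]]
    have "\<Delta> \<noteq> 3" using that by auto
    define q where "q = (n - \<Delta>) div 2"
    \<comment> \<open>Clearing the denominator 6 turns the real threshold into the sign of the
      integer difference in \<open>max_diff\<close>.\<close>
    have e: "real n + 4 = real (n + 4)" "real q * 6 = real (q * 6)" by simp_all
    have "real q > (real n + 4) / 6 \<longleftrightarrow> n + 4 < q * 6"
      unfolding divide_less_eq_numeral1 e of_nat_less_iff ..
    moreover have "real q = (real n + 4) / 6 \<longleftrightarrow> q * 6 = n + 4"
      unfolding eq_divide_eq_numeral1 e of_nat_eq_iff by simp
    moreover have "real q < (real n + 4) / 6 \<longleftrightarrow> q * 6 < n + 4"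
      unfolding less_divide_eq_numeral1 e of_nat_less_iff ..
    ultimately have "real q > (real n + 4) / 6 \<longleftrightarrow> 6 * int q > int n + 4"
      "real q = (real n + 4) / 6 \<longleftrightarrow> 6 * int q = int n + 4"
      "real q < (real n + 4) / 6 \<longleftrightarrow> 6 * int q < int n + 4" by linarith+
    then show ?thesis using unique_4[OF A] unique_34[OF A _ \<open>\<Delta> \<noteq> 3\<close>] unique_3[OF A _ \<open>\<Delta> \<noteq> 3\<close>] D
      unfolding q_def[symmetric] by auto
  qed
  show ?thesis
    using part1 part2 part3 part4 unfolding d_def[symmetric] by blast
qed

end
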